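(* There holds $$\mathcal{E}_\alpha^\star(\Gamma)=\mathcal{K}^{\beta/2}(\Gamma).$$
   Context: Fix $n\ge 2$, $-1<\alpha<1$, $\beta:=1-\alpha\in(0,2)$. Let $\Gamma=\bigcup_{\ell\in I}\Gamma_\ell$, where the $\Gamma_\ell$ are finitely many compact, connected, mutually disjoint, boundaryless, $(n-1)$-dimensional, oriented $C^\infty$-manifolds immersed into $\mathbb R^n$; $\mathrm ds$ is the surface measure on $\Gamma$. With each $\Gamma_\ell$ a prescribed sign $\alpha_\ell\in\{-1,1\}$ is associated. $\mathfrak M^+(\Gamma)$ is the convex cone of all signed Borel measures of the form $\boldsymbol\mu=\sum_{\ell\in I}\alpha_\ell\mu^\ell$ with $\mu^\ell$ a nonnegative Borel (Radon) measure on $\Gamma_\ell$. $$\mathcal K^{\beta/2}(\Gamma):=\Big\{\boldsymbol\sigma=\sum_{\ell\in I}\alpha_\ell\sigma^\ell:\ \sigma^\ell\in H^{\beta/2}(\Gamma_\ell),\ \sigma^\ell\ge0\Big\};$$ an absolutely continuous measure $\boldsymbol\Sigma\in\mathfrak M^+(\Gamma)$ with $\mathrm d\boldsymbol\Sigma=\boldsymbol\sigma\,\mathrm ds$, $\boldsymbol\sigma\in\mathcal K^{\beta/2}(\Gamma)$, is identified with its density, and the cone of such measures is also denoted $\mathcal K^{\beta/2}(\Gamma)$. Localization: for each $\ell\in I$ fix a finite $C^\infty$-atlas of $\Gamma_\ell$ with charts $(O_{\ell r},\mathcal U_{\ell r},\mathcal X_{\ell r})$, $r\in R_\ell$, where $O_{\ell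 r}\subset\Gamma_\ell$ are open and cover $\Gamma_\ell$ and $\mathcal X_{\ell r}:O_{\ell r}\to\mathcal U_{\ell r}\subset\mathbb R^{n-1}$ is a $C^\infty$-diffeomorphism, and let $\{\beta_{\ell r}\}_{r\in R_\ell}$ be a $C^\infty$-partition of unity of $\Gamma_\ell$ subordinate to this atlas. For $\boldsymbol\Sigma\in\mathfrak M^+(\Gamma)$ let $\boldsymbol\Sigma_{\ell r}:=\mathcal X_{\ell r\star}\beta_{\ell r}\boldsymbol\Sigma$ be the pushforward of $\beta_{\ell r}\boldsymbol\Sigma$ under $\mathcal X_{\ell r}$, a distribution with compact support in $\mathcal U_{\ell r}\subset\mathbb R^{n-1}$, and $\widehat{\boldsymbol\Sigma}_{\ell r}$ its Fourier transform on $\mathbb R^{n-1}$. $\mathcal E_\alpha^\star(\Gamma)$ consists of all $\boldsymbol\Sigma\in\mathfrak M^+(\Gamma)$ such that (for all $\ell\in I$, $r\in R_\ell$) $$\int_{\mathbb R^{n-1}}|\boldsymbol\xi'|^\beta\,|\widehat{\boldsymbol\Sigma}_{\ell r}(\boldsymbol\xi')|^2\,\mathrm d\boldsymbol\xi'<\infty .$$ (In the paper these are the measures of finite Riesz energy.) *)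

theory Defs
  imports "HOL-Analysis.Analysis"
begin

section \<open>Smooth maps between Euclidean spaces\<close>

text \<open>Meant for open \<open>U\<close>: class \<open>C\<^sup>k\<close> by recursion over directional derivatives.\<close>

primrec Ck_on :: "nat \<Rightarrow> 'u::euclidean_space set \<Rightarrow> ('u \<Rightarrow> 'w::real_normed_vector) \<Rightarrow> bool" where
  "Ck_on 0 U f \<longleftrightarrow> continuous_on U f"
| "Ck_on (Suc k) U f \<longleftrightarrow>
     f differentiable_on U \<and> (\<forall>v. Ck_on k U (\<lambda>x. frechet_derivative f (at x) v))"

definition smooth_map_on :: "'u::euclidean_space set \<Rightarrow> ('u \<Rightarrow> 'w::real_normed_vector) \<Rightarrow> bool" where
  "smooth_map_on U f \<longleftrightarrow> (\<forall>k. Ck_on k U f)"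


section \<open>Immersed hypersurfaces\<close>

text \<open>
  A manifold is a subset \<open>S\<close> of a Hausdorff space together with a maximal \<open>C\<^sup>\<infinity>\<close>-atlas. A chart is a
  pair \<open>(D, X)\<close> of its domain \<open>D \<subseteq> S\<close> and a map \<open>X\<close> whose values off \<open>D\<close> are irrelevant; its inverse
  is \<open>inv_into D X\<close>, used on the open set \<open>X ` D\<close> only. Chart images are open in the whole of the
  model space, so there is no boundary.
\<close>

type_synonym ('a, 'm) chart = "'a set \<times> ('a \<Rightarrow> real ^ 'm)"

definition chart_on :: "'a::t2_space set \<Rightarrow> ('a, 'm::finite) chart \<Rightarrow> bool" where
  "chart_on S = (\<lambda>(D, X). openin (top_of_set S) D \<and> open (X ` D) \<and>
     homeomorphism D (X ` D) X (inv_into D X))"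

definition compatible_charts :: "('a, 'm::finite) chart \<Rightarrow> ('a, 'm) chart \<Rightarrow> bool" where
  "compatible_charts = (\<lambda>(D, X) (E, Y).
     smooth_map_on (X ` (D \<inter> E)) (Y \<circ> inv_into D X) \<and>
     smooth_map_on (Y ` (D \<inter> E)) (X \<circ> inv_into E Y))"

definition smooth_structure :: "'a::t2_space set \<Rightarrow> ('a, 'm::finite) chart set \<Rightarrow> bool" where
  "smooth_structure S A \<longleftrightarrow>
     (\<forall>c\<in>A. chart_on S c) \<and> (\<Union>c\<in>A. fst c) = S \<and>
     (\<forall>c\<in>A. \<forall>d\<in>A. compatible_charts c d) \<and>
     (\<forall>c. chart_on S c \<and> (\<forall>d\<in>A. compatible_charts c d) \<longrightarrow> c \<in> A)"

definition orientable :: "'a set \<Rightarrow> ('a, 'm::finite) chart set \<Rightarrow> bool" where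
  "orientable S A \<longleftrightarrow> (\<exists>B\<subseteq>A. (\<Union>c\<in>B. fst c) = S \<and>
     (\<forall>(D, X)\<in>B. \<forall>(E, Y)\<in>B. \<forall>u\<in>X ` (D \<inter> E).
        det (matrix (frechet_derivative (Y \<circ> inv_into D X) (at u))) > 0))"

definition smooth_immersion ::
  "('a, 'm::finite) chart set \<Rightarrow> ('a \<Rightarrow> real ^ 'n::finite) \<Rightarrow> bool" where
  "smooth_immersion A \<iota> \<longleftrightarrow> (\<forall>(D, X)\<in>A. smooth_map_on (X ` D) (\<iota> \<circ> inv_into D X) \<and>
     (\<forall>u\<in>X ` D. inj (frechet_derivative (\<iota> \<circ> inv_into D X) (at u))))"

text \<open>
  The immersion \<open>\<iota>\<close> need not be globally injective; an embedded hypersurface is the case where \<open>\<iota>\<close> is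
  the inclusion of a subset of \<open>real ^ 'n\<close>. The codimension is one when \<open>CARD('m) = CARD('n) - 1\<close>.
\<close>

definition closed_immersed_manifold ::
  "'a::t2_space set \<Rightarrow> ('a, 'm::finite) chart set \<Rightarrow> ('a \<Rightarrow> real ^ 'n::finite) \<Rightarrow> bool" where
  "closed_immersed_manifold S A \<iota> \<longleftrightarrow>
     compact S \<and> connected S \<and> smooth_structure S A \<and> orientable S A \<and> smooth_immersion A \<iota>"

definition smooth_function :: "('a, 'm::finite) chart set \<Rightarrow> ('a \<Rightarrow> real) \<Rightarrow> bool" where
  "smooth_function A f \<longleftrightarrow> (\<forall>(D, X)\<in>A. smooth_map_on (X ` D) (f \<circ> inv_into D X))"

definition finite_atlas ::
  "'a set \<Rightarrow> ('a, 'm::finite) chart set \<Rightarrow> 'r set \<Rightarrow> ('r \<Rightarrow> 'a set) \<Rightarrow> ('r \<Rightarrow> 'a \<Rightarrow> real ^ 'm) \<Rightarrow> bool" where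
  "finite_atlas S A R D X \<longleftrightarrow> finite R \<and> (\<forall>r\<in>R. (D r, X r) \<in> A) \<and> (\<Union>r\<in>R. D r) = S"

definition subordinate_partition_of_unity ::
  "'a::t2_space set \<Rightarrow> ('a, 'm::finite) chart set \<Rightarrow> 'r set \<Rightarrow> ('r \<Rightarrow> 'a set) \<Rightarrow> ('r \<Rightarrow> 'a \<Rightarrow> real) \<Rightarrow> bool" where
  "subordinate_partition_of_unity S A R D b \<longleftrightarrow>
     (\<forall>r\<in>R. smooth_function A (b r) \<and> (\<forall>x\<in>S. 0 \<le> b r x) \<and> closure {x\<in>S. b r x \<noteq> 0} \<subseteq> D r) \<and>
     (\<forall>x\<in>S. (\<Sum>r\<in>R. b r x) = 1)"

text \<open>
  The surface measure is the Riemannian volume of the metric induced by \<open>\<iota>\<close>: in a chart it has density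
  \<open>sqrt (det (J\<^sup>T J))\<close>, where \<open>J\<close> is the Jacobian matrix of the local parametrization. These conditions
  determine the measure uniquely.
\<close>

definition gram_density :: "(real ^ 'm::finite \<Rightarrow> real ^ 'n::finite) \<Rightarrow> real ^ 'm \<Rightarrow> real" where
  "gram_density \<Phi> u = (let J = matrix (frechet_derivative \<Phi> (at u)) in sqrt (det (transpose J ** J)))"

definition surface_measure ::
  "'l set \<Rightarrow> ('l \<Rightarrow> 'a::t2_space set) \<Rightarrow> ('l \<Rightarrow> ('a, 'm::finite) chart set) \<Rightarrow> ('a \<Rightarrow> real ^ 'n::finite) \<Rightarrow>
   'a measure \<Rightarrow> bool" where
  "surface_measure I \<Gamma> A \<iota> ds \<longleftrightarrow>
     sets ds = sets (restrict_space borel (\<Union>l\<in>I. \<Gamma> l)) \<and>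
     (\<forall>l\<in>I. \<forall>(D, X)\<in>A l. \<forall>B\<in>sets ds. B \<subseteq> D \<longrightarrow>
        emeasure ds B =
          (\<integral>\<^sup>+u\<in>X ` B. ennreal (gram_density (\<iota> \<circ> inv_into D X) u) \<partial>lborel))"


section \<open>Sobolev spaces of order between 0 and 1\<close>

text \<open>
  Sobolev-Slobodetskii definition, for \<open>0 < s < 1\<close>. Elements are Borel representatives of
  almost-everywhere classes. On the diagonal the quotient is \<open>0 / 0 = 0\<close>.
\<close>

definition sobolev_space :: "real \<Rightarrow> (real ^ 'm::finite \<Rightarrow> real) set" where
  "sobolev_space s = {v \<in> borel_measurable borel.
     (\<integral>\<^sup>+x. ennreal ((v x)\<^sup>2) \<partial>lborel) < \<infinity> \<and>
     (\<integral>\<^sup>+x. (\<integral>\<^sup>+y. ennreal ((v x - v y)\<^sup>2 / norm (x - y) powr (real CARD('m) + 2 * s)) \<partial>lborel) \<partial>lborel) < \<infinity>}"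

text \<open>Independent of any choice of a finite atlas: all charts and all cutoff functions are admitted.\<close>

definition sobolev_space_on ::
  "'a::t2_space set \<Rightarrow> ('a, 'm::finite) chart set \<Rightarrow> real \<Rightarrow> ('a \<Rightarrow> real) set" where
  "sobolev_space_on S A s = {u. \<forall>(D, X)\<in>A. \<forall>\<zeta>.
     smooth_function A \<zeta> \<and> closure {x\<in>S. \<zeta> x \<noteq> 0} \<subseteq> D \<longrightarrow>
     (\<lambda>v. if v \<in> X ` D then \<zeta> (inv_into D X v) * u (inv_into D X v) else 0) \<in> sobolev_space s}"


section \<open>The cones of signed measures\<close>

text \<open>
  A finite signed Borel measure on \<open>\<Gamma> = (\<Union>l\<in>I. \<Gamma> l)\<close> is a real-valued set function, extended by \<open>0\<close>
  to non-Borel sets. Nonnegative Radon measures on the compact \<open>\<Gamma> l\<close> are the finite Borel measures.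
\<close>

definition signed_measure_cone ::
  "'l set \<Rightarrow> ('l \<Rightarrow> 'a::t2_space set) \<Rightarrow> ('l \<Rightarrow> real) \<Rightarrow> ('a set \<Rightarrow> real) set" where
  "signed_measure_cone I \<Gamma> sg = {\<Sigma>. \<exists>\<mu>.
     (\<forall>l\<in>I. finite_measure (\<mu> l) \<and> sets (\<mu> l) = sets (restrict_space borel (\<Gamma> l))) \<and>
     \<Sigma> = (\<lambda>B. if B \<in> sets (restrict_space borel (\<Union>l\<in>I. \<Gamma> l))
               then \<Sum>l\<in>I. sg l * measure (\<mu> l) (B \<inter> \<Gamma> l) else 0)}"

definition sobolev_density_cone ::
  "'l set \<Rightarrow> ('l \<Rightarrow> 'a::t2_space set) \<Rightarrow> ('l \<Rightarrow> ('a, 'm::finite) chart set) \<Rightarrow> 'a measure \<Rightarrow>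
   ('l \<Rightarrow> real) \<Rightarrow> real \<Rightarrow> ('a \<Rightarrow> real) set" where
  "sobolev_density_cone I \<Gamma> A ds sg s = {\<sigma>. \<exists>\<tau>.
     (\<forall>l\<in>I. \<tau> l \<in> sobolev_space_on (\<Gamma> l) (A l) s \<and> (AE x in ds. x \<in> \<Gamma> l \<longrightarrow> 0 \<le> \<tau> l x)) \<and>
     \<sigma> = (\<lambda>x. \<Sum>l\<in>I. sg l * (indicator (\<Gamma> l) x * \<tau> l x))}"

definition sobolev_measure_cone ::
  "'l set \<Rightarrow> ('l \<Rightarrow> 'a::t2_space set) \<Rightarrow> ('l \<Rightarrow> ('a, 'm::finite) chart set) \<Rightarrow> 'a measure \<Rightarrow>
   ('l \<Rightarrow> real) \<Rightarrow> real \<Rightarrow> ('a set \<Rightarrow> real) set" where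
  "sobolev_measure_cone I \<Gamma> A ds sg s = {\<Sigma> \<in> signed_measure_cone I \<Gamma> sg.
     \<exists>\<sigma>\<in>sobolev_density_cone I \<Gamma> A ds sg s.
       integrable ds \<sigma> \<and> (\<forall>B\<in>sets ds. \<Sigma> B = (LINT x:B|ds. \<sigma> x))}"

text \<open>
  For \<open>\<Sigma> = (\<Sum>l\<in>I. sg l * \<mu> l)\<close> in the cone, \<open>component_measure (\<Gamma> l) (sg l) \<Sigma>\<close> is \<open>\<mu> l\<close>, because
  \<open>sg l\<close> is \<open>1\<close> or \<open>-1\<close> and the \<open>\<Gamma> l\<close> are disjoint. Thus the localized signed measure, the pushforward
  of \<open>b \<Sigma>\<close> under the chart \<open>X\<close>, is \<open>sg l\<close> times the nonnegative measure \<open>localized_measure\<close>.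
\<close>

definition component_measure :: "'a::t2_space set \<Rightarrow> real \<Rightarrow> ('a set \<Rightarrow> real) \<Rightarrow> 'a measure" where
  "component_measure S a \<Sigma> = measure_of S (sets (restrict_space borel S)) (\<lambda>B. ennreal (a * \<Sigma> B))"

definition localized_measure ::
  "'a measure \<Rightarrow> 'a set \<Rightarrow> ('a \<Rightarrow> real ^ 'm::finite) \<Rightarrow> ('a \<Rightarrow> real) \<Rightarrow> (real ^ 'm) measure" where
  "localized_measure \<mu> D X b = distr (density (restrict_space \<mu> D) (\<lambda>x. ennreal (b x))) borel X"

definition fourier_transform :: "'u::euclidean_space measure \<Rightarrow> 'u \<Rightarrow> complex" where
  "fourier_transform \<mu> \<xi> = (LINT x|\<mu>. cis (- (\<xi> \<bullet> x)))"

definition localized_fourier ::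
  "'a::t2_space set \<Rightarrow> real \<Rightarrow> ('a set \<Rightarrow> real) \<Rightarrow> 'a set \<Rightarrow> ('a \<Rightarrow> real ^ 'm::finite) \<Rightarrow> ('a \<Rightarrow> real) \<Rightarrow>
   real ^ 'm \<Rightarrow> complex" where
  "localized_fourier S a \<Sigma> D X b \<xi> =
     of_real a * fourier_transform (localized_measure (component_measure S a \<Sigma>) D X b) \<xi>"

definition finite_energy_cone ::
  "'l set \<Rightarrow> ('l \<Rightarrow> 'a::t2_space set) \<Rightarrow> ('l \<Rightarrow> real) \<Rightarrow> ('l \<Rightarrow> 'r set) \<Rightarrow> ('l \<Rightarrow> 'r \<Rightarrow> 'a set) \<Rightarrow>
   ('l \<Rightarrow> 'r \<Rightarrow> 'a \<Rightarrow> real ^ 'm::finite) \<Rightarrow> ('l \<Rightarrow> 'r \<Rightarrow> 'a \<Rightarrow> real) \<Rightarrow> real \<Rightarrow> ('a set \<Rightarrow> real) set" where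
  "finite_energy_cone I \<Gamma> sg R D X b \<alpha> = {\<Sigma> \<in> signed_measure_cone I \<Gamma> sg.
     \<forall>l\<in>I. \<forall>r\<in>R l.
       (\<integral>\<^sup>+\<xi>. ennreal (norm \<xi> powr (1 - \<alpha>) *
          (cmod (localized_fourier (\<Gamma> l) (sg l) \<Sigma> (D l r) (X l r) (b l r) \<xi>))\<^sup>2) \<partial>lborel) < \<infinity>}"

end

theory Submission
  imports Defs "HOL-Probability.Probability"
begin

text \<open>
  Everything reduces to finite measures on \<open>real ^ 'm\<close>. Mollifying with Gaussians, whose Fourier
  transforms are explicit, gives Plancherel's identity for integrable functions by Fubini and Fatou
  alone. Applied to \<open>v - v (h + \<cdot>)\<close> and integrated against \<open>norm h powr - (m + \<beta>)\<close>, it turns the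
  Gagliardo seminorm of \<open>v\<close> into a multiple of the energy
  \<open>\<integral> norm \<xi> powr \<beta> * \<bar>v^(\<xi>)\<bar>\<^sup>2\<close>; the constant comes from writing both powers as superpositions of
  Gaussians. A finite measure \<open>\<mu>\<close> of finite energy has \<open>\<mu>^\<close> in \<open>L\<^sup>2\<close>, so \<open>\<mu> U\<close> is at most a multiple of
  the square root of the volume of \<open>U\<close> for open \<open>U\<close>, and \<open>\<mu>\<close> has a density by Radon-Nikodym.

  Such densities are carried between charts and the surface because multiplication by a locally
  Lipschitz function and a locally bi-Lipschitz change of variables preserve the Sobolev space of
  order \<open>s < 1\<close> for functions supported in a fixed compact set.
\<close>

section \<open>Gaussian kernels\<close>

text \<open>The energy is measured in one fixed finite atlas, while membership in
  \<open>sobolev_space_on\<close> is tested in every chart against every cutoff. Local densities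
  found in the given charts therefore have to be moved to all others. This is done on the Gagliardo
  double integral, because multiplication and change of variables are hard to see on the Fourier
  side. The price is the pairs of points far apart and the increments of the Lipschitz factor; both
  are paid for by the integrability of min(1, |h|^2) / |h|^(m + \<beta>). That integral, and the one
  that defines the constant between seminorm and energy, converge at 0 because \<beta> < 2 and at
  infinity because \<beta> > 0. The identity between seminorm and energy holds in [0, \<infinity>],
  so it serves both inclusions. The weight |\<xi>|^\<beta> degenerates at 0, but the transform of a
  finite measure is bounded, so finite energy still controls the whole L2 norm of the transform.
  Each component is handled as a nonnegative measure, as Fatou's lemma requires; its sign has
  modulus one and drops out of the squared modulus.\<close>

definition gauss :: "real \<Rightarrow> 'a::euclidean_space \<Rightarrow> real" where
  "gauss t z = (\<Prod>i\<in>Basis. normal_density 0 t (z \<bullet> i))"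

text \<open>\<open>lborel\<close> on a Euclidean space is the image of the product of
  one-dimensional Lebesgue measures under the coordinate map, so the product rule for
  \<open>product_sigma_finite\<close> carries over. It reduces the mass and the Fourier transform of
  \<open>gauss\<close> to one dimension.\<close>

lemma
  fixes f :: "'a::euclidean_space \<Rightarrow> real \<Rightarrow> 'b::{real_normed_field,banach,second_countable_topology}"
  assumes f: "\<And>b. b \<in> Basis \<Longrightarrow> integrable lborel (f b)"
  shows integrable_lborel_prod: "integrable lborel (\<lambda>x. \<Prod>b\<in>Basis. f b (x \<bullet> b))"
    and integral_lborel_prod:
      "(LINT x|lborel. (\<Prod>b\<in>Basis. f b (x \<bullet> b))) = (\<Prod>b\<in>Basis. (LINT x|lborel. f b x))"
proof -
  interpret product_sigma_finite "\<lambda>_::'a. lborel :: real measure" ..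
  have [measurable]: "f b \<in> borel_measurable borel" if "b \<in> Basis" for b
    using borel_measurable_integrable[OF f[OF that]] by simp
  have eq: "(\<Prod>b\<in>Basis. f b ((\<Sum>c\<in>Basis. g c *\<^sub>R c) \<bullet> b)) = (\<Prod>b\<in>Basis. f b (g b))" for g :: "'a \<Rightarrow> real"
    by (intro prod.cong refl arg_cong[where f = "f _"]) simp
  have m: "(\<lambda>f. \<Sum>b\<in>Basis. f b *\<^sub>R b) \<in> measurable (\<Pi>\<^sub>M b\<in>Basis. lborel) (borel :: 'a measure)"
    by measurable
  show "integrable lborel (\<lambda>x. \<Prod>b\<in>Basis. f b (x \<bullet> b))"
    by (subst lborel_eq, subst integrable_distr_eq[OF m])
      (simp_all add: eq product_integrable_prod f)
  show "(LINT x|lborel. (\<Prod>b\<in>Basis. f b (x \<bullet> b))) = (\<Prod>b\<in>Basis. (LINT x|lborel. f b x))"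
    by (subst lborel_eq, subst integral_distr[OF m]) (simp_all add: eq product_integral_prod f)
qed

lemma gauss_measurable [measurable]: "gauss t \<in> borel_measurable borel"
  unfolding gauss_def by measurable

lemma gauss_nonneg [simp]: "0 \<le> gauss t z"
  unfolding gauss_def by (simp add: prod_nonneg)

text \<open>The product form serves integration, this radial form serves pointwise bounds and
  scaling. The parameter \<open>t\<close> is the standard deviation.\<close>

lemma gauss_eq:
  fixes z :: "'a::euclidean_space"
  shows "gauss t z = (1 / sqrt (2 * pi * t\<^sup>2)) ^ DIM('a) * exp (- (norm z)\<^sup>2 / (2 * t\<^sup>2))"
proof -
  have "(norm z)\<^sup>2 = (\<Sum>i\<in>Basis. (z \<bullet> i)\<^sup>2)"
    unfolding power2_norm_eq_inner by (subst euclidean_inner) (simp add: power2_eq_square)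
  then show ?thesis
    by (simp add: gauss_def normal_density_def prod.distrib prod_dividef exp_sum[OF finite_Basis, symmetric] sum_negf sum_divide_distrib[symmetric] power_divide)
qed

lemma gauss_le: "gauss t (z::'a::euclidean_space) \<le> (1 / sqrt (2 * pi * t\<^sup>2)) ^ DIM('a)"
  unfolding gauss_eq by (intro mult_left_le) auto

lemma gauss_minus_commute: "gauss t (x - y) = gauss t (y - x)"
  by (simp add: gauss_eq norm_minus_commute)

lemma integrable_gauss [simp, intro]: "t > 0 \<Longrightarrow> integrable lborel (gauss t)"
  unfolding gauss_def[abs_def] by (intro integrable_lborel_prod) auto

lemma integral_gauss [simp]: "t > 0 \<Longrightarrow> (LINT z|lborel. gauss t z) = 1"
  unfolding gauss_def by (subst integral_lborel_prod) auto

lemma nn_integral_gauss [simp]: "t > 0 \<Longrightarrow> (\<integral>\<^sup>+z. ennreal (gauss t z) \<partial>lborel) = 1"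
  by (subst nn_integral_eq_integral) auto

lemma cis_measurable [measurable]: "cis \<in> borel_measurable borel"
  by (intro borel_measurable_continuous_onI continuous_intros)

text \<open>Substituting \<open>t * x\<close> for the variable turns the integral into the
  characteristic function of the standard normal distribution at \<open>t * a\<close>.\<close>

lemma normal_density_char:
  assumes "t > 0"
  shows "(LINT x|lborel. cis (a * x) * complex_of_real (normal_density 0 t x)) = exp (- (t * a)\<^sup>2 / 2)"
proof -
  have "(LINT x|lborel. cis (a * x) * complex_of_real (normal_density 0 t x))
      = t *\<^sub>R (LINT x|lborel. cis (a * (t * x)) * complex_of_real (normal_density 0 t (t * x)))"
    using assms by (subst lborel_integral_real_affine[where c = t and t = 0]) auto
  also have "\<dots> = (LINT x|lborel. std_normal_density x *\<^sub>R iexp (t * a * x))"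
    unfolding integral_scaleR_right[symmetric] using assms
    by (intro Bochner_Integration.integral_cong refl)
      (simp add: normal_density_def real_sqrt_mult power_mult_distrib cis_conv_exp scaleR_conv_of_real mult_ac)
  also have "\<dots> = char std_normal_distribution (t * a)"
    unfolding char_def by (subst integral_density) (auto simp: normal_density_nonneg)
  finally show ?thesis by (simp add: char_std_normal_distribution)
qed

lemma cis_sum: "finite A \<Longrightarrow> cis (\<Sum>i\<in>A. f i) = (\<Prod>i\<in>A. cis (f i))"
  by (induction A rule: finite_induct) (auto simp: cis_mult[symmetric])

text \<open>\<open>cis\<close> turns the sum in the inner product into a product over the
  coordinates, so the one-dimensional formula can be multiplied up.\<close>

lemma gauss_fourier_complex:
  fixes \<xi> :: "'a::euclidean_space"
  assumes "t > 0"
  shows "integrable lborel (\<lambda>z. cis (\<xi> \<bullet> z) * complex_of_real (gauss t z))"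
    and "(LINT z|lborel. cis (\<xi> \<bullet> z) * complex_of_real (gauss t z)) = exp (- (t * norm \<xi>)\<^sup>2 / 2)"
proof -
  have eq: "cis (\<xi> \<bullet> z) * complex_of_real (gauss t z)
     = (\<Prod>i\<in>Basis. cis ((\<xi> \<bullet> i) * (z \<bullet> i)) * complex_of_real (normal_density 0 t (z \<bullet> i)))" for z
    by (subst euclidean_inner) (simp add: cis_sum prod.distrib gauss_def)
  have i: "integrable lborel (\<lambda>x. cis (a * x) * complex_of_real (normal_density 0 t x))" for a
    by (rule Bochner_Integration.integrable_bound[where f = "normal_density 0 t"])
      (use assms in \<open>auto simp: norm_mult\<close>)
  show "integrable lborel (\<lambda>z. cis (\<xi> \<bullet> z) * complex_of_real (gauss t z))"
    unfolding eq by (rule integrable_lborel_prod[OF i])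
  have "(norm \<xi>)\<^sup>2 = (\<Sum>i\<in>Basis. (\<xi> \<bullet> i)\<^sup>2)"
    unfolding power2_norm_eq_inner by (subst euclidean_inner) (simp add: power2_eq_square)
  then have n: "(\<Prod>i\<in>Basis. exp (- (t * (\<xi> \<bullet> i))\<^sup>2 / 2)) = exp (- (t * norm \<xi>)\<^sup>2 / 2)"
    by (simp add: exp_sum[symmetric] sum_negf sum_divide_distrib[symmetric] power_mult_distrib sum_distrib_left[symmetric])
  show "(LINT z|lborel. cis (\<xi> \<bullet> z) * complex_of_real (gauss t z)) = exp (- (t * norm \<xi>)\<^sup>2 / 2)"
    unfolding eq by (subst integral_lborel_prod[OF i])
      (simp only: normal_density_char[OF assms] of_real_prod[symmetric] n)
qed

lemma gauss_fourier:
  fixes \<xi> :: "'a::euclidean_space"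
  assumes "t > 0"
  shows "(LINT z|lborel. cos (\<xi> \<bullet> z) * gauss t z) = exp (- (t * norm \<xi>)\<^sup>2 / 2)"
proof -
  have "Re (LINT z|lborel. cis (\<xi> \<bullet> z) * complex_of_real (gauss t z)) = (LINT z|lborel. cos (\<xi> \<bullet> z) * gauss t z)"
    by (subst integral_Re[symmetric]) (use gauss_fourier_complex[OF assms] in auto)
  then show ?thesis by (simp add: gauss_fourier_complex[OF assms])
qed

section \<open>Scaling, translation and reflection of Lebesgue integrals\<close>

lemma gauss_scale:
  fixes z :: "'a::euclidean_space"
  assumes "t > 0"
  shows "gauss t (t *\<^sub>R z) = gauss 1 z / t ^ DIM('a)"
  using assms by (simp add: gauss_eq power_mult_distrib real_sqrt_mult power_divide)

lemma nn_integral_lborel_scale: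
  fixes f :: "'a::euclidean_space \<Rightarrow> ennreal"
  assumes [measurable]: "f \<in> borel_measurable borel" and "c \<noteq> 0"
  shows "(\<integral>\<^sup>+x. f x \<partial>lborel) = ennreal (\<bar>c\<bar> ^ DIM('a)) * (\<integral>\<^sup>+x. f (t + c *\<^sub>R x) \<partial>lborel)"
  by (subst lborel_affine[OF assms(2), of t])
    (simp add: nn_integral_density nn_integral_distr nn_integral_cmult ennreal_power)

lemma nn_integral_lborel_shift:
  fixes f :: "'a::euclidean_space \<Rightarrow> ennreal"
  assumes [measurable]: "f \<in> borel_measurable borel"
  shows "(\<integral>\<^sup>+x. f (t + x) \<partial>lborel) = (\<integral>\<^sup>+x. f x \<partial>lborel)"
  using nn_integral_lborel_scale[OF assms, of 1 t] by simp

lemma integral_lborel_shift: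
  fixes f :: "'a::euclidean_space \<Rightarrow> 'b::{banach, second_countable_topology}"
  assumes [measurable]: "f \<in> borel_measurable borel"
  shows "(LINT x|lborel. f (t + x)) = (LINT x|lborel. f x)"
proof -
  have "(LINT x|lborel. f x) = (LINT x|distr lborel borel ((+) t). f x)" by (simp add: lborel_distr_plus)
  also have "\<dots> = (LINT x|lborel. f (t + x))" by (subst integral_distr) auto
  finally show ?thesis ..
qed

lemma nn_integral_lborel_reflect:
  fixes f :: "'a::euclidean_space \<Rightarrow> ennreal"
  assumes [measurable]: "f \<in> borel_measurable borel"
  shows "(\<integral>\<^sup>+x. f (t - x) \<partial>lborel) = (\<integral>\<^sup>+x. f x \<partial>lborel)"
  using nn_integral_lborel_scale[OF assms, of "-1" t] by simp

lemma nn_integral_gauss_shift [simp]: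
  "t > 0 \<Longrightarrow> (\<integral>\<^sup>+x. ennreal (gauss t (y - x)) \<partial>lborel) = 1"
  "t > 0 \<Longrightarrow> (\<integral>\<^sup>+x. ennreal (gauss t (x - y)) \<partial>lborel) = 1"
  using nn_integral_lborel_reflect[of "\<lambda>x. ennreal (gauss t x)" y] by (simp_all add: gauss_minus_commute[of t _ y])

lemma integrable_gauss_shift [simp, intro]:
  fixes y :: "'a::euclidean_space"
  assumes "t > 0" shows "integrable lborel (\<lambda>x. gauss t (x - y))"
  by (rule integrableI_bounded) (use assms in auto)

lemma integral_gauss_shift [simp]:
  fixes y :: "'a::euclidean_space"
  assumes "t > 0" shows "(LINT x|lborel. gauss t (x - y)) = 1"
  using assms integral_lborel_shift[of "gauss t" "-y"] by simp

text \<open>Parseval's formula for two translated Gaussians, by explicit computation: both sides are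
  (4 pi t^2)^(-d/2) exp(-|y - y'|^2 / (4 t^2)). The factor \<open>(2 * pi) ^ DIM('a)\<close> in
  Plancherel's identity originates here.\<close>

lemma gauss_mult_gauss_fourier:
  fixes y y' :: "'a::euclidean_space"
  assumes t: "t > 0"
  shows "(LINT x|lborel. gauss t (x - y) * gauss t (x - y'))
       = (LINT \<xi>|lborel. cos (\<xi> \<bullet> (y - y')) * exp (- (t * norm \<xi>)\<^sup>2)) / (2 * pi) ^ DIM('a)"
proof -
  \<comment> \<open>A product of two Gaussians of width \<open>t\<close> is a multiple of one of
    width \<open>t / sqrt 2\<close> about the midpoint of the centres.\<close>
  define s where "s = t / sqrt 2"
  have s: "s > 0" "s\<^sup>2 = t\<^sup>2 / 2" using t by (auto simp: s_def power_divide)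
  \<comment> \<open>With this width \<open>exp (- (t * norm \<xi>)\<^sup>2)\<close> is a multiple of
    \<open>gauss q \<xi>\<close>, so its cosine transform is known.\<close>
  define q where "q = 1 / (sqrt 2 * t)"
  have q: "q > 0" "q\<^sup>2 = 1 / (2 * t\<^sup>2)" using t by (auto simp: q_def power_divide power_mult_distrib)
  define e where "e = exp (- (norm (y - y'))\<^sup>2 / (4 * t\<^sup>2))"
  have gg: "gauss t (x - y) * gauss t (x - y') = (1 / sqrt (4 * pi * t\<^sup>2)) ^ DIM('a) * e * gauss s (x - (1/2) *\<^sub>R (y + y'))" for x
  proof -
    \<comment> \<open>Parallelogram law for \<open>x - y\<close> and \<open>x - y'\<close>, whose
      half sum is \<open>x\<close> minus the midpoint.\<close>
    have *: "(norm (x - y))\<^sup>2 + (norm (x - y'))\<^sup>2 = 2 * (norm (x - (1/2) *\<^sub>R (y + y')))\<^sup>2 + (norm (y - y'))\<^sup>2 / 2"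
      unfolding power2_norm_eq_inner by (simp add: inner_simps inner_commute field_simps)
    have "- (norm (x - y))\<^sup>2 / (2 * t\<^sup>2) + - (norm (x - y'))\<^sup>2 / (2 * t\<^sup>2) = - ((norm (x - y))\<^sup>2 + (norm (x - y'))\<^sup>2) / (2 * t\<^sup>2)"
      using t by (simp add: divide_simps)
    also have "\<dots> = - (norm (y - y'))\<^sup>2 / (4 * t\<^sup>2) + - (norm (x - (1/2) *\<^sub>R (y + y')))\<^sup>2 / (2 * s\<^sup>2)"
      unfolding * s using t by (simp add: divide_simps) 
    finally have ex: "exp (- (norm (x - y))\<^sup>2 / (2 * t\<^sup>2)) * exp (- (norm (x - y'))\<^sup>2 / (2 * t\<^sup>2)) = e * exp (- (norm (x - (1/2) *\<^sub>R (y + y')))\<^sup>2 / (2 * s\<^sup>2))"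
      unfolding e_def exp_add[symmetric] by (rule arg_cong)
    have "1 / sqrt (2 * pi * t\<^sup>2) * (1 / sqrt (2 * pi * t\<^sup>2)) = 1 / sqrt (4 * pi * t\<^sup>2) * (1 / sqrt (2 * pi * s\<^sup>2))"
      unfolding s using t by (simp add: real_sqrt_mult divide_simps)
    then have co: "(1 / sqrt (2 * pi * t\<^sup>2)) ^ DIM('a) * (1 / sqrt (2 * pi * t\<^sup>2)) ^ DIM('a) = (1 / sqrt (4 * pi * t\<^sup>2)) ^ DIM('a) * (1 / sqrt (2 * pi * s\<^sup>2)) ^ DIM('a)"
      unfolding power_mult_distrib[symmetric] by simp
    have "gauss t (x - y) * gauss t (x - y') = ((1 / sqrt (2 * pi * t\<^sup>2)) ^ DIM('a) * (1 / sqrt (2 * pi * t\<^sup>2)) ^ DIM('a))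
      * (exp (- (norm (x - y))\<^sup>2 / (2 * t\<^sup>2)) * exp (- (norm (x - y'))\<^sup>2 / (2 * t\<^sup>2)))"
      unfolding gauss_eq by (simp only: mult_ac)
    also have "\<dots> = (1 / sqrt (4 * pi * t\<^sup>2)) ^ DIM('a) * e * gauss s (x - (1/2) *\<^sub>R (y + y'))"
      unfolding co ex gauss_eq[of s] by (simp only: mult_ac)
    finally show ?thesis .
  qed
  have L: "(LINT x|lborel. gauss t (x - y) * gauss t (x - y')) = (1 / sqrt (4 * pi * t\<^sup>2)) ^ DIM('a) * e"
    unfolding gg using s by simp
  have q1: "2 * q\<^sup>2 = inverse (t\<^sup>2)" "2 * pi * q\<^sup>2 = pi / t\<^sup>2" using q(2) by (auto simp: divide_simps)
  have ex: "exp (- (t * norm \<xi>)\<^sup>2) = sqrt (pi / t\<^sup>2) ^ DIM('a) * gauss q \<xi>" for \<xi> :: 'a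
    unfolding gauss_eq q1 using t by (simp add: power_mult_distrib power_divide field_simps)
  have "(LINT \<xi>|lborel. cos (\<xi> \<bullet> (y - y')) * exp (- (t * norm \<xi>)\<^sup>2))
     = sqrt (pi / t\<^sup>2) ^ DIM('a) * (LINT \<xi>|lborel. cos ((y - y') \<bullet> \<xi>) * gauss q \<xi>)"
    unfolding ex integral_mult_right_zero[symmetric]
    by (intro Bochner_Integration.integral_cong refl) (simp only: inner_commute mult_ac)
  also have "\<dots> = sqrt (pi / t\<^sup>2) ^ DIM('a) * e"
    unfolding gauss_fourier[OF q(1)] e_def power_mult_distrib q(2) by simp
  finally have R: "(LINT \<xi>|lborel. cos (\<xi> \<bullet> (y - y')) * exp (- (t * norm \<xi>)\<^sup>2)) = sqrt (pi / t\<^sup>2) ^ DIM('a) * e" .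
  have "1 / sqrt (4 * pi * t\<^sup>2) = sqrt (pi / t\<^sup>2) / (2 * pi)"
    using t by (simp add: real_sqrt_mult real_sqrt_divide field_simps)
  then show ?thesis unfolding L R by (simp add: power_divide)
qed

lemma integrable_exp_gauss:
  fixes \<xi> :: "'a::euclidean_space"
  assumes "t > 0" shows "integrable lborel (\<lambda>\<xi>::'a. exp (- (t * norm \<xi>)\<^sup>2))"
proof -
  define q where "q = 1 / (sqrt 2 * t)"
  have q: "q > 0" "q\<^sup>2 = 1 / (2 * t\<^sup>2)" using assms by (auto simp: q_def power_divide power_mult_distrib)
  have q1: "2 * q\<^sup>2 = inverse (t\<^sup>2)" "2 * pi * q\<^sup>2 = pi / t\<^sup>2" using q(2) by (auto simp: divide_simps)
  have ex: "exp (- (t * norm \<xi>)\<^sup>2) = sqrt (pi / t\<^sup>2) ^ DIM('a) * gauss q \<xi>" for \<xi> :: 'a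
    unfolding gauss_eq q1 using assms by (simp add: power_mult_distrib power_divide field_simps)
  show ?thesis unfolding ex using q by auto
qed

section \<open>Plancherel's theorem\<close>

lemma (in pair_sigma_finite) integrable_times:
  fixes f g :: "_ \<Rightarrow> real"
  assumes f: "integrable M1 f" and g: "integrable M2 g"
  shows "integrable (M1 \<Otimes>\<^sub>M M2) (\<lambda>p. f (fst p) * g (snd p))"
proof (rule Fubini_integrable)
  show "(\<lambda>p. f (fst p) * g (snd p)) \<in> borel_measurable (M1 \<Otimes>\<^sub>M M2)"
    using borel_measurable_integrable[OF f] borel_measurable_integrable[OF g] by measurable
qed (use f g in \<open>simp_all add: abs_mult\<close>)

lemma (in pair_sigma_finite) integral_times:
  fixes f g :: "_ \<Rightarrow> real"
  assumes f: "integrable M1 f" and g: "integrable M2 g"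
  shows "(LINT p|(M1 \<Otimes>\<^sub>M M2). f (fst p) * g (snd p)) = (LINT x|M1. f x) * (LINT y|M2. g y)"
  using integral_fst'[OF integrable_times[OF f g]] by simp

lemma integrable_mult_bounded:
  fixes f g :: "_ \<Rightarrow> real"
  assumes f: "integrable M f" and [measurable]: "g \<in> borel_measurable M" and "\<And>x. \<bar>g x\<bar> \<le> 1"
  shows "integrable M (\<lambda>x. f x * g x)"
  by (rule Bochner_Integration.integrable_bound[OF f])
    (use assms borel_measurable_integrable[OF f] in \<open>auto simp: abs_mult intro!: mult_left_le\<close>)

text \<open>Fubini's criterion: the inner L1 norms are bounded uniformly, so the iterated integral
  of the absolute value is at most a multiple of the L1 norm of \<open>a\<close>. It is applied to
  the Gaussian and to the cosine kernel below.\<close>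

lemma (in pair_sigma_finite) integrable_weighted_kernel:
  fixes a :: "_ \<Rightarrow> real" and k :: "_ \<Rightarrow> _ \<Rightarrow> real"
  assumes a: "integrable M1 a" and k[measurable]: "(\<lambda>(p, x). k p x) \<in> borel_measurable (M1 \<Otimes>\<^sub>M M2)"
    and ik: "\<And>p. integrable M2 (k p)" and C: "\<And>p. (LINT x|M2. \<bar>k p x\<bar>) \<le> C"
  shows "integrable (M1 \<Otimes>\<^sub>M M2) (\<lambda>(p, x). a p * k p x)"
proof (rule Fubini_integrable)
  have [measurable]: "a \<in> borel_measurable M1" by (rule borel_measurable_integrable[OF a])
  show "(\<lambda>(p, x). a p * k p x) \<in> borel_measurable (M1 \<Otimes>\<^sub>M M2)" by measurable
  show "AE p in M1. integrable M2 (\<lambda>x. case (p, x) of (p, x) \<Rightarrow> a p * k p x)"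
    using ik by simp
  show "integrable M1 (\<lambda>p. LINT x|M2. norm (case (p, x) of (p, x) \<Rightarrow> a p * k p x))"
  proof (rule Bochner_Integration.integrable_bound[where f = "\<lambda>p. C * a p"])
    show "AE p in M1. norm (LINT x|M2. norm (case (p, x) of (p, x) \<Rightarrow> a p * k p x)) \<le> norm (C * a p)"
    proof (rule AE_I2)
      fix p
      have "\<bar>a p\<bar> * (LINT x|M2. \<bar>k p x\<bar>) \<le> \<bar>a p\<bar> * \<bar>C\<bar>"
        using C[of p] by (intro mult_left_mono) auto
      then show "norm (LINT x|M2. norm (case (p, x) of (p, x) \<Rightarrow> a p * k p x)) \<le> norm (C * a p)"
        by (simp add: abs_mult mult.commute)
    qed
  qed (use a in auto)
qed

text \<open>The squared modulus of a Fourier transform as a double integral; the addition theorem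
  for cos splits the kernel into two products.\<close>

lemma sum_squares_fourier:
  fixes f :: "'a::euclidean_space \<Rightarrow> real" and \<xi> :: 'a
  assumes "sigma_finite_measure M" and M[measurable_cong]: "sets M = sets borel" and f: "integrable M f"
  defines "C \<equiv> LINT y|M. f y * cos (\<xi> \<bullet> y)" and "S \<equiv> LINT y|M. f y * sin (\<xi> \<bullet> y)"
  shows "(LINT p|(M \<Otimes>\<^sub>M M). f (fst p) * f (snd p) * cos (\<xi> \<bullet> (fst p - snd p))) = C\<^sup>2 + S\<^sup>2"
proof -
  interpret sigma_finite_measure M by fact
  interpret P: pair_sigma_finite M M ..
  have [measurable]: "f \<in> borel_measurable borel"
    using borel_measurable_integrable[OF f] by measurable
  have c: "integrable M (\<lambda>y. f y * cos (\<xi> \<bullet> y))"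
    by (rule integrable_mult_bounded[OF f]) auto
  have s: "integrable M (\<lambda>y. f y * sin (\<xi> \<bullet> y))"
    by (rule integrable_mult_bounded[OF f]) auto
  have "(LINT p|(M \<Otimes>\<^sub>M M). f (fst p) * f (snd p) * cos (\<xi> \<bullet> (fst p - snd p)))
     = (LINT p|(M \<Otimes>\<^sub>M M). (f (fst p) * cos (\<xi> \<bullet> fst p)) * (f (snd p) * cos (\<xi> \<bullet> snd p))
         + (f (fst p) * sin (\<xi> \<bullet> fst p)) * (f (snd p) * sin (\<xi> \<bullet> snd p)))"
    by (intro Bochner_Integration.integral_cong refl) (simp add: inner_diff_right cos_diff algebra_simps)
  also have "\<dots> = C * C + S * S"
    by (subst Bochner_Integration.integral_add[OF P.integrable_times[OF c c] P.integrable_times[OF s s]])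
      (simp only: P.integral_times[OF c c] P.integral_times[OF s s] C_def S_def)
  finally show ?thesis by (simp add: power2_eq_square)
qed

text \<open>The square is a double integral over \<open>M\<close>; integrating in \<open>x\<close>
  first allows the kernel to be exchanged by \<open>gauss_mult_gauss_fourier\<close>, and a second
  use of Fubini restores a square on the Fourier side. \<open>M\<close> is kept general so that the
  identity applies to functions (\<open>M = lborel\<close>) and to finite measures
  (\<open>f = 1\<close>).\<close>

lemma nn_integral_mollified_square:
  fixes f :: "'a::euclidean_space \<Rightarrow> real"
  assumes sf: "sigma_finite_measure M" and M[measurable_cong]: "sets M = sets borel" and f: "integrable M f"
    and t: "t > 0"
  shows "(\<integral>\<^sup>+x. ennreal ((LINT y|M. gauss t (x - y) * f y)\<^sup>2) \<partial>lborel)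
    = (\<integral>\<^sup>+\<xi>. ennreal (exp (- (t * norm \<xi>)\<^sup>2) *
        ((LINT y|M. f y * cos (\<xi> \<bullet> y))\<^sup>2 + (LINT y|M. f y * sin (\<xi> \<bullet> y))\<^sup>2) / (2 * pi) ^ DIM('a)) \<partial>lborel)"
proof -
  interpret sigma_finite_measure M by fact
  interpret P: pair_sigma_finite M M ..
  interpret L: pair_sigma_finite "M \<Otimes>\<^sub>M M" lborel ..
  have [measurable]: "f \<in> borel_measurable borel"
    using borel_measurable_integrable[OF f] by measurable
  define K where "K = (1 / sqrt (2 * pi * t\<^sup>2)) ^ DIM('a)"
  have gK: "gauss t z \<le> K" for z :: 'a unfolding K_def by (rule gauss_le)
  have K: "0 \<le> K" by (simp add: K_def)
  have ff: "integrable (M \<Otimes>\<^sub>M M) (\<lambda>p. f (fst p) * f (snd p))" by (rule P.integrable_times[OF f f])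
  \<comment> \<open>\<open>F\<close> and \<open>G\<close> are the kernels in space and in frequency,
    weighted by \<open>f\<close> at both points; by \<open>FG\<close> their integrals over the last
    variable agree up to the factor.\<close>
  define F where "F p x = f (fst p) * f (snd p) * (gauss t (x - fst p) * gauss t (x - snd p))" for x :: 'a and p
  define G where "G p \<xi> = f (fst p) * f (snd p) * (cos (\<xi> \<bullet> (fst p - snd p)) * exp (- (t * norm \<xi>)\<^sup>2))" for \<xi> :: 'a and p
  define E where "E = (LINT \<xi>|lborel. exp (- (t * norm (\<xi>::'a))\<^sup>2))"
  have gg: "integrable lborel (\<lambda>x. gauss t (x - y) * gauss t (x - y'))" for y y' :: 'a
    by (rule Bochner_Integration.integrable_bound[where f = "\<lambda>x. K * gauss t (x - y')"])
      (use t gK K in \<open>auto simp: abs_mult intro!: mult_right_mono\<close>)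
  have ggK: "(LINT x|lborel. gauss t (x - y) * gauss t (x - y')) \<le> K" for y y' :: 'a
  proof -
    have "(LINT x|lborel. gauss t (x - y) * gauss t (x - y')) \<le> (LINT x|lborel. K * gauss t (x - y'))"
      by (intro integral_mono gg) (use t gK K in \<open>auto intro!: mult_right_mono\<close>)
    then show ?thesis using t by simp
  qed
  have ce: "integrable lborel (\<lambda>\<xi>. cos (\<xi> \<bullet> z) * exp (- (t * norm \<xi>)\<^sup>2))" for z :: 'a
    by (rule Bochner_Integration.integrable_bound[OF integrable_exp_gauss[OF t]])
      (auto simp: abs_mult intro!: mult_left_le_one_le)
  have ceE: "(LINT \<xi>|lborel. \<bar>cos (\<xi> \<bullet> z) * exp (- (t * norm \<xi>)\<^sup>2)\<bar>) \<le> E" for z :: 'a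
    unfolding E_def
    by (intro integral_mono integrable_abs ce integrable_exp_gauss t)
      (auto simp: abs_mult intro!: mult_left_le_one_le)
  have gt: "integrable M (\<lambda>y. gauss t (x - y) * f y)" for x
    by (rule Bochner_Integration.integrable_bound[where f = "\<lambda>y. K * f y"])
      (use f gK K in \<open>auto simp: abs_mult intro!: mult_right_mono\<close>)
  have iF: "integrable ((M \<Otimes>\<^sub>M M) \<Otimes>\<^sub>M lborel) (\<lambda>(p, x). F p x)"
    unfolding F_def by (rule L.integrable_weighted_kernel[OF ff _ gg]) (auto simp: ggK intro!: ggK)
  have iG: "integrable ((M \<Otimes>\<^sub>M M) \<Otimes>\<^sub>M lborel) (\<lambda>(p, x). G p x)"
    unfolding G_def by (rule L.integrable_weighted_kernel[OF ff _ ce ceE]) measurable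
  have Fx: "(LINT p|(M \<Otimes>\<^sub>M M). F p x) = (LINT y|M. gauss t (x - y) * f y)\<^sup>2" for x
    using P.integral_times[OF gt[of x] gt[of x]] by (simp add: F_def mult_ac power2_eq_square)
  have Gx: "(LINT p|(M \<Otimes>\<^sub>M M). G p \<xi>) = exp (- (t * norm \<xi>)\<^sup>2) *
      ((LINT y|M. f y * cos (\<xi> \<bullet> y))\<^sup>2 + (LINT y|M. f y * sin (\<xi> \<bullet> y))\<^sup>2)" for \<xi>
    unfolding sum_squares_fourier[OF sf M f, symmetric] integral_mult_right_zero[symmetric]
    by (intro Bochner_Integration.integral_cong refl) (simp add: G_def)
  have FG: "(LINT x|lborel. F p x) = (LINT \<xi>|lborel. G p \<xi>) / (2 * pi) ^ DIM('a)" for p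
    by (simp add: F_def G_def gauss_mult_gauss_fourier[OF t])
  have "(\<integral>\<^sup>+x. ennreal ((LINT y|M. gauss t (x - y) * f y)\<^sup>2) \<partial>lborel) = ennreal (LINT x|lborel. (LINT p|(M \<Otimes>\<^sub>M M). F p x))"
    using L.integrable_snd[OF iF] by (subst nn_integral_eq_integral[symmetric]) (auto simp: Fx)
  also have "(LINT x|lborel. (LINT p|(M \<Otimes>\<^sub>M M). F p x)) = (LINT p|(M \<Otimes>\<^sub>M M). (LINT x|lborel. F p x))"
    by (rule L.Fubini_integral[OF iF])
  also have "\<dots> = (LINT \<xi>|lborel. (LINT p|(M \<Otimes>\<^sub>M M). G p \<xi>)) / (2 * pi) ^ DIM('a)"
    unfolding FG by (simp add: L.Fubini_integral[OF iG])
  also have "\<dots> = (LINT \<xi>|lborel. (LINT p|(M \<Otimes>\<^sub>M M). G p \<xi>) / (2 * pi) ^ DIM('a))"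
    by simp
  also have "ennreal \<dots> = (\<integral>\<^sup>+\<xi>. ennreal ((LINT p|(M \<Otimes>\<^sub>M M). G p \<xi>) / (2 * pi) ^ DIM('a)) \<partial>lborel)"
    using L.integrable_snd[OF iG] by (subst nn_integral_eq_integral) (auto simp: Gx)
  finally show ?thesis by (simp add: Gx)
qed

section \<open>Approximate identity\<close>

definition mollify :: "real \<Rightarrow> ('a::euclidean_space \<Rightarrow> real) \<Rightarrow> 'a \<Rightarrow> real" where
  "mollify t w x = (LINT y|lborel. gauss t (x - y) * w y)"

lemma integrable_gauss_times:
  fixes w :: "'a::euclidean_space \<Rightarrow> real"
  assumes M[measurable_cong]: "sets M = sets borel" and w: "integrable M w"
  shows "integrable M (\<lambda>y. gauss t (x - y) * w y)"
proof (rule Bochner_Integration.integrable_bound)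
  show "integrable M (\<lambda>y. (1 / sqrt (2 * pi * t\<^sup>2)) ^ DIM('a) * w y)" using w by simp
  have [measurable]: "w \<in> borel_measurable borel"
    using borel_measurable_integrable[OF w] by measurable
  show "(\<lambda>y. gauss t (x - y) * w y) \<in> borel_measurable M" by measurable
  show "AE y in M. norm (gauss t (x - y) * w y) \<le> norm ((1 / sqrt (2 * pi * t\<^sup>2)) ^ DIM('a) * w y)"
    using gauss_le[where 'a='a and t = t] by (auto simp: abs_mult power_abs intro!: mult_right_mono)
qed

lemma mollify_measurable [measurable]:
  assumes [measurable]: "w \<in> borel_measurable borel"
  shows "mollify t w \<in> borel_measurable borel"
  unfolding mollify_def by measurable

lemma mollify_diff:
  assumes "integrable lborel u" "integrable lborel w"
  shows "mollify t (\<lambda>x. u x - w x) x = mollify t u x - mollify t w x"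
  unfolding mollify_def right_diff_distrib
  by (intro Bochner_Integration.integral_diff integrable_gauss_times assms) auto

lemma mollify_add:
  assumes "integrable lborel u" "integrable lborel w"
  shows "mollify t (\<lambda>x. u x + w x) x = mollify t u x + mollify t w x"
  unfolding mollify_def distrib_left
  by (intro Bochner_Integration.integral_add integrable_gauss_times assms) auto

text \<open>Tonelli, since the kernel has mass one in either variable.\<close>

lemma nn_integral_mollify_abs_le:
  fixes w :: "'a::euclidean_space \<Rightarrow> real"
  assumes t: "t > 0" and w: "integrable lborel w"
  shows "(\<integral>\<^sup>+x. ennreal \<bar>mollify t w x\<bar> \<partial>lborel) \<le> (\<integral>\<^sup>+x. ennreal \<bar>w x\<bar> \<partial>lborel)"
proof -
  have [measurable]: "w \<in> borel_measurable borel"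
    using borel_measurable_integrable[OF w] by measurable
  have "(\<integral>\<^sup>+x. ennreal \<bar>mollify t w x\<bar> \<partial>lborel) \<le> (\<integral>\<^sup>+x. (\<integral>\<^sup>+y. ennreal (gauss t (x - y) * \<bar>w y\<bar>) \<partial>lborel) \<partial>lborel)"
  proof (rule nn_integral_mono)
    fix x
    have "ennreal \<bar>mollify t w x\<bar> \<le> (\<integral>\<^sup>+y. ennreal (norm (gauss t (x - y) * w y)) \<partial>lborel)"
      unfolding mollify_def real_norm_def[symmetric] 
      by (rule integral_norm_bound_ennreal) (rule integrable_gauss_times, use w in auto)
    then show "ennreal \<bar>mollify t w x\<bar> \<le> (\<integral>\<^sup>+y. ennreal (gauss t (x - y) * \<bar>w y\<bar>) \<partial>lborel)"
      by (simp add: abs_mult)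
  qed
  also have "\<dots> = (\<integral>\<^sup>+y. (\<integral>\<^sup>+x. ennreal (gauss t (x - y) * \<bar>w y\<bar>) \<partial>lborel) \<partial>lborel)"
    by (rule lborel_pair.Fubini') measurable
  also have "\<dots> = (\<integral>\<^sup>+y. ennreal \<bar>w y\<bar> \<partial>lborel)"
    using t by (simp add: ennreal_mult nn_integral_multc)
  finally show ?thesis .
qed

text \<open>The substitution \<open>y = x - t *\<^sub>R z\<close> moves \<open>t\<close> from the
  kernel into the argument, so that the fixed weight \<open>gauss 1\<close> can serve as a
  dominating function.\<close>

lemma nn_integral_gauss_diff_eq:
  fixes f :: "'a::euclidean_space \<Rightarrow> ennreal"
  assumes [measurable]: "f \<in> borel_measurable borel" and t: "t > 0"
  shows "(\<integral>\<^sup>+y. ennreal (gauss t (x - y)) * f y \<partial>lborel) = (\<integral>\<^sup>+z. ennreal (gauss 1 z) * f (x - t *\<^sub>R z) \<partial>lborel)"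
proof -
  have "(\<integral>\<^sup>+y. ennreal (gauss t (x - y)) * f y \<partial>lborel)
      = ennreal (t ^ DIM('a)) * (\<integral>\<^sup>+z. ennreal (gauss t (t *\<^sub>R z)) * f (x - t *\<^sub>R z) \<partial>lborel)"
    using t by (subst nn_integral_lborel_scale[where c = "-t" and t = x]) (auto simp: ac_simps)
  also have "\<dots> = (\<integral>\<^sup>+z. ennreal (gauss 1 z) * f (x - t *\<^sub>R z) \<partial>lborel)"
    using t by (subst nn_integral_cmult[symmetric])
      (auto simp: gauss_scale mult.assoc[symmetric] ennreal_mult[symmetric] simp del: ennreal_mult)
  finally show ?thesis .
qed

text \<open>For each fixed \<open>z\<close> the point \<open>x - t n *\<^sub>R z\<close> lies in the
  open set for all large \<open>n\<close>; dominated convergence with the weight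
  \<open>gauss 1\<close> does the rest.\<close>

lemma gauss_open_tendsto_1:
  fixes x :: "'a::euclidean_space"
  assumes U: "open U" "x \<in> U" and t: "\<And>n. t n > 0" "t \<longlonglongrightarrow> 0"
  shows "(\<lambda>n. \<integral>\<^sup>+y. ennreal (gauss (t n) (x - y)) * indicator U y \<partial>lborel) \<longlonglongrightarrow> 1"
proof -
  have [measurable]: "U \<in> sets borel" using U by simp
  have "(\<lambda>n. \<integral>\<^sup>+z. ennreal (gauss 1 z) * indicator U (x - t n *\<^sub>R z) \<partial>lborel) \<longlonglongrightarrow> (\<integral>\<^sup>+z. ennreal (gauss 1 (z::'a)) \<partial>lborel)"
  proof (rule nn_integral_dominated_convergence[where w = "\<lambda>z. ennreal (gauss 1 z)"])
    show "AE z in lborel. (\<lambda>n. ennreal (gauss 1 z) * indicator U (x - t n *\<^sub>R z)) \<longlonglongrightarrow> ennreal (gauss 1 z)"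
    proof (rule AE_I2)
      fix z :: 'a
      have "(\<lambda>n. x - t n *\<^sub>R z) \<longlonglongrightarrow> x - 0 *\<^sub>R z" by (intro tendsto_intros t)
      then have "\<forall>\<^sub>F n in sequentially. x - t n *\<^sub>R z \<in> U"
        using U by (intro topological_tendstoD) auto
      then have "\<forall>\<^sub>F n in sequentially. ennreal (gauss 1 z) * indicator U (x - t n *\<^sub>R z) = ennreal (gauss 1 z)"
        by eventually_elim simp
      then show "(\<lambda>n. ennreal (gauss 1 z) * indicator U (x - t n *\<^sub>R z)) \<longlonglongrightarrow> ennreal (gauss 1 z)"
        by (rule tendsto_eventually)
    qed
  qed (auto split: split_indicator)
  then show ?thesis by (simp add: nn_integral_gauss_diff_eq t(1))
qed

text \<open>The squared modulus of the Fourier transform of the signed measure with density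
  \<open>f\<close> with respect to \<open>M\<close>, in real form;
  \<open>cmod_fourier_transform\<close> makes the link for \<open>f = 1\<close>. Cosine and sine
  integrals keep the Fubini arguments real.\<close>

definition power_spectrum :: "'a::euclidean_space measure \<Rightarrow> ('a \<Rightarrow> real) \<Rightarrow> 'a \<Rightarrow> real" where
  "power_spectrum M f \<xi> = (LINT y|M. f y * cos (\<xi> \<bullet> y))\<^sup>2 + (LINT y|M. f y * sin (\<xi> \<bullet> y))\<^sup>2"

lemma power_spectrum_nonneg [simp]: "0 \<le> power_spectrum M f \<xi>"
  by (simp add: power_spectrum_def)

lemma power_spectrum_measurable [measurable]:
  fixes f :: "'a::euclidean_space \<Rightarrow> real"
  assumes "sigma_finite_measure M" and M[measurable_cong]: "sets M = sets borel" and [measurable]: "f \<in> borel_measurable borel"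
  shows "power_spectrum M f \<in> borel_measurable borel"
proof -
  interpret sigma_finite_measure M by fact
  show ?thesis unfolding power_spectrum_def by measurable
qed


abbreviation mollify_error :: "real \<Rightarrow> ('a::euclidean_space \<Rightarrow> real) \<Rightarrow> ennreal" where
  "mollify_error t w \<equiv> (\<integral>\<^sup>+x. ennreal \<bar>mollify t w x - w x\<bar> \<partial>lborel)"

text \<open>Mollification contracts the L1 norm, so convergence passes from L1 approximants
  \<open>u\<close> to \<open>w\<close>: the error splits into the mollified difference, the error of
  \<open>u\<close> and the difference itself.\<close>

lemma approx_identity_closure:
  fixes w :: "'a::euclidean_space \<Rightarrow> real"
  assumes t: "\<And>n. t n > 0" and w: "integrable lborel w"
    and u: "\<And>e. e > 0 \<Longrightarrow> \<exists>u. integrable lborel u \<and> (\<integral>\<^sup>+x. ennreal \<bar>w x - u x\<bar> \<partial>lborel) \<le> ennreal e \<and>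
      (\<lambda>n. mollify_error (t n) u) \<longlonglongrightarrow> 0"
  shows "(\<lambda>n. mollify_error (t n) w) \<longlonglongrightarrow> 0"
proof (rule tendsto_zero_ennreal)
  fix r :: real assume r: "0 < r"
  \<comment> \<open>Three terms of size \<open>r / 4\<close> leave room for the strict
    inequality.\<close>
  from u[of "r / 4"] r obtain u where u: "integrable lborel u"
    and wu: "(\<integral>\<^sup>+x. ennreal \<bar>w x - u x\<bar> \<partial>lborel) \<le> ennreal (r / 4)"
    and lim: "(\<lambda>n. mollify_error (t n) u) \<longlonglongrightarrow> 0" by auto
  have [measurable]: "w \<in> borel_measurable borel" "u \<in> borel_measurable borel"
    using borel_measurable_integrable[OF w] borel_measurable_integrable[OF u] by simp_all
  have "\<forall>\<^sub>F n in sequentially. (mollify_error (t n) u) < ennreal (r / 4)"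
    using r by (intro order_tendstoD(2)[OF lim]) simp
  then show "\<forall>\<^sub>F n in sequentially. (mollify_error (t n) w) < ennreal r"
  proof eventually_elim
    case (elim n)
    have "(mollify_error (t n) w) \<le>
      (\<integral>\<^sup>+x. (ennreal \<bar>mollify (t n) (\<lambda>x. w x - u x) x\<bar> + ennreal \<bar>mollify (t n) u x - u x\<bar>) + ennreal \<bar>w x - u x\<bar> \<partial>lborel)"
      by (intro nn_integral_mono) (simp add: mollify_diff[OF w u] ennreal_plus[symmetric] del: ennreal_plus)
    also have "\<dots> = (\<integral>\<^sup>+x. ennreal \<bar>mollify (t n) (\<lambda>x. w x - u x) x\<bar> \<partial>lborel) + (mollify_error (t n) u)
        + (\<integral>\<^sup>+x. ennreal \<bar>w x - u x\<bar> \<partial>lborel)"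
      by (simp add: nn_integral_add)
    also have "\<dots> \<le> ennreal (r / 4) + ennreal (r / 4) + ennreal (r / 4)"
    proof (intro add_mono)
      have "(\<integral>\<^sup>+x. ennreal \<bar>mollify (t n) (\<lambda>x. w x - u x) x\<bar> \<partial>lborel) \<le> (\<integral>\<^sup>+x. ennreal \<bar>w x - u x\<bar> \<partial>lborel)"
        using w u by (intro nn_integral_mollify_abs_le t) auto
      then show "(\<integral>\<^sup>+x. ennreal \<bar>mollify (t n) (\<lambda>x. w x - u x) x\<bar> \<partial>lborel) \<le> ennreal (r / 4)"
        using wu by simp
    qed (use elim wu in auto)
    also have "\<dots> < ennreal r" using r by (simp add: ennreal_plus[symmetric] ennreal_less_iff del: ennreal_plus)
    finally show ?case .
  qed
qed

lemma mollify_indicator: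
  fixes U :: "'a::euclidean_space set"
  assumes t: "t > 0" and [measurable]: "U \<in> sets borel" and fin: "emeasure lborel U < \<infinity>"
  shows "ennreal (mollify t (indicator U) x) = (\<integral>\<^sup>+y. ennreal (gauss t (x - y)) * indicator U y \<partial>lborel)"
    and "0 \<le> mollify t (indicator U) x" and "mollify t (indicator U) x \<le> 1"
proof -
  have i: "integrable lborel (\<lambda>y. gauss t (x - y) * indicator U y)"
    using fin by (intro integrable_gauss_times) (auto simp: integrable_indicator_iff)
  show *: "ennreal (mollify t (indicator U) x) = (\<integral>\<^sup>+y. ennreal (gauss t (x - y)) * indicator U y \<partial>lborel)"
    unfolding mollify_def by (subst nn_integral_eq_integral[OF i, symmetric]) (auto split: split_indicator intro!: nn_integral_cong)
  show "0 \<le> mollify t (indicator U) x"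
    unfolding mollify_def by (intro Bochner_Integration.integral_nonneg) auto
  have "ennreal (mollify t (indicator U) x) \<le> (\<integral>\<^sup>+y. ennreal (gauss t (x - y)) \<partial>lborel)"
    unfolding * by (intro nn_integral_mono) (auto split: split_indicator)
  then show "mollify t (indicator U) x \<le> 1" using t by simp
qed

text \<open>The boundary of an open set may have positive measure, so pointwise convergence is used
  on \<open>U\<close> only. The mollified indicator lies between 0 and 1 and has the mass of
  \<open>U\<close>; hence the L1 error is twice the mass that has left \<open>U\<close>, and
  convergence on \<open>U\<close> is enough.\<close>

lemma approx_identity_open:
  fixes U :: "'a::euclidean_space set"
  assumes t: "\<And>n. t n > 0" "t \<longlonglongrightarrow> 0" and U: "open U" and fin: "emeasure lborel U < \<infinity>"
  shows "(\<lambda>n. mollify_error (t n) (indicator U)) \<longlonglongrightarrow> 0"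
proof -
  have Ub [measurable]: "U \<in> sets borel" using U by simp
  note m = mollify_indicator[OF t(1) Ub fin]
  have lim: "(\<lambda>n. \<integral>\<^sup>+x. ennreal (mollify (t n) (indicator U) x) * indicator U x \<partial>lborel) \<longlonglongrightarrow> (\<integral>\<^sup>+x. indicator U x \<partial>lborel)"
  proof (rule nn_integral_dominated_convergence[where w = "indicator U"])
    show "AE x in lborel. (\<lambda>n. ennreal (mollify (t n) (indicator U) x) * indicator U x) \<longlonglongrightarrow> indicator U x"
      using gauss_open_tendsto_1[OF U _ t] by (auto simp: m split: split_indicator)
    show "AE x in lborel. ennreal (mollify (t n) (indicator U) x) * indicator U x \<le> indicator U x" for n
      using m(3) by (auto split: split_indicator)
  qed (use fin in auto)
  have tot: "(\<integral>\<^sup>+x. ennreal (mollify (t n) (indicator U) x) \<partial>lborel) = emeasure lborel U" for n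
  proof -
    have "(\<integral>\<^sup>+x. ennreal (mollify (t n) (indicator U) x) \<partial>lborel)
      = (\<integral>\<^sup>+y. (\<integral>\<^sup>+x. ennreal (gauss (t n) (x - y)) * indicator U y \<partial>lborel) \<partial>lborel)"
      unfolding m by (rule lborel_pair.Fubini') measurable
    then show ?thesis using t by (simp add: nn_integral_multc)
  qed
  \<comment> \<open>Pointwise |m - 1_U| + 2 m 1_U = m + 1_U whenever 0 \<le> m \<le> 1.\<close>
  have eq: "(mollify_error (t n) (indicator U))
     = 2 * emeasure lborel U - 2 * (\<integral>\<^sup>+x. ennreal (mollify (t n) (indicator U) x) * indicator U x \<partial>lborel)" for n
  proof -
    have "(mollify_error (t n) (indicator U))
        + 2 * (\<integral>\<^sup>+x. ennreal (mollify (t n) (indicator U) x) * indicator U x \<partial>lborel)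
      = (\<integral>\<^sup>+x. ennreal \<bar>mollify (t n) (indicator U) x - indicator U x\<bar>
        + 2 * (ennreal (mollify (t n) (indicator U) x) * indicator U x) \<partial>lborel)"
      by (simp add: nn_integral_add nn_integral_cmult)
    also have "\<dots> = (\<integral>\<^sup>+x. ennreal (mollify (t n) (indicator U) x) + indicator U x \<partial>lborel)"
    proof (rule nn_integral_cong)
      fix x
      have two: "2 * ennreal c = ennreal (2 * c)" for c by (simp add: ennreal_mult')
      then show "ennreal \<bar>mollify (t n) (indicator U) x - indicator U x\<bar>
        + 2 * (ennreal (mollify (t n) (indicator U) x) * indicator U x) = ennreal (mollify (t n) (indicator U) x) + indicator U x"
        using m(2,3)[of n x] ennreal_plus[of "mollify (t n) (indicator U) x" 1]
          ennreal_plus[of "1 - mollify (t n) (indicator U) x" "2 * mollify (t n) (indicator U) x"]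
        by (cases "x \<in> U") (auto simp: two add_ac simp del: ennreal_plus)
    qed
    also have "\<dots> = 2 * emeasure lborel U"
      by (simp add: nn_integral_add tot mult_2)
    finally have e: "(mollify_error (t n) (indicator U))
        + 2 * (\<integral>\<^sup>+x. ennreal (mollify (t n) (indicator U) x) * indicator U x \<partial>lborel) = 2 * emeasure lborel U" .
    \<comment> \<open>Cancellation in \<open>ennreal\<close> needs the subtracted term to be
      finite.\<close>
    have "(\<integral>\<^sup>+x. ennreal (mollify (t n) (indicator U) x) * indicator U x \<partial>lborel) \<le> (\<integral>\<^sup>+x. ennreal (mollify (t n) (indicator U) x) \<partial>lborel)"
      by (intro nn_integral_mono) (auto split: split_indicator)
    then have "2 * (\<integral>\<^sup>+x. ennreal (mollify (t n) (indicator U) x) * indicator U x \<partial>lborel) \<noteq> top"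
      using fin unfolding tot by (auto simp: ennreal_mult_eq_top_iff top_unique)
    then show ?thesis unfolding e[symmetric] by (simp add: ennreal_add_diff_cancel_right)
  qed
  have "(\<lambda>n. 2 * emeasure lborel U - 2 * (\<integral>\<^sup>+x. ennreal (mollify (t n) (indicator U) x) * indicator U x \<partial>lborel))
     \<longlonglongrightarrow> 2 * emeasure lborel U - 2 * emeasure lborel U"
    using lim fin by (intro tendsto_diff_ennreal tendsto_const ennreal_tendsto_cmult) (auto simp: ennreal_mult_eq_top_iff)
  then show ?thesis unfolding eq using fin by (simp add: ennreal_mult_eq_top_iff)
qed

text \<open>Induction over integrable functions: an indicator is approximated in L1 by those of open
  sets through outer regularity, sums are immediate, and limits fall under
  \<open>approx_identity_closure\<close>.\<close>

lemma approx_identity: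
  fixes w :: "'a::euclidean_space \<Rightarrow> real"
  assumes w: "integrable lborel w" and t: "\<And>n. t n > 0" "t \<longlonglongrightarrow> 0"
  shows "(\<lambda>n. mollify_error (t n) w) \<longlonglongrightarrow> 0"
  using w
proof (induction rule: integrable_induct)
  case (base A c)
  then have [measurable]: "A \<in> sets borel" by simp
  show ?case
  proof (rule approx_identity_closure[OF t(1)])
    show "integrable lborel (\<lambda>x. indicator A x *\<^sub>R c)" using base by auto
    fix e :: real assume e: "e > 0"
    \<comment> \<open>The \<open>+ 1\<close> covers \<open>c = 0\<close>.\<close>
    obtain U where U: "open U" "A \<subseteq> U" and Ue: "emeasure lborel (U - A) < ennreal (e / (\<bar>c\<bar> + 1))"
      using outer_regular_lborel[of A "e / (\<bar>c\<bar> + 1)"] e by auto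
    have [measurable]: "U \<in> sets borel" using U by simp
    have "emeasure lborel U \<le> emeasure lborel (U - A) + emeasure lborel A"
      using emeasure_subadditive[of "U - A" lborel A] U(2) by (simp add: Un_absorb2)
    also have "\<dots> < \<infinity>" using Ue base by (auto simp: less_top[symmetric])
    finally have Uf: "emeasure lborel U < \<infinity>" .
    show "\<exists>u. integrable lborel u \<and> (\<integral>\<^sup>+x. ennreal \<bar>indicator A x *\<^sub>R c - u x\<bar> \<partial>lborel) \<le> ennreal e \<and>
      (\<lambda>n. mollify_error (t n) u) \<longlonglongrightarrow> 0"
    proof (intro exI[of _ "\<lambda>x. c * indicator U x"] conjI)
      show "integrable lborel (\<lambda>x. c * indicator U x)" using Uf by auto
      have "(\<integral>\<^sup>+x. ennreal \<bar>indicator A x *\<^sub>R c - c * indicator U x\<bar> \<partial>lborel) = (\<integral>\<^sup>+x. ennreal \<bar>c\<bar> * indicator (U - A) x \<partial>lborel)"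
        using U by (intro nn_integral_cong) (auto split: split_indicator)
      also have "\<dots> = ennreal \<bar>c\<bar> * emeasure lborel (U - A)" by (simp add: nn_integral_cmult)
      also have "\<dots> \<le> ennreal \<bar>c\<bar> * ennreal (e / (\<bar>c\<bar> + 1))" using Ue by (intro mult_left_mono) auto
      also have "\<dots> \<le> ennreal e" using e by (simp add: ennreal_mult'[symmetric] divide_simps)
      finally show "(\<integral>\<^sup>+x. ennreal \<bar>indicator A x *\<^sub>R c - c * indicator U x\<bar> \<partial>lborel) \<le> ennreal e" .
      have "mollify (t n) (\<lambda>x. c * indicator U x) x = c * mollify (t n) (indicator U) x" for n x
        unfolding mollify_def by (subst integral_mult_right_zero[symmetric]) (simp add: mult_ac)
      then have "(\<integral>\<^sup>+x. ennreal \<bar>mollify (t n) (\<lambda>x. c * indicator U x) x - c * indicator U x\<bar> \<partial>lborel)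
        = ennreal \<bar>c\<bar> * (mollify_error (t n) (indicator U))" for n
        by (subst nn_integral_cmult[symmetric])
          (auto simp: right_diff_distrib[symmetric] abs_mult ennreal_mult simp del: ennreal_mult' intro!: nn_integral_cong)
      then show "(\<lambda>n. \<integral>\<^sup>+x. ennreal \<bar>mollify (t n) (\<lambda>x. c * indicator U x) x - c * indicator U x\<bar> \<partial>lborel) \<longlonglongrightarrow> 0"
        using ennreal_tendsto_cmult[OF _ approx_identity_open[OF t U(1) Uf], of "ennreal \<bar>c\<bar>"] by simp
    qed
  qed
next
  case (add f g)
  have [measurable]: "f \<in> borel_measurable borel" "g \<in> borel_measurable borel"
    using add by auto
  have "(\<lambda>n. (mollify_error (t n) f) + (mollify_error (t n) g)) \<longlonglongrightarrow> 0 + 0"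
    using add by (intro tendsto_add)
  then have lim: "(\<lambda>n. (mollify_error (t n) f) + (mollify_error (t n) g)) \<longlonglongrightarrow> 0"
    by simp
  show ?case
  proof (rule tendsto_sandwich[OF _ _ tendsto_const lim])
    show "\<forall>\<^sub>F n in sequentially. (\<integral>\<^sup>+x. ennreal \<bar>mollify (t n) (\<lambda>x. f x + g x) x - (f x + g x)\<bar> \<partial>lborel)
      \<le> (mollify_error (t n) f) + (mollify_error (t n) g)"
      by (subst nn_integral_add[symmetric])
        (auto simp: mollify_add[OF add(1,2)] ennreal_plus[symmetric] simp del: ennreal_plus intro!: always_eventually nn_integral_mono)
  qed auto
next
  case (lim f s)
  have [measurable]: "f \<in> borel_measurable borel" "\<And>i. s i \<in> borel_measurable borel"
    using lim by auto
  show ?case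
  proof (rule approx_identity_closure[OF t(1) lim(4)])
    fix e :: real assume e: "e > 0"
    have "(\<lambda>i. \<integral>\<^sup>+x. ennreal (norm (f x - s i x)) \<partial>lborel) \<longlonglongrightarrow> 0"
    proof (rule nn_integral_dominated_convergence_norm[where w = "\<lambda>x. 2 * norm (f x)"])
      show "(\<integral>\<^sup>+ x. ennreal (2 * norm (f x)) \<partial>lborel) < \<infinity>"
        using lim(4) unfolding integrable_iff_bounded
        by (auto simp: ennreal_mult nn_integral_cmult ennreal_mult_less_top)
    qed (use lim in auto)
    then have "\<forall>\<^sub>F i in sequentially. (\<integral>\<^sup>+x. ennreal (norm (f x - s i x)) \<partial>lborel) < ennreal e"
      using e by (intro order_tendstoD) auto
    then obtain i where "(\<integral>\<^sup>+x. ennreal (norm (f x - s i x)) \<partial>lborel) < ennreal e"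
      unfolding eventually_sequentially by auto
    then show "\<exists>u. integrable lborel u \<and> (\<integral>\<^sup>+x. ennreal \<bar>f x - u x\<bar> \<partial>lborel) \<le> ennreal e \<and>
      (\<lambda>n. mollify_error (t n) u) \<longlonglongrightarrow> 0"
      using lim(1,5) by (intro exI[of _ "s i"]) auto
  qed
qed

text \<open>Cauchy-Schwarz after writing the kernel as a product of two square roots; one factor
  integrates to one.\<close>

lemma nn_integral_mollify_square_le:
  fixes w :: "'a::euclidean_space \<Rightarrow> real"
  assumes t: "t > 0" and w: "integrable lborel w"
  shows "(\<integral>\<^sup>+x. ennreal ((mollify t w x)\<^sup>2) \<partial>lborel) \<le> (\<integral>\<^sup>+x. ennreal ((w x)\<^sup>2) \<partial>lborel)"
proof -
  have [measurable]: "w \<in> borel_measurable borel" using borel_measurable_integrable[OF w] by simp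
  have "(\<integral>\<^sup>+x. ennreal ((mollify t w x)\<^sup>2) \<partial>lborel) \<le> (\<integral>\<^sup>+x. (\<integral>\<^sup>+y. ennreal (gauss t (x - y) * (w y)\<^sup>2) \<partial>lborel) \<partial>lborel)"
  proof (rule nn_integral_mono)
    fix x
    have "ennreal \<bar>mollify t w x\<bar> \<le> (\<integral>\<^sup>+y. ennreal (norm (gauss t (x - y) * w y)) \<partial>lborel)"
      unfolding mollify_def real_norm_def[symmetric]
      by (rule integral_norm_bound_ennreal) (rule integrable_gauss_times, use w in auto)
    also have "\<dots> = (\<integral>\<^sup>+y. ennreal (sqrt (gauss t (x - y))) * ennreal (sqrt (gauss t (x - y)) * \<bar>w y\<bar>) \<partial>lborel)"
      by (intro nn_integral_cong) (simp add: abs_mult ennreal_mult'[symmetric] mult.assoc[symmetric])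
    finally have "(ennreal \<bar>mollify t w x\<bar>)\<^sup>2 \<le> (\<integral>\<^sup>+y. ennreal (sqrt (gauss t (x - y))) * ennreal (sqrt (gauss t (x - y)) * \<bar>w y\<bar>) \<partial>lborel)\<^sup>2"
      by (rule power_mono) simp
    also have "\<dots> \<le> (\<integral>\<^sup>+y. (ennreal (sqrt (gauss t (x - y))))\<^sup>2 \<partial>lborel) * (\<integral>\<^sup>+y. (ennreal (sqrt (gauss t (x - y)) * \<bar>w y\<bar>))\<^sup>2 \<partial>lborel)"
      by (rule Cauchy_Schwarz_nn_integral) measurable
    finally show "ennreal ((mollify t w x)\<^sup>2) \<le> (\<integral>\<^sup>+y. ennreal (gauss t (x - y) * (w y)\<^sup>2) \<partial>lborel)"
      using t by (simp add: ennreal_power power_mult_distrib)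
  qed
  also have "\<dots> = (\<integral>\<^sup>+y. (\<integral>\<^sup>+x. ennreal (gauss t (x - y) * (w y)\<^sup>2) \<partial>lborel) \<partial>lborel)"
    by (rule lborel_pair.Fubini') measurable
  also have "\<dots> = (\<integral>\<^sup>+y. ennreal ((w y)\<^sup>2) \<partial>lborel)"
    using t by (simp add: ennreal_mult nn_integral_multc)
  finally show ?thesis .
qed

text \<open>An identity in [0, \<infinity>], as \<open>w\<close> is only integrable. Both
  inequalities start from the mollified identity \<open>sq\<close>: Fatou in frequency together with
  the L2 contraction gives one, Fatou in space together with the damping factor being at most 1
  gives the other.\<close>

theorem plancherel:
  fixes w :: "'a::euclidean_space \<Rightarrow> real"
  assumes w: "integrable lborel w"
  shows "(\<integral>\<^sup>+x. ennreal ((w x)\<^sup>2) \<partial>lborel) = (\<integral>\<^sup>+\<xi>. ennreal (power_spectrum lborel w \<xi> / (2 * pi) ^ DIM('a)) \<partial>lborel)"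
proof (rule antisym)
  have [measurable]: "w \<in> borel_measurable borel" using borel_measurable_integrable[OF w] by simp
  have [measurable]: "power_spectrum lborel w \<in> borel_measurable borel"
    by (rule power_spectrum_measurable) (auto intro: sigma_finite_lborel)
  define t where "t n = 1 / real (Suc n)" for n
  have t: "t n > 0" for n by (simp add: t_def)
  have t0: "t \<longlonglongrightarrow> 0" unfolding t_def using LIMSEQ_inverse_real_of_nat by (simp add: inverse_eq_divide)
  have sq: "(\<integral>\<^sup>+x. ennreal ((mollify (t n) w x)\<^sup>2) \<partial>lborel)
    = (\<integral>\<^sup>+\<xi>. ennreal (exp (- (t n * norm \<xi>)\<^sup>2) * power_spectrum lborel w \<xi> / (2 * pi) ^ DIM('a)) \<partial>lborel)" for n
    unfolding mollify_def power_spectrum_def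
    by (rule nn_integral_mollified_square) (auto intro: sigma_finite_lborel w t)
  let ?P = "\<lambda>\<xi>. power_spectrum lborel w \<xi> / (2 * pi) ^ DIM('a)"
  have "(\<lambda>n. exp (- (t n * norm \<xi>)\<^sup>2) * power_spectrum lborel w \<xi> / (2 * pi) ^ DIM('a))
     \<longlonglongrightarrow> exp (- (0 * norm \<xi>)\<^sup>2) * power_spectrum lborel w \<xi> / (2 * pi) ^ DIM('a)" for \<xi> :: 'a
    by (intro tendsto_intros t0) auto
  then have "ennreal (?P \<xi>) = liminf (\<lambda>n. ennreal (exp (- (t n * norm \<xi>)\<^sup>2) * power_spectrum lborel w \<xi> / (2 * pi) ^ DIM('a)))" for \<xi> :: 'a
    by (intro lim_imp_Liminf[symmetric] tendsto_ennrealI) auto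
  then have "(\<integral>\<^sup>+\<xi>. ennreal (?P \<xi>) \<partial>lborel)
      = (\<integral>\<^sup>+\<xi>. liminf (\<lambda>n. ennreal (exp (- (t n * norm \<xi>)\<^sup>2) * power_spectrum lborel w \<xi> / (2 * pi) ^ DIM('a))) \<partial>lborel)"
    by simp
  also have "\<dots> \<le> liminf (\<lambda>n. \<integral>\<^sup>+\<xi>. ennreal (exp (- (t n * norm \<xi>)\<^sup>2) * power_spectrum lborel w \<xi> / (2 * pi) ^ DIM('a)) \<partial>lborel)"
    by (rule nn_integral_liminf) measurable
  also have "\<dots> \<le> liminf (\<lambda>n::nat. \<integral>\<^sup>+x. ennreal ((w x)\<^sup>2) \<partial>lborel)"
    unfolding sq[symmetric] by (intro Liminf_mono always_eventually allI nn_integral_mollify_square_le t w)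
  finally show "(\<integral>\<^sup>+\<xi>. ennreal (?P \<xi>) \<partial>lborel) \<le> (\<integral>\<^sup>+x. ennreal ((w x)\<^sup>2) \<partial>lborel)"
    by (simp add: Liminf_const)
  have mi: "integrable lborel (\<lambda>x. mollify (t n) w x - w x)" for n
  proof (intro Bochner_Integration.integrable_diff w)
    have "(\<integral>\<^sup>+x. ennreal \<bar>mollify (t n) w x\<bar> \<partial>lborel) < \<infinity>"
      using nn_integral_mollify_abs_le[OF t w] w unfolding integrable_iff_bounded by (auto intro: le_less_trans)
    then show "integrable lborel (mollify (t n) w)" by (simp add: integrable_iff_bounded)
  qed
  \<comment> \<open>L1 convergence yields an almost everywhere convergent subsequence, the input of
    the second use of Fatou.\<close>
  have "(\<lambda>n. LINT x|lborel. norm (mollify (t n) w x - w x)) \<longlonglongrightarrow> 0"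
  proof -
    have "(\<lambda>n. ennreal (LINT x|lborel. norm (mollify (t n) w x - w x))) \<longlonglongrightarrow> ennreal 0"
      using approx_identity[OF w t t0] mi by (simp add: nn_integral_eq_integral)
    then show ?thesis by (subst (asm) tendsto_ennreal_iff) auto
  qed
  from tendsto_L1_AE_subseq[OF mi this] obtain r where r: "strict_mono r"
    and ae: "AE x in lborel. (\<lambda>n. mollify (t (r n)) w x - w x) \<longlonglongrightarrow> 0" by blast
  have "(\<integral>\<^sup>+x. ennreal ((w x)\<^sup>2) \<partial>lborel) = (\<integral>\<^sup>+x. liminf (\<lambda>n. ennreal ((mollify (t (r n)) w x)\<^sup>2)) \<partial>lborel)"
  proof (rule nn_integral_cong_AE, use ae in eventually_elim)
    case (elim x)
    then have "(\<lambda>n. (mollify (t (r n)) w x)\<^sup>2) \<longlonglongrightarrow> (w x)\<^sup>2"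
      by (intro tendsto_power) (simp add: LIM_zero_iff)
    then show ?case by (intro lim_imp_Liminf[symmetric] tendsto_ennrealI) auto
  qed
  also have "\<dots> \<le> liminf (\<lambda>n. \<integral>\<^sup>+x. ennreal ((mollify (t (r n)) w x)\<^sup>2) \<partial>lborel)"
    by (rule nn_integral_liminf) measurable
  also have "\<dots> \<le> liminf (\<lambda>n::nat. \<integral>\<^sup>+\<xi>. ennreal (?P \<xi>) \<partial>lborel)"
    unfolding sq by (intro Liminf_mono always_eventually allI nn_integral_mono)
      (auto intro!: ennreal_leI divide_right_mono mult_left_le_one_le)
  finally show "(\<integral>\<^sup>+x. ennreal ((w x)\<^sup>2) \<partial>lborel) \<le> (\<integral>\<^sup>+\<xi>. ennreal (?P \<xi>) \<partial>lborel)"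
    by (simp add: Liminf_const)
qed

section \<open>The Gagliardo seminorm on the Fourier side\<close>

lemma nn_integral_Ioi_scale:
  fixes f :: "real \<Rightarrow> ennreal"
  assumes [measurable]: "f \<in> borel_measurable borel" and r: "r > 0"
  shows "(\<integral>\<^sup>+u\<in>{0<..}. f u \<partial>lborel) = ennreal r * (\<integral>\<^sup>+u\<in>{0<..}. f (r * u) \<partial>lborel)"
proof -
  have "indicator {0<..} (r * u) = (indicator {0<..} u :: ennreal)" for u
    using r by (auto split: split_indicator simp: zero_less_mult_iff)
  then show ?thesis using r by (subst nn_integral_real_affine[where c = r and t = 0]) auto
qed

lemma nn_integral_powr_Ici_finite:
  fixes e :: real assumes "e < -1"
  shows "(\<integral>\<^sup>+u\<in>{1..}. ennreal (u powr e) \<partial>lborel) < \<infinity>"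
proof -
  have "((\<lambda>u. if u \<in> {1..} then u powr e else 0) has_integral -(1 powr (e+1)) / (e+1)) UNIV"
    unfolding has_integral_restrict_UNIV by (rule has_integral_powr_to_inf) (use assms in auto)
  from nn_integral_has_integral_lborel[OF _ _ this]
  have "(\<integral>\<^sup>+u. ennreal (if u \<in> {1..} then u powr e else 0) \<partial>lborel) < \<infinity>" by simp
  moreover have "(\<integral>\<^sup>+u\<in>{1..}. ennreal (u powr e) \<partial>lborel) = (\<integral>\<^sup>+u. ennreal (if u \<in> {1..} then u powr e else 0) \<partial>lborel)"
    by (intro nn_integral_cong) (auto split: split_indicator)
  ultimately show ?thesis by simp
qed

lemma nn_integral_powr_Icc_finite:
  fixes e :: real assumes "e > -1"
  shows "(\<integral>\<^sup>+u\<in>{0..1}. ennreal (u powr e) \<partial>lborel) < \<infinity>"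
proof -
  have "((\<lambda>u. if u \<in> {0..1} then u powr e else 0) has_integral 1 powr (e+1) / (e+1)) UNIV"
    unfolding has_integral_restrict_UNIV by (rule has_integral_powr_from_0) (use assms in auto)
  from nn_integral_has_integral_lborel[OF _ _ this]
  have "(\<integral>\<^sup>+u. ennreal (if u \<in> {0..1} then u powr e else 0) \<partial>lborel) < \<infinity>" by simp
  moreover have "(\<integral>\<^sup>+u\<in>{0..1}. ennreal (u powr e) \<partial>lborel) = (\<integral>\<^sup>+u. ennreal (if u \<in> {0..1} then u powr e else 0) \<partial>lborel)"
    by (intro nn_integral_cong) (auto split: split_indicator)
  ultimately show ?thesis by simp
qed

section \<open>Powers of the norm as superpositions of Gaussians\<close>

lemma nn_integral_Ioi_pos:
  fixes f :: "real \<Rightarrow> real"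
  assumes [measurable]: "f \<in> borel_measurable borel" and "\<And>u. u > 0 \<Longrightarrow> f u > 0"
  shows "0 < (\<integral>\<^sup>+u\<in>{0<..}. ennreal (f u) \<partial>lborel)"
proof (rule ccontr)
  assume "\<not> 0 < (\<integral>\<^sup>+u\<in>{0<..}. ennreal (f u) \<partial>lborel)"
  then have "(\<integral>\<^sup>+u\<in>{0<..}. ennreal (f u) \<partial>lborel) = 0" by simp
  then have "AE u in lborel. ennreal (f u) * indicator {0<..} u = 0"
    by (subst (asm) nn_integral_0_iff_AE) auto
  then have "AE u::real in lborel. u \<notin> {0<..}"
    by (rule eventually_mono) (metis assms(2) ennreal_eq_0_iff greaterThan_iff indicator_simps(1) mult.right_neutral not_less)
  then have "AE u in lborel. \<not> (0 < u \<and> u \<le> (1::real))"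
    by (rule eventually_mono) simp
  from emeasure_eq_0_AE[OF this] have "emeasure lborel {u. 0 < u \<and> u \<le> (1::real)} = 0"
    by simp
  moreover have "{u. 0 < u \<and> u \<le> (1::real)} = {0<..1}" by auto
  ultimately have "emeasure lborel {0<..(1::real)} = 0" by simp
  then show False by simp
qed

text \<open>Substituting \<open>t = norm h * u\<close> pulls out the power of \<open>norm h\<close>;
  the remaining integral over \<open>u\<close> is the constant. It converges at infinity because
  \<beta> > 0 and at 0 because \<open>exp (- 1 / (2 * u\<^sup>2))\<close> beats every power.\<close>

lemma gauss_time_integral:
  fixes h :: "'a::euclidean_space" and \<beta> :: real
  assumes \<beta>: "\<beta> > 0"
  obtains c :: real where "c > 0" "\<And>h::'a. h \<noteq> 0 \<Longrightarrow>
    (\<integral>\<^sup>+t\<in>{0<..}. ennreal (t powr (-1-\<beta>) * gauss t h) \<partial>lborel) = ennreal (c / norm h powr (DIM('a) + \<beta>))"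
proof -
  define g where "g u = u powr (-1-\<beta>) * ((1 / sqrt (2 * pi * u\<^sup>2)) ^ DIM('a) * exp (- 1 / (2 * u\<^sup>2)))" for u
  define J where "J = (\<integral>\<^sup>+u\<in>{0<..}. ennreal (g u) \<partial>lborel)"
  have [measurable]: "g \<in> borel_measurable borel" unfolding g_def by measurable
  have J0: "0 < J" unfolding J_def
    by (rule nn_integral_Ioi_pos) (auto simp: g_def)
  \<comment> \<open>So large that the bound \<open>(2 * real N * u\<^sup>2) ^ N\<close> for the
    exponential outweighs the singularity: \<open>2 * real N - DIM('a) - 1 - \<beta>\<close> is then
    nonnegative.\<close>
  define N where "N = nat \<lceil>DIM('a) + \<beta> + 1\<rceil>"
  have N: "real N \<ge> DIM('a) + \<beta> + 1" unfolding N_def by linarith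
  have N0: "real N > 0" using N \<beta> by linarith
  have gb: "ennreal (g u) * indicator {0<..} u \<le> ennreal ((2 * real N) ^ N) * indicator {0..1} u + ennreal (u powr (-1-\<beta>)) * indicator {1..} u" for u
  proof (cases "u > 0")
    case u: True
    have s: "1 / sqrt (2 * pi * u\<^sup>2) \<le> 1 / u"
    proof -
      have "u\<^sup>2 \<le> 2 * pi * u\<^sup>2" using pi_gt3 by (intro mult_right_mono[of 1 "2*pi" "u\<^sup>2", simplified]) auto
      then have "u \<le> sqrt (2 * pi * u\<^sup>2)" using u by (intro real_le_rsqrt) auto
      then show ?thesis using u by (intro divide_left_mono) auto
    qed
    show ?thesis
    proof (cases "u \<le> 1")
      case True
      \<comment> \<open>From exp x \<ge> (1 + x/N)^N \<ge> (x/N)^N.\<close>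
      have "(1 / (2 * u\<^sup>2) / real N) ^ N \<le> (1 + 1 / (2 * u\<^sup>2) / real N) ^ N"
        using N0 by (intro power_mono) auto
      also have "\<dots> \<le> exp (1 / (2 * u\<^sup>2))"
        by (rule exp_ge_one_plus_x_over_n_power_n) (use N0 in \<open>auto intro: order_trans[of _ 0]\<close>)
      finally have "exp (- 1 / (2 * u\<^sup>2)) \<le> (2 * real N * u\<^sup>2) ^ N"
        using u N0 by (simp add: exp_minus power_divide power_mult_distrib field_simps)
      moreover have "(1 / sqrt (2 * pi * u\<^sup>2)) ^ DIM('a) \<le> (1 / u) ^ DIM('a)"
        using s u by (intro power_mono) auto
      ultimately have "g u \<le> u powr (-1-\<beta>) * ((1 / u) ^ DIM('a) * (2 * real N * u\<^sup>2) ^ N)"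
        unfolding g_def using u by (intro mult_left_mono mult_mono) auto
      also have "\<dots> = (2 * real N) ^ N * u powr (2 * real N - DIM('a) - 1 - \<beta>)"
      proof -
        have 1: "(1 / u) ^ DIM('a) = u powr (- real DIM('a))"
          using u by (simp add: powr_minus powr_realpow power_one_over inverse_eq_divide)
        have 2: "(2 * real N * u\<^sup>2) ^ N = (2 * real N) ^ N * u powr (2 * real N)"
          using u powr_realpow[of u "2 * N"] by (simp add: power_mult_distrib power_mult)
        have "u powr (-1-\<beta>) * (u powr (- real DIM('a)) * u powr (2 * real N)) = u powr (2 * real N - DIM('a) - 1 - \<beta>)"
          unfolding powr_add[symmetric] by (simp add: algebra_simps)
        then show ?thesis unfolding 1 2 by (simp add: mult_ac)
      qed
      also have "\<dots> \<le> (2 * real N) ^ N * 1"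
        using u True N by (intro mult_left_mono powr_le1) auto
      finally show ?thesis using u True by (auto intro: ennreal_leI add_increasing2 split: split_indicator)
    next
      case False
      have "(1 / sqrt (2 * pi * u\<^sup>2)) ^ DIM('a) \<le> 1"
      proof (rule power_le_one)
        show "1 / sqrt (2 * pi * u\<^sup>2) \<le> 1" using s False by (rule_tac order_trans[OF s]) (auto simp: field_simps)
      qed auto
      then have "g u \<le> u powr (-1-\<beta>) * (1 * 1)"
        unfolding g_def by (intro mult_left_mono mult_mono) auto
      then show ?thesis using False by (auto intro: ennreal_leI split: split_indicator)
    qed
  qed (auto split: split_indicator)
  have "J \<le> (\<integral>\<^sup>+u. ennreal ((2 * real N) ^ N) * indicator {0..1::real} u + ennreal (u powr (-1-\<beta>)) * indicator {1..} u \<partial>lborel)"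
    unfolding J_def by (intro nn_integral_mono gb)
  also have "\<dots> = (\<integral>\<^sup>+u. ennreal ((2 * real N) ^ N) * indicator {0..1::real} u \<partial>lborel) + (\<integral>\<^sup>+u. ennreal (u powr (-1-\<beta>)) * indicator {1..} u \<partial>lborel)"
    by (rule nn_integral_add) measurable
  also have "\<dots> < \<infinity>"
    using nn_integral_powr_Ici_finite[of "-1-\<beta>"] \<beta> by (simp add: nn_integral_cmult_indicator less_top[symmetric])
  finally have Jf: "J < \<infinity>" .
  define c where "c = enn2real J"
  have c: "c > 0" "J = ennreal c" using J0 Jf by (auto simp: c_def enn2real_positive_iff less_top)
  show thesis
  proof (rule that[OF c(1)])
    fix h :: 'a assume h: "h \<noteq> 0"
    define r where "r = norm h"
    have r: "r > 0" using h by (simp add: r_def)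
    have *: "(r * u) powr (-1-\<beta>) * gauss (r * u) h = r powr (-1-\<beta>-DIM('a)) * g u" if "u > 0" for u
    proof -
      have "(1 / sqrt (2 * pi * (r * u)\<^sup>2)) ^ DIM('a) = r powr (- real DIM('a)) * (1 / sqrt (2 * pi * u\<^sup>2)) ^ DIM('a)"
        using r that by (simp add: power_mult_distrib real_sqrt_mult powr_minus powr_realpow power_divide inverse_eq_divide)
      moreover have "exp (- (norm h)\<^sup>2 / (2 * (r * u)\<^sup>2)) = exp (- 1 / (2 * u\<^sup>2))"
        using r by (simp add: r_def[symmetric] power_mult_distrib)
      ultimately show ?thesis unfolding gauss_eq g_def using r that
        by (simp add: powr_mult powr_diff powr_minus divide_simps)
    qed
    have "(\<integral>\<^sup>+t\<in>{0<..}. ennreal (t powr (-1-\<beta>) * gauss t h) \<partial>lborel)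
      = ennreal r * (\<integral>\<^sup>+u\<in>{0<..}. ennreal ((r * u) powr (-1-\<beta>) * gauss (r * u) h) \<partial>lborel)"
      using r by (intro nn_integral_Ioi_scale) (auto simp: gauss_eq)
    also have "(\<integral>\<^sup>+u\<in>{0<..}. ennreal ((r * u) powr (-1-\<beta>) * gauss (r * u) h) \<partial>lborel)
      = (\<integral>\<^sup>+u. ennreal (r powr (-1-\<beta>-DIM('a))) * (ennreal (g u) * indicator {0<..} u) \<partial>lborel)"
      by (intro nn_integral_cong) (auto split: split_indicator simp: * ennreal_mult'[symmetric])
    also have "\<dots> = ennreal (r powr (-1-\<beta>-DIM('a))) * J"
      unfolding J_def by (rule nn_integral_cmult) measurable
    also have "ennreal r * \<dots> = ennreal (c / norm h powr (DIM('a) + \<beta>))"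
    proof -
      have "r * (r powr (-1-\<beta>-DIM('a)) * c) = c / r powr (DIM('a) + \<beta>)"
        using r by (simp add: powr_diff powr_minus powr_add divide_simps)
      then show ?thesis using r c by (simp add: r_def[symmetric] ennreal_mult'[symmetric] ennreal_mult''[symmetric])
    qed
    finally show "(\<integral>\<^sup>+t\<in>{0<..}. ennreal (t powr (-1-\<beta>) * gauss t h) \<partial>lborel) = ennreal (c / norm h powr (DIM('a) + \<beta>))" .
  qed
qed

text \<open>Again a rescaling, by \<open>r\<close>. Near 0 the bracket is of order u^2 and leaves
  \<open>u powr (1-\<beta>)\<close>, integrable as \<beta> < 2; at infinity
  \<open>u powr (-1-\<beta>)\<close> is integrable as \<beta> > 0.\<close>

lemma heat_time_integral:
  fixes \<beta> :: real
  assumes \<beta>: "0 < \<beta>" "\<beta> < 2"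
  obtains c :: real where "c > 0" "\<And>r. r \<ge> 0 \<Longrightarrow>
    (\<integral>\<^sup>+t\<in>{0<..}. ennreal (t powr (-1-\<beta>) * (1 - exp (- (t * r)\<^sup>2 / 2))) \<partial>lborel) = ennreal (c * r powr \<beta>)"
proof -
  define g where "g u = u powr (-1-\<beta>) * (1 - exp (- u\<^sup>2 / 2))" for u
  define J where "J = (\<integral>\<^sup>+u\<in>{0<..}. ennreal (g u) \<partial>lborel)"
  have [measurable]: "g \<in> borel_measurable borel" unfolding g_def by measurable
  have J0: "0 < J" unfolding J_def
    by (rule nn_integral_Ioi_pos) (auto simp: g_def)
  have gb: "ennreal (g u) * indicator {0<..} u \<le> ennreal (u powr (1-\<beta>)) * indicator {0..1} u + ennreal (u powr (-1-\<beta>)) * indicator {1..} u" for u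
  proof (cases "u > 0")
    case u: True
    show ?thesis
    proof (cases "u \<le> 1")
      case True
      have "1 - u\<^sup>2 / 2 \<le> exp (- u\<^sup>2 / 2)" using exp_ge_add_one_self[of "- u\<^sup>2 / 2"] by simp
      then have "1 - exp (- u\<^sup>2 / 2) \<le> u\<^sup>2" using zero_le_power2[of u] by linarith
      then have "g u \<le> u powr (-1-\<beta>) * u\<^sup>2"
        unfolding g_def by (intro mult_left_mono) auto
      also have "\<dots> = u powr (1-\<beta>)"
        using u by (simp add: powr_diff powr_minus field_simps power2_eq_square)
      finally have "ennreal (g u) * indicator {0<..} u \<le> ennreal (u powr (1-\<beta>)) * indicator {0..1} u"
        using u True by (auto intro: ennreal_leI)
      then show ?thesis by (rule add_increasing2[rotated]) simp
    next
      case False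
      have "g u \<le> u powr (-1-\<beta>) * 1"
        unfolding g_def by (intro mult_left_mono) auto
      then show ?thesis using False by (auto intro: ennreal_leI split: split_indicator)
    qed
  qed (auto split: split_indicator)
  have "J \<le> (\<integral>\<^sup>+u. ennreal (u powr (1-\<beta>)) * indicator {0..1::real} u + ennreal (u powr (-1-\<beta>)) * indicator {1..} u \<partial>lborel)"
    unfolding J_def by (intro nn_integral_mono gb)
  also have "\<dots> = (\<integral>\<^sup>+u. ennreal (u powr (1-\<beta>)) * indicator {0..1::real} u \<partial>lborel) + (\<integral>\<^sup>+u. ennreal (u powr (-1-\<beta>)) * indicator {1..} u \<partial>lborel)"
    by (rule nn_integral_add) measurable
  also have "\<dots> < \<infinity>"
    using nn_integral_powr_Ici_finite[of "-1-\<beta>"] nn_integral_powr_Icc_finite[of "1-\<beta>"] \<beta> by (simp add: less_top[symmetric])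
  finally have Jf: "J < \<infinity>" .
  define c where "c = enn2real J"
  have c: "c > 0" "J = ennreal c" using J0 Jf by (auto simp: c_def enn2real_positive_iff less_top)
  show thesis
  proof (rule that[OF c(1)])
    fix r :: real assume r0: "r \<ge> 0"
    show "(\<integral>\<^sup>+t\<in>{0<..}. ennreal (t powr (-1-\<beta>) * (1 - exp (- (t * r)\<^sup>2 / 2))) \<partial>lborel) = ennreal (c * r powr \<beta>)"
    proof (cases "r = 0")
      case False
      then have r: "r > 0" using r0 by simp
      have *: "t powr (-1-\<beta>) * (1 - exp (- (t * r)\<^sup>2 / 2)) = r powr (1+\<beta>) * g (r * t)" if "t > 0" for t
        using r that by (simp add: g_def powr_mult powr_diff powr_add powr_minus divide_simps mult_ac)
      have "(\<integral>\<^sup>+t\<in>{0<..}. ennreal (t powr (-1-\<beta>) * (1 - exp (- (t * r)\<^sup>2 / 2))) \<partial>lborel)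
        = (\<integral>\<^sup>+t. ennreal (r powr (1+\<beta>)) * (ennreal (g (r * t)) * indicator {0<..} t) \<partial>lborel)"
        by (intro nn_integral_cong) (use * in \<open>auto split: split_indicator simp: ennreal_mult'[symmetric]\<close>)
      also have "\<dots> = ennreal (r powr (1+\<beta>)) * (\<integral>\<^sup>+t\<in>{0<..}. ennreal (g (r * t)) \<partial>lborel)"
        by (rule nn_integral_cmult) measurable
      also have "\<dots> = ennreal (r powr \<beta>) * (ennreal r * (\<integral>\<^sup>+t\<in>{0<..}. ennreal (g (r * t)) \<partial>lborel))"
        using r by (simp add: powr_add mult.assoc[symmetric] ennreal_mult'[symmetric] ennreal_mult''[symmetric] mult_ac)
      also have "ennreal r * (\<integral>\<^sup>+t\<in>{0<..}. ennreal (g (r * t)) \<partial>lborel) = J"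
        unfolding J_def using r by (subst nn_integral_Ioi_scale[OF _ r]) auto
      finally show ?thesis using c by (simp add: ennreal_mult'[symmetric] mult_ac)
    qed simp
  qed
qed

lemma nn_integral_cos_gauss:
  fixes \<xi> :: "'a::euclidean_space"
  assumes t: "t > 0"
  shows "(\<integral>\<^sup>+h. ennreal ((1 - cos (\<xi> \<bullet> h)) * gauss t h) \<partial>lborel) = ennreal (1 - exp (- (t * norm \<xi>)\<^sup>2 / 2))"
proof -
  have i: "integrable lborel (\<lambda>h. cos (\<xi> \<bullet> h) * gauss t h)"
    using integrable_mult_bounded[OF integrable_gauss[OF t], of "\<lambda>h. cos (\<xi> \<bullet> h)"] by (simp add: mult.commute)
  have "(\<integral>\<^sup>+h. ennreal (gauss t h - cos (\<xi> \<bullet> h) * gauss t h) \<partial>lborel) = ennreal (1 - exp (- (t * norm \<xi>)\<^sup>2 / 2))"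
  proof (subst nn_integral_eq_integral)
    show "AE h in lborel. 0 \<le> gauss t h - cos (\<xi> \<bullet> h) * gauss t h"
      by (rule AE_I2) (use mult_right_mono[OF cos_le_one gauss_nonneg] in simp)
  qed (use t i in \<open>auto simp: gauss_fourier\<close>)
  then show ?thesis by (simp add: left_diff_distrib)
qed

text \<open>The singular kernel is replaced by its Gaussian superposition. By Tonelli the
  \<open>h\<close> integral can be done at fixed \<open>t\<close>, where it is 1 - exp(-(t
  |\<xi>|)^2 / 2), and the \<open>t\<close> integral of this is a multiple of the power of
  \<open>norm \<xi>\<close>.\<close>

lemma cos_kernel_integral:
  fixes \<beta> :: real
  assumes \<beta>: "0 < \<beta>" "\<beta> < 2"
  obtains C :: real where "C > 0" "\<And>\<xi>::'a::euclidean_space.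
    (\<integral>\<^sup>+h. ennreal ((1 - cos (\<xi> \<bullet> h)) / norm h powr (DIM('a) + \<beta>)) \<partial>lborel) = ennreal (C * norm \<xi> powr \<beta>)"
proof -
  obtain a where a: "a > 0" "\<And>h::'a. h \<noteq> 0 \<Longrightarrow>
    (\<integral>\<^sup>+t\<in>{0<..}. ennreal (t powr (-1-\<beta>) * gauss t h) \<partial>lborel) = ennreal (a / norm h powr (DIM('a) + \<beta>))"
    using gauss_time_integral[OF \<beta>(1)] by blast
  obtain b where b: "b > 0" "\<And>r. r \<ge> 0 \<Longrightarrow>
    (\<integral>\<^sup>+t\<in>{0<..}. ennreal (t powr (-1-\<beta>) * (1 - exp (- (t * r)\<^sup>2 / 2))) \<partial>lborel) = ennreal (b * r powr \<beta>)"
    using heat_time_integral[OF \<beta>] by blast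
  have [measurable]: "(\<lambda>(t, h). gauss t (h::'a)) \<in> borel_measurable (borel \<Otimes>\<^sub>M borel)"
    unfolding gauss_eq by measurable
  show thesis
  proof (rule that[of "b / a"])
    fix \<xi> :: 'a
    have "(\<integral>\<^sup>+h. ennreal ((1 - cos (\<xi> \<bullet> h)) / norm h powr (DIM('a) + \<beta>)) \<partial>lborel)
      = (\<integral>\<^sup>+h. ennreal ((1 - cos (\<xi> \<bullet> h)) / a) * (\<integral>\<^sup>+t\<in>{0<..}. ennreal (t powr (-1-\<beta>) * gauss t h) \<partial>lborel) \<partial>lborel)"
    \<comment> \<open>The superposition formula requires \<open>h \<noteq> 0\<close>; the origin is
      a null set.\<close>
    proof (rule nn_integral_cong_AE, use AE_lborel_singleton[of 0] in eventually_elim)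
      case (elim h)
      then show ?case using a by (simp add: ennreal_mult'[symmetric])
    qed
    also have "\<dots> = (\<integral>\<^sup>+h. (\<integral>\<^sup>+t. ennreal ((1 - cos (\<xi> \<bullet> h)) / a) * (ennreal (t powr (-1-\<beta>) * gauss t h) * indicator {0<..} t) \<partial>lborel) \<partial>lborel)"
      by (intro nn_integral_cong nn_integral_cmult[symmetric]) measurable
    also have "\<dots> = (\<integral>\<^sup>+t. (\<integral>\<^sup>+h. ennreal ((1 - cos (\<xi> \<bullet> h)) / a) * (ennreal (t powr (-1-\<beta>) * gauss t h) * indicator {0<..} t) \<partial>lborel) \<partial>lborel)"
      by (rule lborel_pair.Fubini') measurable
    also have "\<dots> = (\<integral>\<^sup>+t. ennreal (1 / a) * (ennreal (t powr (-1-\<beta>) * (1 - exp (- (t * norm \<xi>)\<^sup>2 / 2))) * indicator {0<..} t) \<partial>lborel)"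
    proof (rule nn_integral_cong)
      fix t :: real
      show "(\<integral>\<^sup>+h. ennreal ((1 - cos (\<xi> \<bullet> h)) / a) * (ennreal (t powr (-1-\<beta>) * gauss t h) * indicator {0<..} t) \<partial>lborel)
        = ennreal (1 / a) * (ennreal (t powr (-1-\<beta>) * (1 - exp (- (t * norm \<xi>)\<^sup>2 / 2))) * indicator {0<..} t)"
      proof (cases "t > 0")
        case True
        note * = nn_integral_cos_gauss[OF True, of \<xi>]
        have "(\<integral>\<^sup>+h. ennreal ((1 - cos (\<xi> \<bullet> h)) / a) * (ennreal (t powr (-1-\<beta>) * gauss t h) * indicator {0<..} t) \<partial>lborel)
          = (\<integral>\<^sup>+h. ennreal (1 / a * t powr (-1-\<beta>)) * ennreal ((1 - cos (\<xi> \<bullet> h)) * gauss t h) \<partial>lborel)"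
          using True a(1) by (intro nn_integral_cong) (simp add: ennreal_mult'[symmetric] ennreal_mult''[symmetric] mult_ac)
        also have "\<dots> = ennreal (1 / a * t powr (-1-\<beta>)) * ennreal (1 - exp (- (t * norm \<xi>)\<^sup>2 / 2))"
          unfolding *[symmetric] by (rule nn_integral_cmult) measurable
        finally show ?thesis using True a(1) by (simp add: ennreal_mult'[symmetric] ennreal_mult''[symmetric] mult_ac)
      qed simp
    qed
    also have "\<dots> = ennreal (1 / a) * ennreal (b * norm \<xi> powr \<beta>)"
      using b(2)[of "norm \<xi>"] by (subst nn_integral_cmult) auto
    also have "\<dots> = ennreal (b / a * norm \<xi> powr \<beta>)"
      using a(1) b(1) by (simp add: ennreal_mult'[symmetric])
    finally show "(\<integral>\<^sup>+h. ennreal ((1 - cos (\<xi> \<bullet> h)) / norm h powr (DIM('a) + \<beta>)) \<partial>lborel) = ennreal (b / a * norm \<xi> powr \<beta>)" .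
  qed (use a b in auto)
qed

section \<open>The seminorm as an integral over translations\<close>

abbreviation gagliardo :: "real \<Rightarrow> ('a::euclidean_space \<Rightarrow> real) \<Rightarrow> ennreal" where
  "gagliardo p v \<equiv> (\<integral>\<^sup>+x. (\<integral>\<^sup>+y. ennreal ((v x - v y)\<^sup>2 / norm (x - y) powr p) \<partial>lborel) \<partial>lborel)"

text \<open>A translation by \<open>h\<close> multiplies the transform by a phase of angle a = \<xi>
  . h, and |1 - e^(ia)|^2 = 2 (1 - cos a). In real form the pair of cosine and sine integrals is
  rotated by that angle.\<close>

lemma power_spectrum_shift_diff:
  fixes v :: "'a::euclidean_space \<Rightarrow> real"
  assumes v: "integrable lborel v"
  shows "power_spectrum lborel (\<lambda>x. v x - v (h + x)) \<xi> = 2 * (1 - cos (\<xi> \<bullet> h)) * power_spectrum lborel v \<xi>"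
proof -
  have [measurable]: "v \<in> borel_measurable borel" using borel_measurable_integrable[OF v] by simp
  have c: "integrable lborel (\<lambda>y. v y * cos (\<xi> \<bullet> y - a))" for a
    by (rule integrable_mult_bounded[OF v]) auto
  have s: "integrable lborel (\<lambda>y. v y * sin (\<xi> \<bullet> y - a))" for a
    by (rule integrable_mult_bounded[OF v]) auto
  note c0 = c[of 0, simplified] and s0 = s[of 0, simplified]
  define C where "C = (LINT y|lborel. v y * cos (\<xi> \<bullet> y))"
  define S where "S = (LINT y|lborel. v y * sin (\<xi> \<bullet> y))"
  let ?a = "\<xi> \<bullet> h"
  have iv: "integrable lborel (\<lambda>x. v (h + x))"
    using v integrable_distr_eq[of "(+) h" lborel borel v] by (simp add: lborel_distr_plus)
  have c': "integrable lborel (\<lambda>y. v (h + y) * cos (\<xi> \<bullet> y))"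
    by (rule integrable_mult_bounded[OF iv]) auto
  have s': "integrable lborel (\<lambda>y. v (h + y) * sin (\<xi> \<bullet> y))"
    by (rule integrable_mult_bounded[OF iv]) auto
  have C': "(LINT y|lborel. v (h + y) * cos (\<xi> \<bullet> y)) = C * cos ?a + S * sin ?a"
  proof -
    have "(LINT y|lborel. v (h + y) * cos (\<xi> \<bullet> y)) = (LINT y|lborel. v y * cos (\<xi> \<bullet> y - ?a))"
      by (subst integral_lborel_shift[of "\<lambda>y. v y * cos (\<xi> \<bullet> y - ?a)" h, symmetric]) (auto simp: inner_add_right)
    also have "\<dots> = (LINT y|lborel. (v y * cos (\<xi> \<bullet> y)) * cos ?a + (v y * sin (\<xi> \<bullet> y)) * sin ?a)"
      by (simp add: cos_diff algebra_simps)
    also have "\<dots> = C * cos ?a + S * sin ?a"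
      unfolding C_def S_def using c0 s0 by (subst Bochner_Integration.integral_add) auto
    finally show ?thesis .
  qed
  have S': "(LINT y|lborel. v (h + y) * sin (\<xi> \<bullet> y)) = S * cos ?a - C * sin ?a"
  proof -
    have "(LINT y|lborel. v (h + y) * sin (\<xi> \<bullet> y)) = (LINT y|lborel. v y * sin (\<xi> \<bullet> y - ?a))"
      by (subst integral_lborel_shift[of "\<lambda>y. v y * sin (\<xi> \<bullet> y - ?a)" h, symmetric]) (auto simp: inner_add_right)
    also have "\<dots> = (LINT y|lborel. (v y * sin (\<xi> \<bullet> y)) * cos ?a - (v y * cos (\<xi> \<bullet> y)) * sin ?a)"
      by (simp add: sin_diff algebra_simps)
    also have "\<dots> = S * cos ?a - C * sin ?a"
      unfolding C_def S_def using c0 s0 by (subst Bochner_Integration.integral_diff) auto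
    finally show ?thesis .
  qed
  have "power_spectrum lborel (\<lambda>x. v x - v (h + x)) \<xi> = (C - (C * cos ?a + S * sin ?a))\<^sup>2 + (S - (S * cos ?a - C * sin ?a))\<^sup>2"
    unfolding power_spectrum_def left_diff_distrib
    using c0 s0 c' s' by (simp add: C' S' C_def S_def)
  also have "\<dots> = 2 * (1 - cos ?a) * (C\<^sup>2 + S\<^sup>2)"
    using sin_cos_squared_add[of ?a] by algebra
  finally show ?thesis by (simp add: power_spectrum_def C_def S_def)
qed

text \<open>For fixed \<open>h = y - x\<close> the integral over \<open>x\<close> is the squared L2
  norm of a difference, to which \<open>plancherel\<close> applies; Tonelli then leaves the kernel
  of \<open>cos_kernel_integral\<close>. The constant does not depend on \<open>v\<close>.\<close>

theorem gagliardo_fourier: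
  fixes \<beta> :: real
  assumes \<beta>: "0 < \<beta>" "\<beta> < 2"
  obtains C :: real where "C > 0" "\<And>v::'a::euclidean_space \<Rightarrow> real. integrable lborel v \<Longrightarrow>
    gagliardo (DIM('a) + \<beta>) v
      = ennreal C * (\<integral>\<^sup>+\<xi>. ennreal (norm \<xi> powr \<beta> * power_spectrum lborel v \<xi>) \<partial>lborel)"
proof -
  obtain c where c: "c > 0" "\<And>\<xi>::'a.
    (\<integral>\<^sup>+h. ennreal ((1 - cos (\<xi> \<bullet> h)) / norm h powr (DIM('a) + \<beta>)) \<partial>lborel) = ennreal (c * norm \<xi> powr \<beta>)"
    using cos_kernel_integral[OF \<beta>] by blast
  define P where "P = (2 * pi) ^ DIM('a)"
  have P: "P > 0" by (simp add: P_def)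
  show thesis
  \<comment> \<open>2 from the squared modulus of 1 - e^(ia), \<open>c\<close> from the cosine
    kernel, \<open>P\<close> from Plancherel.\<close>
  proof (rule that[of "2 * c / P"])
    fix v :: "'a \<Rightarrow> real" assume v: "integrable lborel v"
    have [measurable]: "v \<in> borel_measurable borel" using borel_measurable_integrable[OF v] by simp
    have [measurable]: "power_spectrum lborel v \<in> borel_measurable borel"
      by (rule power_spectrum_measurable) (auto intro: sigma_finite_lborel)
    let ?p = "DIM('a) + \<beta>"
    have shift: "(\<integral>\<^sup>+y. ennreal ((v x - v y)\<^sup>2 / norm (x - y) powr ?p) \<partial>lborel)
      = (\<integral>\<^sup>+h. ennreal ((v x - v (h + x))\<^sup>2 / norm h powr ?p) \<partial>lborel)" for x
      by (subst nn_integral_lborel_shift[of _ x, symmetric]) (simp_all add: add.commute)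
    have iv: "integrable lborel (\<lambda>x. v (h + x))" for h
      using v integrable_distr_eq[of "(+) h" lborel borel v] by (simp add: lborel_distr_plus)
    have "gagliardo ?p v
      = (\<integral>\<^sup>+h. (\<integral>\<^sup>+x. ennreal ((v x - v (h + x))\<^sup>2 / norm h powr ?p) \<partial>lborel) \<partial>lborel)"
      unfolding shift by (rule lborel_pair.Fubini') measurable
    also have "\<dots> = (\<integral>\<^sup>+h. ennreal (1 / norm h powr ?p) * (\<integral>\<^sup>+x. ennreal ((v x - v (h + x))\<^sup>2) \<partial>lborel) \<partial>lborel)"
      by (intro nn_integral_cong, subst nn_integral_cmult[symmetric])
        (auto simp: ennreal_mult'[symmetric] ennreal_mult''[symmetric])
    also have "\<dots> = (\<integral>\<^sup>+h. ennreal (1 / norm h powr ?p) * (\<integral>\<^sup>+\<xi>. ennreal (2 * (1 - cos (\<xi> \<bullet> h)) * power_spectrum lborel v \<xi> / P) \<partial>lborel) \<partial>lborel)"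
      unfolding P_def using v iv by (simp add: plancherel power_spectrum_shift_diff)
    also have "\<dots> = (\<integral>\<^sup>+h. (\<integral>\<^sup>+\<xi>. ennreal (2 * power_spectrum lborel v \<xi> / P) * ennreal ((1 - cos (\<xi> \<bullet> h)) / norm h powr ?p) \<partial>lborel) \<partial>lborel)"
    proof (rule nn_integral_cong)
      fix h :: 'a
      have *: "ennreal (1 / norm h powr ?p) * ennreal (2 * (1 - cos (\<xi> \<bullet> h)) * power_spectrum lborel v \<xi> / P)
        = ennreal (2 * power_spectrum lborel v \<xi> / P) * ennreal ((1 - cos (\<xi> \<bullet> h)) / norm h powr ?p)" for \<xi> :: 'a
      proof -
        have "1 / norm h powr ?p * (2 * (1 - cos (\<xi> \<bullet> h)) * power_spectrum lborel v \<xi> / P)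
          = 2 * power_spectrum lborel v \<xi> / P * ((1 - cos (\<xi> \<bullet> h)) / norm h powr ?p)"
          by (simp only: times_divide_times_eq mult_1_left mult_ac)
        moreover have "ennreal (1 / norm h powr ?p) * ennreal (2 * (1 - cos (\<xi> \<bullet> h)) * power_spectrum lborel v \<xi> / P)
          = ennreal (1 / norm h powr ?p * (2 * (1 - cos (\<xi> \<bullet> h)) * power_spectrum lborel v \<xi> / P))"
          by (rule ennreal_mult[symmetric]) (use P in auto)
        moreover have "ennreal (2 * power_spectrum lborel v \<xi> / P) * ennreal ((1 - cos (\<xi> \<bullet> h)) / norm h powr ?p)
          = ennreal (2 * power_spectrum lborel v \<xi> / P * ((1 - cos (\<xi> \<bullet> h)) / norm h powr ?p))"
          by (rule ennreal_mult[symmetric]) (use P in auto)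
        ultimately show ?thesis by metis
      qed
      show "ennreal (1 / norm h powr ?p) * (\<integral>\<^sup>+\<xi>. ennreal (2 * (1 - cos (\<xi> \<bullet> h)) * power_spectrum lborel v \<xi> / P) \<partial>lborel)
        = (\<integral>\<^sup>+\<xi>. ennreal (2 * power_spectrum lborel v \<xi> / P) * ennreal ((1 - cos (\<xi> \<bullet> h)) / norm h powr ?p) \<partial>lborel)"
        unfolding *[symmetric] by (rule nn_integral_cmult[symmetric]) measurable
    qed
    also have "\<dots> = (\<integral>\<^sup>+\<xi>. (\<integral>\<^sup>+h. ennreal (2 * power_spectrum lborel v \<xi> / P) * ennreal ((1 - cos (\<xi> \<bullet> h)) / norm h powr ?p) \<partial>lborel) \<partial>lborel)"
      by (rule lborel_pair.Fubini') measurable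
    also have "\<dots> = (\<integral>\<^sup>+\<xi>. ennreal (2 * c / P) * ennreal (norm \<xi> powr \<beta> * power_spectrum lborel v \<xi>) \<partial>lborel)"
      using P c(1) by (intro nn_integral_cong, subst nn_integral_cmult, measurable, simp only: c(2))
        (simp add: ennreal_mult'[symmetric] ennreal_mult''[symmetric] mult_ac)
    also have "\<dots> = ennreal (2 * c / P) * (\<integral>\<^sup>+\<xi>. ennreal (norm \<xi> powr \<beta> * power_spectrum lborel v \<xi>) \<partial>lborel)"
      by (rule nn_integral_cmult) measurable
    finally show "gagliardo ?p v = \<dots>" .
  qed (use c P in auto)
qed

text \<open>Averaging \<open>cos_kernel_integral\<close> over \<xi> against a Gaussian replaces
  polar coordinates: the average of 1 - cos is 1 - exp(-|h|^2 / 2), which dominates a multiple of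
  min(1, |h|^2), and the other order of integration leaves a Gaussian moment. The result controls
  the lower order terms in \<open>sobolev_space_transplant\<close>.\<close>

lemma nn_integral_min_kernel_finite:
  fixes \<beta> :: real
  assumes \<beta>: "0 < \<beta>" "\<beta> < 2"
  shows "(\<integral>\<^sup>+h. ennreal (min 1 ((norm (h::'a::euclidean_space))\<^sup>2) / norm h powr (DIM('a) + \<beta>)) \<partial>lborel) < \<infinity>"
proof -
  obtain C where C: "C > 0" "\<And>\<xi>::'a.
    (\<integral>\<^sup>+h. ennreal ((1 - cos (\<xi> \<bullet> h)) / norm h powr (DIM('a) + \<beta>)) \<partial>lborel) = ennreal (C * norm \<xi> powr \<beta>)"
    using cos_kernel_integral[OF \<beta>] by blast
  let ?p = "DIM('a) + \<beta>"
  \<comment> \<open>From exp(-y/2) \<le> 2/(2 + y), hence 1 - exp(-y/2) \<ge> y/(2 + y). For y \<le>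
    1 the denominator is at most 3, which gives the constant; for y \<ge> 1 one has 3 y \<ge> 2 +
    y.\<close>
  have min_le: "min 1 y \<le> 3 * (1 - exp (- y / 2))" if "y \<ge> 0" for y :: real
  proof -
    have "exp (- y / 2) * (1 + y / 2) \<le> exp (- y / 2) * exp (y / 2)"
      using exp_ge_add_one_self[of "y / 2"] by (intro mult_left_mono) auto
    then have "exp (- y / 2) * (2 + y) \<le> 2" by (simp add: exp_minus field_simps)
    then have "exp (- y / 2) \<le> 2 / (2 + y)" using that by (simp add: pos_le_divide_eq)
    then have "1 - exp (- y / 2) \<ge> 1 - 2 / (2 + y)" by simp
    also have "1 - 2 / (2 + y) = y / (2 + y)" using that by (simp add: field_simps)
    finally have "3 * (1 - exp (- y / 2)) \<ge> 3 * (y / (2 + y))" by simp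
    moreover have "min 1 y \<le> 3 * (y / (2 + y))"
    proof (cases "y \<le> 1")
      case True then have "y * (2 + y) \<le> y * 3" using that by (intro mult_left_mono) auto
      then show ?thesis using that True by (simp add: pos_le_divide_eq)
    qed (use that in \<open>simp add: pos_le_divide_eq\<close>)
    ultimately show ?thesis by linarith
  qed
  have cosg: "(\<integral>\<^sup>+\<xi>. ennreal ((1 - cos (\<xi> \<bullet> h)) * gauss 1 \<xi>) \<partial>lborel) = ennreal (1 - exp (- (norm h)\<^sup>2 / 2))" for h :: 'a
    using nn_integral_cos_gauss[of 1 h] by (simp add: inner_commute)
  have "(\<integral>\<^sup>+h. ennreal (min 1 ((norm (h::'a))\<^sup>2) / norm h powr ?p) \<partial>lborel)
    \<le> (\<integral>\<^sup>+h. ennreal (3 / norm (h::'a) powr ?p) * (\<integral>\<^sup>+\<xi>. ennreal ((1 - cos (\<xi> \<bullet> h)) * gauss 1 \<xi>) \<partial>lborel) \<partial>lborel)"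
    unfolding cosg
  proof (rule nn_integral_mono)
    fix h :: 'a
    have "min 1 ((norm h)\<^sup>2) / norm h powr ?p \<le> 3 * (1 - exp (- (norm h)\<^sup>2 / 2)) / norm h powr ?p"
      by (intro divide_right_mono min_le) auto
    then show "ennreal (min 1 ((norm h)\<^sup>2) / norm h powr ?p) \<le> ennreal (3 / norm h powr ?p) * ennreal (1 - exp (- (norm h)\<^sup>2 / 2))"
      by (simp add: ennreal_mult'[symmetric] ennreal_leI)
  qed
  also have "\<dots> = (\<integral>\<^sup>+h. (\<integral>\<^sup>+\<xi>. ennreal (3 * gauss 1 (\<xi>::'a)) * ennreal ((1 - cos (\<xi> \<bullet> h)) / norm h powr ?p) \<partial>lborel) \<partial>lborel)"
    by (intro nn_integral_cong, subst nn_integral_cmult[symmetric])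
      (auto simp: ennreal_mult'[symmetric] ennreal_mult''[symmetric] mult_ac)
  also have "\<dots> = (\<integral>\<^sup>+\<xi>. (\<integral>\<^sup>+h. ennreal (3 * gauss 1 (\<xi>::'a)) * ennreal ((1 - cos (\<xi> \<bullet> h)) / norm h powr ?p) \<partial>lborel) \<partial>lborel)"
    by (rule lborel_pair.Fubini') measurable
  also have "\<dots> = (\<integral>\<^sup>+\<xi>. ennreal (3 * C * (norm (\<xi>::'a) powr \<beta> * gauss 1 \<xi>)) \<partial>lborel)"
    using C(1) by (intro nn_integral_cong, subst nn_integral_cmult, measurable, simp only: C(2))
      (simp add: ennreal_mult'[symmetric] ennreal_mult''[symmetric] mult_ac)
  also have "\<dots> \<le> (\<integral>\<^sup>+\<xi>. ennreal (3 * C * (4 * (1 / sqrt (2 * pi)) ^ DIM('a)) * exp (- (1/2 * norm (\<xi>::'a))\<^sup>2)) \<partial>lborel)"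
  proof (intro nn_integral_mono ennreal_leI)
    fix \<xi> :: 'a
    let ?r = "norm \<xi>"
    \<comment> \<open>Half of the Gaussian exponent is spent on absorbing the growth of
      \<open>?r powr \<beta>\<close>.\<close>
    have "?r powr \<beta> \<le> 4 * exp (?r\<^sup>2 / 4)"
    proof (cases "?r \<le> 1")
      case True
      have "?r powr \<beta> \<le> 1" using True \<beta> by (intro powr_le1) auto
      moreover have "1 \<le> exp (?r\<^sup>2 / 4)" by simp
      ultimately show ?thesis by linarith
    next
      case False
      then have "?r powr \<beta> \<le> ?r powr 2" using \<beta> by (intro powr_mono) auto
      also have "\<dots> = ?r\<^sup>2" using False by (subst powr_numeral) auto
      also have "\<dots> \<le> 4 * exp (?r\<^sup>2 / 4)" using exp_ge_add_one_self[of "?r\<^sup>2 / 4"] by linarith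
      finally show ?thesis .
    qed
    then have "?r powr \<beta> * exp (- ?r\<^sup>2 / 2) \<le> 4 * exp (?r\<^sup>2 / 4) * exp (- ?r\<^sup>2 / 2)"
      by (rule mult_right_mono) simp
    also have "\<dots> = 4 * exp (- (1/2 * ?r)\<^sup>2)"
      by (simp add: exp_add[symmetric] power_divide)
    finally have "(1 / sqrt (2 * pi)) ^ DIM('a) * (?r powr \<beta> * exp (- ?r\<^sup>2 / 2)) \<le> (1 / sqrt (2 * pi)) ^ DIM('a) * (4 * exp (- (1/2 * ?r)\<^sup>2))"
      by (rule mult_left_mono) simp
    moreover have "gauss 1 \<xi> = (1 / sqrt (2 * pi)) ^ DIM('a) * exp (- ?r\<^sup>2 / 2)"
      by (simp add: gauss_eq)
    ultimately have "?r powr \<beta> * gauss 1 \<xi> \<le> (4 * (1 / sqrt (2 * pi)) ^ DIM('a)) * exp (- (1/2 * ?r)\<^sup>2)"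
      by (simp only: mult_ac)
    then have "3 * C * (?r powr \<beta> * gauss 1 \<xi>) \<le> 3 * C * ((4 * (1 / sqrt (2 * pi)) ^ DIM('a)) * exp (- (1/2 * ?r)\<^sup>2))"
      by (rule mult_left_mono) (use C(1) in simp)
    then show "3 * C * (?r powr \<beta> * gauss 1 \<xi>) \<le> 3 * C * (4 * (1 / sqrt (2 * pi)) ^ DIM('a)) * exp (- (1/2 * ?r)\<^sup>2)"
      by (simp only: mult.assoc)
  qed
  also have "\<dots> < \<infinity>"
  proof -
    have "integrable lborel (\<lambda>\<xi>::'a. 3 * C * (4 * (1 / sqrt (2 * pi)) ^ DIM('a)) * exp (- (1/2 * norm \<xi>)\<^sup>2))"
      using integrable_exp_gauss[of "1/2", where 'a = 'a] by (intro integrable_mult_right) auto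
    then show ?thesis using C(1) by (subst nn_integral_eq_integral) auto
  qed
  finally show ?thesis .
qed

section \<open>Measures of finite energy have Sobolev densities\<close>

lemma cmod_fourier_transform:
  fixes N :: "'a::euclidean_space measure"
  assumes "finite_measure N" and N[measurable_cong]: "sets N = sets borel"
  shows "(cmod (fourier_transform N \<xi>))\<^sup>2 = power_spectrum N (\<lambda>_. 1) \<xi>"
proof -
  interpret finite_measure N by fact
  have i: "integrable N (\<lambda>x. cis (- (\<xi> \<bullet> x)))"
    by (rule integrable_const_bound[where B = 1]) auto
  have "Re (fourier_transform N \<xi>) = (LINT y|N. 1 * cos (\<xi> \<bullet> y))"
    "Im (fourier_transform N \<xi>) = - (LINT y|N. 1 * sin (\<xi> \<bullet> y))"
    unfolding fourier_transform_def integral_Re[OF i, symmetric] integral_Im[OF i, symmetric] by auto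
  then show ?thesis by (simp add: cmod_power2 power_spectrum_def)
qed

lemma power_spectrum_density:
  fixes v :: "'a::euclidean_space \<Rightarrow> real"
  assumes [measurable]: "v \<in> borel_measurable borel" and "AE x in lborel. 0 \<le> v x"
  shows "power_spectrum (density lborel (\<lambda>x. ennreal (v x))) (\<lambda>_. 1) \<xi> = power_spectrum lborel v \<xi>"
  using assms(2) by (simp add: power_spectrum_def integral_density)

lemma power_spectrum_le:
  fixes N :: "'a::euclidean_space measure"
  assumes "finite_measure N" and N[measurable_cong]: "sets N = sets borel"
  shows "power_spectrum N (\<lambda>_. 1) \<xi> \<le> 2 * (measure N UNIV)\<^sup>2"
proof -
  interpret finite_measure N by fact
  have sp: "space N = UNIV" using sets_eq_imp_space_eq[OF N] by simp
  have b: "\<bar>LINT y|N. f y\<bar> \<le> measure N UNIV" if [measurable]: "f \<in> borel_measurable borel" and "\<And>y. \<bar>f y\<bar> \<le> 1" for f :: "'a \<Rightarrow> real"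
  proof -
    have i: "integrable N f"
      by (rule integrable_const_bound[where B = 1]) (use that in auto)
    have "\<bar>LINT y|N. f y\<bar> \<le> (LINT y|N. \<bar>f y\<bar>)" by (rule integral_abs_bound)
    also have "\<dots> \<le> (LINT y|N. 1)" by (intro integral_mono integrable_abs i) (use that in auto)
    finally show ?thesis by (simp add: sp)
  qed
  have "(LINT y|N. cos (\<xi> \<bullet> y))\<^sup>2 \<le> (measure N UNIV)\<^sup>2" "(LINT y|N. sin (\<xi> \<bullet> y))\<^sup>2 \<le> (measure N UNIV)\<^sup>2"
    by (auto intro!: power2_le_iff_abs_le[THEN iffD2] b)
  then show ?thesis by (simp add: power_spectrum_def)
qed

text \<open>The weight is at least one outside the unit ball, and inside it the spectrum is bounded
  in terms of the total mass. Hence finite energy gives a square integrable transform.\<close>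

lemma power_spectrum_finite:
  fixes N :: "'a::euclidean_space measure"
  assumes fN: "finite_measure N" and N[measurable_cong]: "sets N = sets borel" and "0 < \<beta>"
    and en: "(\<integral>\<^sup>+\<xi>. ennreal (norm \<xi> powr \<beta> * power_spectrum N (\<lambda>_. 1) \<xi>) \<partial>lborel) < \<infinity>"
  shows "(\<integral>\<^sup>+\<xi>. ennreal (power_spectrum N (\<lambda>_. 1) \<xi>) \<partial>lborel) < \<infinity>"
proof -
  interpret finite_measure N by fact
  have [measurable]: "power_spectrum N (\<lambda>_. 1) \<in> borel_measurable borel"
    by (rule power_spectrum_measurable) (simp_all add: N sigma_finite_measure_axioms)
  have [measurable]: "ball (0::'a) 1 \<in> sets borel" by simp
  let ?K = "2 * (measure N UNIV)\<^sup>2"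
  have "(\<integral>\<^sup>+\<xi>. ennreal (power_spectrum N (\<lambda>_. 1) \<xi>) \<partial>lborel)
    \<le> (\<integral>\<^sup>+\<xi>. ennreal ?K * indicator (ball 0 1) \<xi> + ennreal (norm \<xi> powr \<beta> * power_spectrum N (\<lambda>_. 1) \<xi>) \<partial>lborel)"
  proof (rule nn_integral_mono)
    fix \<xi> :: 'a
    show "ennreal (power_spectrum N (\<lambda>_. 1) \<xi>) \<le> ennreal ?K * indicator (ball 0 1) \<xi> + ennreal (norm \<xi> powr \<beta> * power_spectrum N (\<lambda>_. 1) \<xi>)"
    proof (cases "norm \<xi> < 1")
      case True
      then have "ennreal (power_spectrum N (\<lambda>_. 1) \<xi>) \<le> ennreal ?K * indicator (ball 0 1) \<xi>"
        using power_spectrum_le[OF fN N] by (auto intro: ennreal_leI)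
      then show ?thesis by (rule add_increasing2[rotated]) simp
    next
      case False
      then have "1 \<le> norm \<xi> powr \<beta>" using \<open>0 < \<beta>\<close> by (intro ge_one_powr_ge_zero) auto
      then have "1 * power_spectrum N (\<lambda>_. 1) \<xi> \<le> norm \<xi> powr \<beta> * power_spectrum N (\<lambda>_. 1) \<xi>"
        by (intro mult_right_mono) auto
      then show ?thesis using False by (auto intro: ennreal_leI)
    qed
  qed
  also have "\<dots> = ennreal ?K * emeasure lborel (ball (0::'a) 1) + (\<integral>\<^sup>+\<xi>. ennreal (norm \<xi> powr \<beta> * power_spectrum N (\<lambda>_. 1) \<xi>) \<partial>lborel)"
    by (subst nn_integral_add) (auto simp: nn_integral_cmult_indicator)
  also have "\<dots> < \<infinity>"
    using en emeasure_lborel_ball_finite[of "0::'a" 1] by (auto simp: less_top[symmetric] ennreal_mult_eq_top_iff)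
  finally show ?thesis .
qed

lemma ennreal_power2_le_imp_le:
  assumes "x\<^sup>2 \<le> (ennreal y)\<^sup>2" "0 \<le> y" shows "x \<le> ennreal y"
proof (cases x rule: ennreal_cases)
  case (real r)
  then show ?thesis using assms by (auto simp: ennreal_power intro: power2_le_imp_le)
next
  case top
  then show ?thesis using assms by (simp add: ennreal_power top_unique)
qed

text \<open>The mollified measures have squared L2 norm at most \<open>q\<close> by
  \<open>nn_integral_mollified_square\<close>; Cauchy-Schwarz bounds their mass in \<open>U\<close>,
  and Fatou together with openness returns to \<open>N\<close>.\<close>

lemma measure_open_le_power_spectrum:
  fixes N :: "'a::euclidean_space measure"
  assumes fN: "finite_measure N" and N[measurable_cong]: "sets N = sets borel"
    and q: "(\<integral>\<^sup>+\<xi>. ennreal (power_spectrum N (\<lambda>_. 1) \<xi> / (2 * pi) ^ DIM('a)) \<partial>lborel) \<le> ennreal q" "0 \<le> q"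
    and U: "open U" and e: "emeasure lborel U \<le> ennreal e" "0 \<le> e"
  shows "emeasure N U \<le> ennreal (sqrt (q * e))"
proof -
  interpret finite_measure N by fact
  interpret NL: pair_sigma_finite N lborel ..
  have [measurable]: "U \<in> sets borel" using U by simp
  define t where "t n = 1 / real (Suc n)" for n
  have t: "t n > 0" for n by (simp add: t_def)
  have t0: "t \<longlonglongrightarrow> 0" unfolding t_def using LIMSEQ_inverse_real_of_nat by (simp add: inverse_eq_divide)
  define u where "u n x = (LINT y|N. gauss (t n) (x - y) * 1)" for n x
  have [measurable]: "u n \<in> borel_measurable borel" for n unfolding u_def by measurable
  have u: "ennreal (u n x) = (\<integral>\<^sup>+y. ennreal (gauss (t n) (x - y)) \<partial>N)" for n x
  proof -
    have "integrable N (\<lambda>y. gauss (t n) (x - y) * 1)" by (rule integrable_gauss_times) (simp_all add: N)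
    then show ?thesis unfolding u_def by (subst nn_integral_eq_integral[symmetric]) auto
  qed
  have u0: "0 \<le> u n x" for n x unfolding u_def by simp
  have u2: "(\<integral>\<^sup>+x. ennreal ((u n x)\<^sup>2) \<partial>lborel) \<le> ennreal q" for n
  proof -
    have "(\<integral>\<^sup>+x. ennreal ((u n x)\<^sup>2) \<partial>lborel) = (\<integral>\<^sup>+\<xi>. ennreal (exp (- (t n * norm \<xi>)\<^sup>2) * power_spectrum N (\<lambda>_. 1) \<xi> / (2 * pi) ^ DIM('a)) \<partial>lborel)"
      unfolding u_def power_spectrum_def
      by (rule nn_integral_mollified_square) (simp_all add: N t sigma_finite_measure_axioms)
    also have "\<dots> \<le> (\<integral>\<^sup>+\<xi>. ennreal (power_spectrum N (\<lambda>_. 1) \<xi> / (2 * pi) ^ DIM('a)) \<partial>lborel)"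
      by (intro nn_integral_mono ennreal_leI divide_right_mono mult_left_le_one_le) auto
    finally show ?thesis using q(1) by simp
  qed
  have "emeasure N U = (\<integral>\<^sup>+y. indicator U y \<partial>N)" by simp
  \<comment> \<open>By symmetry of the Gaussian, the mass in \<open>U\<close> of the mollified
    measure is the integral of the mollified indicator of \<open>U\<close> against \<open>N\<close>,
    and on \<open>U\<close> that function tends to 1.\<close>
  also have "\<dots> \<le> (\<integral>\<^sup>+y. liminf (\<lambda>n. \<integral>\<^sup>+x. ennreal (gauss (t n) (y - x)) * indicator U x \<partial>lborel) \<partial>N)"
  proof (rule nn_integral_mono)
    fix y
    show "indicator U y \<le> liminf (\<lambda>n. \<integral>\<^sup>+x. ennreal (gauss (t n) (y - x)) * indicator U x \<partial>lborel)"
    proof (cases "y \<in> U")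
      case True
      then show ?thesis using lim_imp_Liminf[OF _ gauss_open_tendsto_1[OF U True t t0]] by simp
    qed simp
  qed
  also have "\<dots> \<le> liminf (\<lambda>n. \<integral>\<^sup>+y. (\<integral>\<^sup>+x. ennreal (gauss (t n) (y - x)) * indicator U x \<partial>lborel) \<partial>N)"
    by (rule nn_integral_liminf) measurable
  also have "\<dots> \<le> liminf (\<lambda>n::nat. ennreal (sqrt (q * e)))"
  proof (intro Liminf_mono always_eventually allI)
    fix n
    have "(\<integral>\<^sup>+y. (\<integral>\<^sup>+x. ennreal (gauss (t n) (y - x)) * indicator U x \<partial>lborel) \<partial>N)
      = (\<integral>\<^sup>+x. (\<integral>\<^sup>+y. ennreal (gauss (t n) (y - x)) * indicator U x \<partial>N) \<partial>lborel)"
      by (rule NL.Fubini'[symmetric]) measurable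
    also have "\<dots> = (\<integral>\<^sup>+x. ennreal (u n x) * indicator U x \<partial>lborel)"
      unfolding u by (simp add: nn_integral_multc gauss_minus_commute)
    finally have a: "(\<integral>\<^sup>+y. (\<integral>\<^sup>+x. ennreal (gauss (t n) (y - x)) * indicator U x \<partial>lborel) \<partial>N) = \<dots>" (is "?a = ?b") .
    have "?b\<^sup>2 \<le> (\<integral>\<^sup>+x. (ennreal (u n x))\<^sup>2 \<partial>lborel) * (\<integral>\<^sup>+x. (indicator U x)\<^sup>2 \<partial>lborel)"
      by (rule Cauchy_Schwarz_nn_integral) measurable
    also have "(\<integral>\<^sup>+x. (indicator U x)\<^sup>2 \<partial>lborel) = emeasure lborel U"
    proof -
      have "(indicator U x)\<^sup>2 = (indicator U x :: ennreal)" for x by (auto split: split_indicator)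
      then show ?thesis by simp
    qed
    also have "(\<integral>\<^sup>+x. (ennreal (u n x))\<^sup>2 \<partial>lborel) * emeasure lborel U \<le> ennreal q * ennreal e"
      using u2[of n] e(1) by (intro mult_mono) (auto simp: ennreal_power u0)
    also have "\<dots> = (ennreal (sqrt (q * e)))\<^sup>2"
      using q(2) e(2) by (simp add: ennreal_power ennreal_mult)
    finally show "?a \<le> ennreal (sqrt (q * e))"
      unfolding a by (rule ennreal_power2_le_imp_le) (use q(2) e(2) in auto)
  qed
  finally show ?thesis by (simp add: Liminf_const)
qed

text \<open>A null set lies in open sets of arbitrarily small volume, and those have small
  \<open>N\<close> measure by \<open>measure_open_le_power_spectrum\<close>.\<close>

lemma finite_energy_absolutely_continuous:
  fixes N :: "'a::euclidean_space measure"
  assumes fN: "finite_measure N" and N: "sets N = sets borel"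
    and fin: "(\<integral>\<^sup>+\<xi>. ennreal (power_spectrum N (\<lambda>_. 1) \<xi>) \<partial>lborel) < \<infinity>"
  shows "absolutely_continuous lborel N"
  unfolding absolutely_continuous_def
proof (rule subsetI)
  interpret finite_measure N by fact
  have [measurable]: "power_spectrum N (\<lambda>_. 1) \<in> borel_measurable borel"
    by (rule power_spectrum_measurable) (simp_all add: N sigma_finite_measure_axioms)
  define q where "q = enn2real (\<integral>\<^sup>+\<xi>. ennreal (power_spectrum N (\<lambda>_. 1) \<xi> / (2 * pi) ^ DIM('a)) \<partial>lborel)"
  have "(\<integral>\<^sup>+\<xi>. ennreal (power_spectrum N (\<lambda>_. 1) \<xi> / (2 * pi) ^ DIM('a)) \<partial>lborel)
    = ennreal (1 / (2 * pi) ^ DIM('a)) * (\<integral>\<^sup>+\<xi>. ennreal (power_spectrum N (\<lambda>_. 1) \<xi>) \<partial>lborel)"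
    by (subst nn_integral_cmult[symmetric]) (auto simp: ennreal_mult'[symmetric])
  also have "\<dots> < \<infinity>" using fin by (auto simp: less_top[symmetric] ennreal_mult_eq_top_iff)
  finally have q: "(\<integral>\<^sup>+\<xi>. ennreal (power_spectrum N (\<lambda>_. 1) \<xi> / (2 * pi) ^ DIM('a)) \<partial>lborel) \<le> ennreal q" "0 \<le> q"
    by (auto simp: q_def)
  fix A :: "'a set" assume A: "A \<in> null_sets lborel"
  then have Ab: "A \<in> sets borel" and A0: "emeasure lborel A = 0" by auto
  have "emeasure N A \<le> 0 + ennreal e" if "e > 0" for e :: real
  proof -
    \<comment> \<open>Then \<open>q * d \<le> e\<^sup>2\<close>; the \<open>+ 1\<close> covers
      \<open>q = 0\<close>.\<close>
    define d where "d = e\<^sup>2 / (q + 1)"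
    have d: "d > 0" using that q(2) by (simp add: d_def)
    obtain U where U: "open U" "A \<subseteq> U" "emeasure lborel (U - A) < ennreal d"
      using outer_regular_lborel[OF Ab d] by metis
    have "emeasure lborel U \<le> emeasure lborel (U - A) + emeasure lborel A"
      using emeasure_subadditive[of "U - A" lborel A] U Ab by (simp add: Un_absorb2)
    then have "emeasure lborel U \<le> ennreal d" using U(3) A0 by simp
    from measure_open_le_power_spectrum[OF fN N q U(1) this] d
    have "emeasure N U \<le> ennreal (sqrt (q * d))" by simp
    moreover have "emeasure N A \<le> emeasure N U" using U by (intro emeasure_mono) (auto simp: N)
    moreover have "sqrt (q * d) \<le> e"
    proof (rule real_le_lsqrt)
      have "q / (q + 1) \<le> 1" using q(2) by simp
      then have "e\<^sup>2 * (q / (q + 1)) \<le> e\<^sup>2" by (intro mult_left_le) auto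
      then show "q * d \<le> e\<^sup>2" by (simp add: d_def mult.commute)
    qed (use that in auto)
    ultimately show ?thesis by (auto intro: order_trans ennreal_leI)
  qed
  then have "emeasure N A \<le> 0" by (rule ennreal_le_epsilon)
  then show "A \<in> null_sets N" using Ab by (simp add: null_sets_def N)
qed

section \<open>From finite energy to Sobolev densities and back\<close>

abbreviation energy :: "real \<Rightarrow> 'a::euclidean_space measure \<Rightarrow> ennreal" where
  "energy \<beta> N \<equiv> (\<integral>\<^sup>+\<xi>. ennreal (norm \<xi> powr \<beta> * (cmod (fourier_transform N \<xi>))\<^sup>2) \<partial>lborel)"

text \<open>Radon-Nikodym supplies a density, integrable because \<open>N\<close> is finite. This
  makes \<open>plancherel\<close> and \<open>gagliardo_fourier\<close> applicable, which turn the
  two Fourier bounds into the two Sobolev bounds.\<close>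

theorem finite_energy_imp_sobolev_density:
  fixes N :: "'a::euclidean_space measure" and \<beta> :: real
  assumes fN: "finite_measure N" and N: "sets N = sets borel" and \<beta>: "0 < \<beta>" "\<beta> < 2"
    and en: "energy \<beta> N < \<infinity>"
  obtains v where "v \<in> borel_measurable borel" "\<And>x. 0 \<le> v x" "N = density lborel (\<lambda>x. ennreal (v x))"
    "(\<integral>\<^sup>+x. ennreal ((v x)\<^sup>2) \<partial>lborel) < \<infinity>"
    "gagliardo (DIM('a) + \<beta>) v < \<infinity>"
proof -
  interpret finite_measure N by fact
  note en' = en[unfolded cmod_fourier_transform[OF fN N]]
  note fin = power_spectrum_finite[OF fN N \<beta>(1) en']
  obtain f where f[measurable]: "f \<in> borel_measurable lborel" and fN: "density lborel f = N"
    using sigma_finite_measure.Radon_Nikodym[OF sigma_finite_lborel finite_energy_absolutely_continuous[OF fN N fin]] N by auto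
  \<comment> \<open>The Radon-Nikodym density takes extended values but is finite almost everywhere;
    \<open>enn2real\<close> replaces \<infinity> by 0.\<close>
  define v where "v x = enn2real (f x)" for x
  have v[measurable]: "v \<in> borel_measurable borel" unfolding v_def using f by simp
  have v0: "0 \<le> v x" for x by (simp add: v_def)
  have fint: "(\<integral>\<^sup>+x. f x \<partial>lborel) \<noteq> \<infinity>"
    using emeasure_finite[of UNIV] unfolding fN[symmetric] by (simp add: emeasure_density)
  have "AE x in lborel. f x \<noteq> \<infinity>" by (rule nn_integral_noteq_infinite[OF f fint])
  then have fv: "AE x in lborel. f x = ennreal (v x)"
    by eventually_elim (simp add: v_def less_top)
  then have Nv: "N = density lborel (\<lambda>x. ennreal (v x))"
    unfolding fN[symmetric] by (intro density_cong) auto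
  have vi: "integrable lborel v"
  proof (rule integrableI_bounded)
    have "(\<integral>\<^sup>+x. ennreal (norm (v x)) \<partial>lborel) = (\<integral>\<^sup>+x. f x \<partial>lborel)"
      by (rule nn_integral_cong_AE) (use fv v0 in auto)
    then show "(\<integral>\<^sup>+x. ennreal (norm (v x)) \<partial>lborel) < \<infinity>" using fint by (simp add: less_top)
  qed simp
  have ps: "power_spectrum N (\<lambda>_. 1) \<xi> = power_spectrum lborel v \<xi>" for \<xi>
    unfolding Nv by (rule power_spectrum_density) (auto simp: v0)
  have [measurable]: "power_spectrum lborel v \<in> borel_measurable borel"
    by (rule power_spectrum_measurable) (auto intro: sigma_finite_lborel)
  have "(\<integral>\<^sup>+x. ennreal ((v x)\<^sup>2) \<partial>lborel) = (\<integral>\<^sup>+\<xi>. ennreal (power_spectrum lborel v \<xi> / (2 * pi) ^ DIM('a)) \<partial>lborel)"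
    by (rule plancherel[OF vi])
  also have "\<dots> = ennreal (1 / (2 * pi) ^ DIM('a)) * (\<integral>\<^sup>+\<xi>. ennreal (power_spectrum lborel v \<xi>) \<partial>lborel)"
    by (subst nn_integral_cmult[symmetric]) (auto simp: ennreal_mult'[symmetric])
  also have "\<dots> < \<infinity>" using fin by (auto simp: less_top[symmetric] ennreal_mult_eq_top_iff ps)
  finally have v2: "(\<integral>\<^sup>+x. ennreal ((v x)\<^sup>2) \<partial>lborel) < \<infinity>" .
  obtain C :: real where "\<And>v::'a \<Rightarrow> real. integrable lborel v \<Longrightarrow>
    gagliardo (DIM('a) + \<beta>) v
      = ennreal C * (\<integral>\<^sup>+\<xi>. ennreal (norm \<xi> powr \<beta> * power_spectrum lborel v \<xi>) \<partial>lborel)"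
    using gagliardo_fourier[OF \<beta>] by blast
  from this[OF vi] have "gagliardo (DIM('a) + \<beta>) v < \<infinity>"
    using en' by (auto simp: ps less_top[symmetric] ennreal_mult_eq_top_iff)
  with v v0 Nv v2 show thesis by (rule that)
qed

text \<open>The converse reading of \<open>gagliardo_fourier\<close>. It relies on
  \<open>C > 0\<close>, since 0 times \<infinity> is 0 in \<open>ennreal\<close>.\<close>

theorem sobolev_density_imp_finite_energy:
  fixes v :: "'a::euclidean_space \<Rightarrow> real" and \<beta> :: real
  assumes v: "integrable lborel v" and v0: "AE x in lborel. 0 \<le> v x" and \<beta>: "0 < \<beta>" "\<beta> < 2"
    and g: "gagliardo (DIM('a) + \<beta>) v < \<infinity>"
  shows "energy \<beta> (density lborel (\<lambda>x. ennreal (v x))) < \<infinity>"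
proof -
  have [measurable]: "v \<in> borel_measurable borel" using borel_measurable_integrable[OF v] by simp
  have fin: "finite_measure (density lborel (\<lambda>x. ennreal (v x)))"
  proof (rule finite_measureI)
    have "(\<integral>\<^sup>+x. ennreal (v x) \<partial>lborel) \<le> (\<integral>\<^sup>+x. ennreal (norm (v x)) \<partial>lborel)"
      by (intro nn_integral_mono ennreal_leI) auto
    then show "emeasure (density lborel (\<lambda>x. ennreal (v x))) (space (density lborel (\<lambda>x. ennreal (v x)))) \<noteq> \<infinity>"
      using v by (auto simp: emeasure_density integrable_iff_bounded top_unique)
  qed
  have ps: "(cmod (fourier_transform (density lborel (\<lambda>x. ennreal (v x))) \<xi>))\<^sup>2 = power_spectrum lborel v \<xi>" for \<xi>
    by (subst cmod_fourier_transform[OF fin]) (auto simp: power_spectrum_density v0)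
  obtain C :: real where C: "C > 0" "\<And>v::'a \<Rightarrow> real. integrable lborel v \<Longrightarrow>
    gagliardo (DIM('a) + \<beta>) v
      = ennreal C * (\<integral>\<^sup>+\<xi>. ennreal (norm \<xi> powr \<beta> * power_spectrum lborel v \<xi>) \<partial>lborel)"
    using gagliardo_fourier[OF \<beta>] by blast
  show ?thesis unfolding ps using g C(1) unfolding C(2)[OF v]
    by (auto simp: less_top[symmetric] ennreal_mult_eq_top_iff)
qed

section \<open>Bi-Lipschitz changes of variables\<close>

lemma emeasure_ball_conv_unit_ball:
  fixes c :: "'a::euclidean_space"
  assumes "r \<ge> 0"
  shows "emeasure lborel (ball c r) = ennreal (r ^ DIM('a) * measure lborel (ball (0::'a) 1))"
proof -
  have "emeasure lborel (ball c r) = ennreal (measure lborel (ball c r))"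
    using emeasure_lborel_ball_finite[of c r] by (intro emeasure_eq_ennreal_measure) auto
  then show ?thesis by (simp only: content_ball_conv_unit_ball[OF assms])
qed

text \<open>Averaging takes the place of a covering theorem. For open \<open>U\<close> the share of
  a small ball about \<open>q\<close> that lies in \<open>U\<close> tends to 1 at each
  \<open>q\<close> in \<open>U\<close>, and Fubini turns the \<nu> integral of that share into an
  average of the \<nu> measures of balls about points of \<open>U\<close>. Outer regularity extends
  the bound to Borel sets.\<close>

lemma emeasure_le_of_balls:
  fixes \<nu> :: "'a::euclidean_space measure"
  assumes fin: "finite_measure \<nu>" and \<nu>[measurable_cong]: "sets \<nu> = sets borel" and "0 \<le> c"
    and balls: "\<And>p r. r > 0 \<Longrightarrow> emeasure \<nu> (ball p r) \<le> ennreal c * emeasure lborel (ball p r)"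
    and B: "B \<in> sets borel"
  shows "emeasure \<nu> B \<le> ennreal c * emeasure lborel B"
proof -
  interpret finite_measure \<nu> by fact
  interpret NL: pair_sigma_finite \<nu> lborel ..
  define vol where "vol r = r ^ DIM('a) * measure lborel (ball (0::'a) 1)" for r
  have vol: "emeasure lborel (ball p r) = ennreal (vol r)" "vol r > 0" if "r > 0" for p :: 'a and r
    using that emeasure_ball_conv_unit_ball[of r p] content_ball_pos[of 1 "0::'a"] by (auto simp: vol_def)
  define r where "r n = 1 / real (Suc n)" for n
  have r: "r n > 0" for n by (simp add: r_def)
  have r0: "r \<longlonglongrightarrow> 0" unfolding r_def using LIMSEQ_inverse_real_of_nat by (simp add: inverse_eq_divide)
  have op: "emeasure \<nu> U \<le> ennreal c * emeasure lborel U" if U: "open U" for U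
  proof -
    have [measurable]: "U \<in> sets borel" using U by simp
    \<comment> \<open>The share of \<open>ball q (r n)\<close> that lies in \<open>U\<close>;
      writing the ball through \<open>p - q\<close> makes joint measurability evident.\<close>
    define k where "k n q = ennreal (1 / vol (r n)) * (\<integral>\<^sup>+p. indicator U p * indicator {z. norm z < r n} (p - q) \<partial>lborel)" for n and q :: 'a
    have k: "k n q = ennreal (1 / vol (r n)) * emeasure lborel (U \<inter> ball q (r n))" for n q
    proof -
      have "indicator U p * indicator {z. norm z < r n} (p - q) = (indicator (U \<inter> ball q (r n)) p :: ennreal)" for p
        by (auto split: split_indicator simp: dist_norm norm_minus_commute)
      then show ?thesis by (simp add: k_def)
    qed
    have [measurable]: "k n \<in> borel_measurable borel" for n unfolding k_def by measurable
    have lim: "indicator U q \<le> liminf (\<lambda>n. k n q)" for q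
    proof (cases "q \<in> U")
      case True
      then obtain e where e: "e > 0" "ball q e \<subseteq> U" using U openE by blast
      have "\<forall>\<^sub>F n in sequentially. r n < e" using order_tendstoD(2)[OF r0 e(1)] .
      then have "\<forall>\<^sub>F n in sequentially. k n q = 1"
      proof eventually_elim
        case (elim n)
        then have "U \<inter> ball q (r n) = ball q (r n)" using e by auto
        then show ?case using vol(1)[OF r[of n], of q] vol(2)[OF r[of n]] by (simp add: k ennreal_mult'[symmetric])
      qed
      then have "(\<lambda>n. k n q) \<longlonglongrightarrow> 1" by (rule tendsto_eventually)
      then show ?thesis using True by (simp add: lim_imp_Liminf)
    qed simp
    have "emeasure \<nu> U = (\<integral>\<^sup>+q. indicator U q \<partial>\<nu>)" by simp
    also have "\<dots> \<le> (\<integral>\<^sup>+q. liminf (\<lambda>n. k n q) \<partial>\<nu>)" by (intro nn_integral_mono lim)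
    also have "\<dots> \<le> liminf (\<lambda>n. \<integral>\<^sup>+q. k n q \<partial>\<nu>)" by (rule nn_integral_liminf) measurable
    also have "\<dots> \<le> liminf (\<lambda>n::nat. ennreal c * emeasure lborel U)"
    proof (intro Liminf_mono always_eventually allI)
      fix n
      have "(\<integral>\<^sup>+q. k n q \<partial>\<nu>) = ennreal (1 / vol (r n)) * (\<integral>\<^sup>+q. (\<integral>\<^sup>+p. indicator U p * indicator {z. norm z < r n} (p - q) \<partial>lborel) \<partial>\<nu>)"
        unfolding k_def by (rule nn_integral_cmult) measurable
      also have "(\<integral>\<^sup>+q. (\<integral>\<^sup>+p. indicator U p * indicator {z. norm z < r n} (p - q) \<partial>lborel) \<partial>\<nu>)
        = (\<integral>\<^sup>+p. (\<integral>\<^sup>+q. indicator U p * indicator {z. norm z < r n} (p - q) \<partial>\<nu>) \<partial>lborel)"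
        by (rule NL.Fubini'[symmetric]) measurable
      also have "\<dots> \<le> (\<integral>\<^sup>+p. indicator U p * (ennreal c * ennreal (vol (r n))) \<partial>lborel)"
      proof (rule nn_integral_mono)
        fix p :: 'a
        have "(\<integral>\<^sup>+q. indicator U p * indicator {z. norm z < r n} (p - q) \<partial>\<nu>)
          = indicator U p * (\<integral>\<^sup>+q. indicator {z. norm z < r n} (p - q) \<partial>\<nu>)"
          by (rule nn_integral_cmult) measurable
        also have "(\<integral>\<^sup>+q. indicator {z. norm z < r n} (p - q) \<partial>\<nu>) = (\<integral>\<^sup>+q. indicator (ball p (r n)) q \<partial>\<nu>)"
          by (intro nn_integral_cong) (auto split: split_indicator simp: dist_norm)
        also have "\<dots> = emeasure \<nu> (ball p (r n))" by (rule nn_integral_indicator) (simp add: \<nu>)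
        also have "indicator U p * \<dots> \<le> indicator U p * (ennreal c * ennreal (vol (r n)))"
          using balls[OF r[of n], of p] by (intro mult_left_mono) (simp_all add: vol[OF r])
        finally show "(\<integral>\<^sup>+q. indicator U p * indicator {z. norm z < r n} (p - q) \<partial>\<nu>) \<le> indicator U p * (ennreal c * ennreal (vol (r n)))" .
      qed
      also have "\<dots> = emeasure lborel U * (ennreal c * ennreal (vol (r n)))"
        by (simp add: nn_integral_multc)
      finally have "(\<integral>\<^sup>+q. k n q \<partial>\<nu>) \<le> ennreal (1 / vol (r n)) * (emeasure lborel U * (ennreal c * ennreal (vol (r n))))"
        by (simp add: mult_left_mono)
      also have "\<dots> = (ennreal (1 / vol (r n)) * ennreal (vol (r n))) * (ennreal c * emeasure lborel U)"
        by (simp only: mult_ac)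
      also have "ennreal (1 / vol (r n)) * ennreal (vol (r n)) = 1"
        using vol(2)[OF r, of n] by (simp add: ennreal_mult'[symmetric])
      finally show "(\<integral>\<^sup>+q. k n q \<partial>\<nu>) \<le> ennreal c * emeasure lborel U" by simp
    qed
    finally show ?thesis by (simp add: Liminf_const)
  qed
  show ?thesis
  proof (rule ennreal_le_epsilon)
    fix e :: real assume e: "e > 0"
    \<comment> \<open>\<open>c + 1\<close> keeps the denominator positive when
      \<open>c = 0\<close>.\<close>
    define d where "d = e / (c + 1)"
    have d: "d > 0" "c * d \<le> e" using e \<open>0 \<le> c\<close> by (auto simp: d_def field_simps)
    obtain U where U: "open U" "B \<subseteq> U" "emeasure lborel (U - B) < ennreal d"
      using outer_regular_lborel[OF B d(1)] by metis
    have "emeasure \<nu> B \<le> emeasure \<nu> U" using U by (intro emeasure_mono) (auto simp: \<nu>)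
    also have "\<dots> \<le> ennreal c * emeasure lborel U" by (rule op[OF U(1)])
    also have "emeasure lborel U \<le> emeasure lborel (U - B) + emeasure lborel B"
      using emeasure_subadditive[of "U - B" lborel B] U B by (simp add: Un_absorb2)
    also have "\<dots> \<le> ennreal d + emeasure lborel B" using U(3) by (intro add_mono) auto
    also have "ennreal c * (ennreal d + emeasure lborel B) = ennreal (c * d) + ennreal c * emeasure lborel B"
      using d(1) \<open>0 \<le> c\<close> by (simp add: distrib_left ennreal_mult)
    also have "\<dots> \<le> ennreal e + ennreal c * emeasure lborel B"
      using d by (intro add_mono ennreal_leI) auto
    finally show "emeasure \<nu> B \<le> ennreal c * emeasure lborel B + ennreal e"
      by (simp add: add.commute mult_left_mono)
  qed
qed

text \<open>A change of variables inequality without derivatives. Since \<phi> shrinks distances by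
  at most the factor \<open>L\<close>, the preimage of a ball of radius \<open>r\<close> fits in a
  ball of radius \<open>2 * L * r\<close>. So the image of Lebesgue measure on \<open>V\<close> is
  bounded on balls, and \<open>emeasure_le_of_balls\<close> extends the bound.\<close>

lemma nn_integral_expanding_le:
  fixes \<phi> :: "'a::euclidean_space \<Rightarrow> 'a"
  assumes V: "compact V" and \<phi>[measurable]: "\<phi> \<in> borel_measurable borel" and L: "L > 0"
    and ex: "\<And>x y. x \<in> V \<Longrightarrow> y \<in> V \<Longrightarrow> dist x y \<le> L * dist (\<phi> x) (\<phi> y)"
    and f[measurable]: "f \<in> borel_measurable borel"
  shows "(\<integral>\<^sup>+x\<in>V. f (\<phi> x) \<partial>lborel) \<le> ennreal ((2 * L) ^ DIM('a)) * (\<integral>\<^sup>+x. f x \<partial>lborel)"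
proof -
  have Vb[measurable]: "V \<in> sets borel" using V by (simp add: borel_compact)
  define \<nu> where "\<nu> = distr (restrict_space lborel V) borel \<phi>"
  have m: "\<phi> \<in> measurable (restrict_space lborel V) borel"
    by (rule measurable_restrict_space1) simp
  have \<nu>e: "emeasure \<nu> B = emeasure lborel (\<phi> -` B \<inter> V)" if "B \<in> sets borel" for B
    unfolding \<nu>_def using that
    by (subst emeasure_distr[OF m]) (auto simp: space_restrict_space emeasure_restrict_space)
  have fin: "finite_measure \<nu>"
  proof (rule finite_measureI)
    have "emeasure \<nu> (space \<nu>) = emeasure lborel V" using \<nu>e[of UNIV] by (simp add: \<nu>_def)
    then show "emeasure \<nu> (space \<nu>) \<noteq> \<infinity>" using emeasure_compact_finite[OF V] by auto
  qed
  have "emeasure \<nu> (ball p r) \<le> ennreal ((2 * L) ^ DIM('a)) * emeasure lborel (ball p r)" if r: "r > 0" for p r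
  proof (cases "\<phi> -` ball p r \<inter> V = {}")
    case False
    then obtain x0 where x0: "x0 \<in> V" "\<phi> x0 \<in> ball p r" by auto
    \<comment> \<open>The new ball is centred at a point of the preimage, as \<open>p\<close> need
      not be attained by \<phi>; this costs the factor 2.\<close>
    have "\<phi> -` ball p r \<inter> V \<subseteq> ball x0 (2 * L * r)"
    proof
      fix x assume x: "x \<in> \<phi> -` ball p r \<inter> V"
      have "dist (\<phi> x0) (\<phi> x) < 2 * r"
        using x x0 dist_triangle3[of "\<phi> x0" "\<phi> x" p] by auto
      then have "L * dist (\<phi> x0) (\<phi> x) < L * (2 * r)" using L by simp
      then show "x \<in> ball x0 (2 * L * r)" using ex[of x0 x] x x0 by (simp add: mult_ac)
    qed
    then have "emeasure \<nu> (ball p r) \<le> emeasure lborel (ball x0 (2 * L * r))"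
      by (simp add: \<nu>e emeasure_mono)
    also have "\<dots> = ennreal ((2 * L) ^ DIM('a)) * emeasure lborel (ball p r)"
      using L r by (simp add: emeasure_ball_conv_unit_ball power_mult_distrib ennreal_mult'[symmetric] mult_ac)
    finally show ?thesis .
  qed (simp add: \<nu>e)
  from emeasure_le_of_balls[OF fin _ _ this] L
  have le: "emeasure \<nu> B \<le> ennreal ((2 * L) ^ DIM('a)) * emeasure lborel B" if "B \<in> sets borel" for B
    using that by (simp add: \<nu>_def)
  have s: "sets \<nu> = sets (scale_measure (ennreal ((2 * L) ^ DIM('a))) lborel)" by (simp add: \<nu>_def)
  have "(\<integral>\<^sup>+x\<in>V. f (\<phi> x) \<partial>lborel) = (\<integral>\<^sup>+x. f x \<partial>\<nu>)"
    unfolding \<nu>_def by (subst nn_integral_distr[OF m]) (auto simp: nn_integral_restrict_space)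
  also have "\<dots> \<le> (\<integral>\<^sup>+x. f x \<partial>scale_measure (ennreal ((2 * L) ^ DIM('a))) lborel)"
  proof (rule nn_integral_mono_measure[OF s])
    show "\<nu> \<le> scale_measure (ennreal ((2 * L) ^ DIM('a))) lborel"
      unfolding le_measure[OF s] using le by (auto intro!: le_funI simp: emeasure_notin_sets \<nu>_def)
  qed
  also have "\<dots> = ennreal ((2 * L) ^ DIM('a)) * (\<integral>\<^sup>+x. f x \<partial>lborel)"
    by (rule nn_integral_scale_measure) simp
  finally show ?thesis .
qed

section \<open>Multiplication and change of variables in Sobolev spaces\<close>

lemma power2_add_le: "((a::real) + b)\<^sup>2 \<le> 2 * a\<^sup>2 + 2 * b\<^sup>2"
  using zero_le_power2[of "a - b"] by (simp add: power2_eq_square algebra_simps)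

text \<open>Pairs at distance at least \<delta> cost only the L2 norm of \<open>w\<close>. For
  closer pairs, if one point is in \<open>K\<close> then both are in \<open>V\<close>, and the
  product rule separates the increment of \<psi>, again an L2 term, from that of \<open>v\<close>
  along \<phi>. The double integral of the latter is transported by
  \<open>nn_integral_expanding_le\<close>, once in each variable.\<close>

lemma sobolev_space_transplant:
  fixes \<phi> :: "real ^ 'm::finite \<Rightarrow> real ^ 'm" and \<psi> v w :: "real ^ 'm \<Rightarrow> real"
  assumes s: "0 < s" "s < 1" and v: "v \<in> sobolev_space s"
    and K: "compact K" and V: "compact V" and \<delta>: "0 < \<delta>" "\<delta> \<le> 1"
    and nbhd: "\<And>x y. x \<in> K \<Longrightarrow> dist x y < \<delta> \<Longrightarrow> y \<in> V"
    and \<phi>: "\<And>x y. x \<in> V \<Longrightarrow> y \<in> V \<Longrightarrow> dist (\<phi> x) (\<phi> y) \<le> L * dist x y"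
    and ex: "\<And>x y. x \<in> V \<Longrightarrow> y \<in> V \<Longrightarrow> dist x y \<le> L * dist (\<phi> x) (\<phi> y)"
    and \<psi>: "\<And>x y. x \<in> V \<Longrightarrow> y \<in> V \<Longrightarrow> dist (\<psi> x) (\<psi> y) \<le> L * dist x y"
    and M: "\<And>x. x \<in> V \<Longrightarrow> \<bar>\<psi> x\<bar> \<le> M" and L: "L > 0"
    and wV: "\<And>x. x \<in> V \<Longrightarrow> w x = \<psi> x * v (\<phi> x)" and wK: "\<And>x. x \<notin> K \<Longrightarrow> w x = 0"
  shows "w \<in> sobolev_space s"
proof -
  have v_meas[measurable]: "v \<in> borel_measurable borel"
    and v2: "(\<integral>\<^sup>+x. ennreal ((v x)\<^sup>2) \<partial>lborel) < \<infinity>"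
    and vG: "gagliardo (real CARD('m) + 2 * s) v < \<infinity>"
    using v by (auto simp: sobolev_space_def)
  have Kb[measurable]: "K \<in> sets borel" and Vb[measurable]: "V \<in> sets borel"
    using K V by (simp_all add: borel_compact)
  have KV: "K \<subseteq> V" using nbhd \<delta> by fastforce
  have c\<phi>: "continuous_on V \<phi>"
    by (rule lipschitz_on_continuous_on[of L]) (use \<phi> L in \<open>auto intro: lipschitz_onI\<close>)
  have c\<psi>: "continuous_on V \<psi>"
    by (rule lipschitz_on_continuous_on[of L]) (use \<psi> L in \<open>auto intro: lipschitz_onI\<close>)
  \<comment> \<open>Extension by zero makes the two factors Borel on the whole space and changes
    nothing on \<open>V\<close>.\<close>
  define f where "f x = indicator V x *\<^sub>R \<phi> x" for x
  define g where "g x = indicator V x *\<^sub>R \<psi> x" for x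
  have [measurable]: "f \<in> borel_measurable borel" "g \<in> borel_measurable borel"
    unfolding f_def g_def by (intro borel_measurable_continuous_on_indicator Vb c\<phi> c\<psi>)+
  have fV: "f x = \<phi> x" if "x \<in> V" for x using that by (simp add: f_def)
  have w_eq: "w = (\<lambda>x. indicator K x * (g x * v (f x)))"
    using wV wK KV by (auto simp: f_def g_def fun_eq_iff split: split_indicator)
  have w_meas[measurable]: "w \<in> borel_measurable borel" unfolding w_eq by measurable
  define c where "c = ennreal ((2 * L) ^ CARD('m))"
  have c: "c < \<infinity>" by (simp add: c_def)
  have change: "(\<integral>\<^sup>+x\<in>V. h (f x) \<partial>lborel) \<le> c * (\<integral>\<^sup>+x. h x \<partial>lborel)"
    if [measurable]: "h \<in> borel_measurable borel" for h
    using nn_integral_expanding_le[OF V _ L, of f h] ex fV by (simp add: c_def)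
  have vf2: "(\<integral>\<^sup>+x\<in>V. ennreal ((v (f x))\<^sup>2) \<partial>lborel) < \<infinity>"
    using le_less_trans[OF change[of "\<lambda>x. ennreal ((v x)\<^sup>2)"]] v2 c by (simp add: ennreal_mult_less_top)
  have w_le: "(w x)\<^sup>2 \<le> M\<^sup>2 * (v (f x))\<^sup>2" if "x \<in> V" for x
  proof -
    have "\<bar>\<psi> x\<bar>\<^sup>2 \<le> M\<^sup>2" using M[OF that] by (intro power_mono) auto
    then show ?thesis using that by (simp add: wV fV power_mult_distrib mult_right_mono)
  qed
  have w2: "(\<integral>\<^sup>+x. ennreal ((w x)\<^sup>2) \<partial>lborel) < \<infinity>"
  proof -
    have "(\<integral>\<^sup>+x. ennreal ((w x)\<^sup>2) \<partial>lborel) \<le> (\<integral>\<^sup>+x. ennreal (M\<^sup>2) * (ennreal ((v (f x))\<^sup>2) * indicator V x) \<partial>lborel)"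
    proof (rule nn_integral_mono)
      fix x
      show "ennreal ((w x)\<^sup>2) \<le> ennreal (M\<^sup>2) * (ennreal ((v (f x))\<^sup>2) * indicator V x)"
      proof (cases "x \<in> V")
        case True then show ?thesis using w_le[OF True] by (simp add: ennreal_mult'[symmetric] ennreal_leI)
      next
        case False then show ?thesis using wK[of x] KV by auto
      qed
    qed
    also have "\<dots> = ennreal (M\<^sup>2) * (\<integral>\<^sup>+x\<in>V. ennreal ((v (f x))\<^sup>2) \<partial>lborel)"
      by (rule nn_integral_cmult) measurable
    also have "\<dots> < \<infinity>" using vf2 by (simp add: ennreal_mult_less_top)
    finally show ?thesis .
  qed
  define p where "p = real CARD('m) + 2 * s"
  \<comment> \<open>The kernel left over by the L2 terms: a squared Lipschitz increment near the
    diagonal, a constant away from it. It is integrable because 0 < s < 1.\<close>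
  define k where "k h = min 1 ((norm h)\<^sup>2) / norm h powr p" for h :: "real ^ 'm"
  have [measurable]: "k \<in> borel_measurable borel" unfolding k_def by measurable
  have k0: "0 \<le> k h" for h by (simp add: k_def)
  have kfin: "(\<integral>\<^sup>+h. ennreal (k h) \<partial>lborel) < \<infinity>"
    using nn_integral_min_kernel_finite[of "2 * s", where 'a = "real ^ 'm"] s by (simp add: k_def p_def)
  have kx: "(\<integral>\<^sup>+y. ennreal (k (x - y)) \<partial>lborel) = (\<integral>\<^sup>+h. ennreal (k h) \<partial>lborel)" for x
    by (rule nn_integral_lborel_reflect) measurable
  have ky: "(\<integral>\<^sup>+x. ennreal (k (x - y)) \<partial>lborel) = (\<integral>\<^sup>+h. ennreal (k h) \<partial>lborel)" for y
    using nn_integral_lborel_shift[of "\<lambda>h. ennreal (k h)" "- y"] by simp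
  \<comment> \<open>The first summand pays for distant pairs, the second for the increment of \<psi>
    at close pairs.\<close>
  define G where "G x = 2 / \<delta>\<^sup>2 * (w x)\<^sup>2 + 2 * L\<^sup>2 * (indicator V x * (v (f x))\<^sup>2)" for x
  have [measurable]: "G \<in> borel_measurable borel" unfolding G_def by measurable
  have G0: "0 \<le> G x" for x by (simp add: G_def)
  have Gfin: "(\<integral>\<^sup>+x. ennreal (G x) \<partial>lborel) < \<infinity>"
  proof -
    have "ennreal (G x) = ennreal (2 / \<delta>\<^sup>2) * ennreal ((w x)\<^sup>2) + ennreal (2 * L\<^sup>2) * (ennreal ((v (f x))\<^sup>2) * indicator V x)" for x
      by (auto simp: G_def ennreal_mult'[symmetric] split: split_indicator)
    then have "(\<integral>\<^sup>+x. ennreal (G x) \<partial>lborel) = ennreal (2 / \<delta>\<^sup>2) * (\<integral>\<^sup>+x. ennreal ((w x)\<^sup>2) \<partial>lborel)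
        + ennreal (2 * L\<^sup>2) * (\<integral>\<^sup>+x\<in>V. ennreal ((v (f x))\<^sup>2) \<partial>lborel)"
      by (simp add: nn_integral_add nn_integral_cmult)
    then show ?thesis using w2 vf2 by (simp add: ennreal_mult_less_top)
  qed
  define F where "F a b = (v a - v b)\<^sup>2 / norm (a - b) powr p" for a b
  have F0: "0 \<le> F a b" for a b by (simp add: F_def)
  have [measurable]: "(\<lambda>(a, b). F a b) \<in> borel_measurable (borel \<Otimes>\<^sub>M borel)" unfolding F_def by measurable
  have Fsym: "F a b = F b a" for a b by (simp add: F_def norm_minus_commute power2_commute)
  \<comment> \<open>\<open>M\<^sup>2\<close> bounds the square of \<psi>, \<open>L powr p\<close>
    replaces the distance of two points by that of their images, and 2 comes from
    \<open>power2_add_le\<close>.\<close>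
  define P where "P = 2 * M\<^sup>2 * L powr p"
  have P0: "0 \<le> P" by (simp add: P_def)
  have near: "(w x - w y)\<^sup>2 / norm (x - y) powr p \<le> G x * k (x - y) + P * F (f x) (f y)"
    if x: "x \<in> V" and y: "y \<in> V" and xy: "norm (x - y) < \<delta>" for x y
  proof (cases "x = y")
    case False
    let ?n = "norm (x - y)"
    have n: "?n > 0" using False by simp
    have "?n \<le> 1" using xy \<delta> by simp
    then have "?n\<^sup>2 \<le> 1" by (simp add: power_le_one)
    then have kk: "k (x - y) = ?n\<^sup>2 / ?n powr p" by (simp add: k_def min_def)
    \<comment> \<open>In the first term \<open>v\<close> is evaluated at \<open>f x\<close> only, so
      the integral over \<open>y\<close> will meet nothing but the kernel \<open>k\<close>.\<close>
    have "w x - w y = (\<psi> x - \<psi> y) * v (f x) + \<psi> y * (v (f x) - v (f y))"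
      using x y by (simp add: wV fV algebra_simps)
    then have "(w x - w y)\<^sup>2 \<le> 2 * ((\<psi> x - \<psi> y) * v (f x))\<^sup>2 + 2 * (\<psi> y * (v (f x) - v (f y)))\<^sup>2"
      using power2_add_le by simp
    also have "\<dots> \<le> 2 * (L\<^sup>2 * ?n\<^sup>2 * (v (f x))\<^sup>2) + 2 * (M\<^sup>2 * (v (f x) - v (f y))\<^sup>2)"
    proof -
      have "\<bar>\<psi> x - \<psi> y\<bar>\<^sup>2 \<le> (L * ?n)\<^sup>2" using \<psi>[OF x y] by (intro power_mono) (auto simp: dist_norm)
      moreover have "\<bar>\<psi> y\<bar>\<^sup>2 \<le> M\<^sup>2" using M[OF y] by (intro power_mono) auto
      ultimately show ?thesis by (auto simp: power_mult_distrib intro!: add_mono mult_right_mono)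
    qed
    finally have "(w x - w y)\<^sup>2 / ?n powr p \<le> (2 * (L\<^sup>2 * ?n\<^sup>2 * (v (f x))\<^sup>2) + 2 * (M\<^sup>2 * (v (f x) - v (f y))\<^sup>2)) / ?n powr p"
      by (rule divide_right_mono) simp
    also have "\<dots> = 2 * L\<^sup>2 * (v (f x))\<^sup>2 * k (x - y) + 2 * M\<^sup>2 * ((v (f x) - v (f y))\<^sup>2 / ?n powr p)"
      by (simp add: kk add_divide_distrib mult_ac)
    also have "\<dots> \<le> G x * k (x - y) + 2 * M\<^sup>2 * (L powr p * F (f x) (f y))"
    proof (intro add_mono mult_right_mono mult_left_mono k0)
      show "2 * L\<^sup>2 * (v (f x))\<^sup>2 \<le> G x" using x by (simp add: G_def)
      let ?m = "norm (f x - f y)"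
      have "?n \<le> L * ?m" using ex[OF x y] x y by (simp add: fV dist_norm)
      then have m: "?m > 0" using n L by (smt (verit) mult_le_0_iff norm_ge_zero zero_less_norm_iff norm_zero mult_zero_right)
      have "?m \<le> L * ?n" using \<phi>[OF x y] x y by (simp add: fV dist_norm)
      then have "?m powr p \<le> (L * ?n) powr p" using s by (intro powr_mono2) (auto simp: p_def)
      then have "?m powr p \<le> L powr p * ?n powr p" using L by (simp add: powr_mult)
      then have "1 / ?n powr p \<le> L powr p / ?m powr p" using m n by (simp add: field_simps)
      then have "(v (f x) - v (f y))\<^sup>2 * (1 / ?n powr p) \<le> (v (f x) - v (f y))\<^sup>2 * (L powr p / ?m powr p)"
        by (rule mult_left_mono) simp
      then show "(v (f x) - v (f y))\<^sup>2 / ?n powr p \<le> L powr p * F (f x) (f y)"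
        by (simp add: F_def mult_ac)
    qed auto
    finally show ?thesis by (simp add: P_def mult_ac)
  qed (use G0 k0 P0 F0 in auto)
  have far: "(w x - w y)\<^sup>2 / norm (x - y) powr p \<le> G x * k (x - y) + G y * k (x - y)"
    if xy: "\<delta> \<le> norm (x - y)" for x y
  proof -
    let ?n = "norm (x - y)"
    have "\<delta>\<^sup>2 \<le> min 1 (?n\<^sup>2)" using xy \<delta> by (auto simp: power_le_one intro: power_mono)
    then have "1 \<le> 1 / \<delta>\<^sup>2 * min 1 (?n\<^sup>2)" using \<delta> by (simp add: field_simps)
    then have "(2 * (w x)\<^sup>2 + 2 * (w y)\<^sup>2) * 1 \<le> (2 * (w x)\<^sup>2 + 2 * (w y)\<^sup>2) * (1 / \<delta>\<^sup>2 * min 1 (?n\<^sup>2))"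
      by (rule mult_left_mono) simp
    moreover have "(w x - w y)\<^sup>2 \<le> 2 * (w x)\<^sup>2 + 2 * (w y)\<^sup>2" using power2_add_le[of "w x" "- w y"] by simp
    ultimately have "(w x - w y)\<^sup>2 \<le> (2 / \<delta>\<^sup>2 * (w x)\<^sup>2 + 2 / \<delta>\<^sup>2 * (w y)\<^sup>2) * min 1 (?n\<^sup>2)"
      by (simp add: field_simps add_divide_distrib)
    also have "\<dots> \<le> (G x + G y) * min 1 (?n\<^sup>2)"
      by (intro mult_right_mono add_mono) (auto simp: G_def)
    finally have "(w x - w y)\<^sup>2 / ?n powr p \<le> (G x + G y) * min 1 (?n\<^sup>2) / ?n powr p"
      by (rule divide_right_mono) simp
    then show ?thesis by (simp add: k_def distrib_right add_divide_distrib)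
  qed
  have all: "ennreal ((w x - w y)\<^sup>2 / norm (x - y) powr p) \<le>
      ennreal (G x) * ennreal (k (x - y)) + ennreal (G y) * ennreal (k (x - y))
      + ennreal P * (ennreal (F (f x) (f y)) * indicator V x * indicator V y)" for x y
  proof -
    have "(w x - w y)\<^sup>2 / norm (x - y) powr p \<le> G x * k (x - y) + G y * k (x - y) + P * (F (f x) (f y) * indicator V x * indicator V y)"
    proof (cases "\<delta> \<le> norm (x - y)")
      case True then show ?thesis using far[OF True] P0 F0 by (simp add: add_increasing2)
    next
      case False
      then have d: "norm (x - y) < \<delta>" by simp
      \<comment> \<open>When \<open>y\<close> is in \<open>K\<close>, the roles are exchanged and
        \<open>G y\<close> takes the place of \<open>G x\<close>; if neither point is in
        \<open>K\<close>, both values vanish.\<close>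
      consider "x \<in> K" | "y \<in> K" | "x \<notin> K" "y \<notin> K" by blast
      then show ?thesis
      proof cases
        case 1
        then have "x \<in> V" "y \<in> V" using nbhd[of x y] d KV by (auto simp: dist_norm)
        then show ?thesis using near[of x y] d mult_nonneg_nonneg[OF G0[of y] k0[of "x - y"]] by simp
      next
        case 2
        then have V: "x \<in> V" "y \<in> V" using nbhd[of y x] d KV by (auto simp: dist_norm norm_minus_commute)
        have "(w x - w y)\<^sup>2 / norm (x - y) powr p \<le> G y * k (x - y) + P * F (f x) (f y)"
          using near[OF V(2,1)] d by (simp add: norm_minus_commute[of y x] power2_commute[of "w y"] Fsym[of "f y"] k_def)
        then show ?thesis using V mult_nonneg_nonneg[OF G0[of x] k0[of "x - y"]] by simp
      next
        case 3
        then show ?thesis using wK G0 k0 P0 F0 by simp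
      qed
    qed
    then have "ennreal ((w x - w y)\<^sup>2 / norm (x - y) powr p)
      \<le> ennreal (G x * k (x - y) + G y * k (x - y) + P * (F (f x) (f y) * indicator V x * indicator V y))"
      by (rule ennreal_leI)
    also have "\<dots> = ennreal (G x) * ennreal (k (x - y)) + ennreal (G y) * ennreal (k (x - y))
      + ennreal P * (ennreal (F (f x) (f y)) * indicator V x * indicator V y)"
      using G0 k0 P0 F0 by (auto simp: ennreal_mult[symmetric] split: split_indicator)
    finally show ?thesis .
  qed
  have Ifin: "(\<integral>\<^sup>+x. (\<integral>\<^sup>+y. ennreal (F (f x) (f y)) * indicator V x * indicator V y \<partial>lborel) \<partial>lborel) < \<infinity>"
  proof -
    have "(\<integral>\<^sup>+x. (\<integral>\<^sup>+y. ennreal (F (f x) (f y)) * indicator V x * indicator V y \<partial>lborel) \<partial>lborel)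
      = (\<integral>\<^sup>+x. (\<integral>\<^sup>+y\<in>V. ennreal (F (f x) (f y)) \<partial>lborel) * indicator V x \<partial>lborel)"
      by (intro nn_integral_cong) (auto split: split_indicator)
    also have "\<dots> \<le> (\<integral>\<^sup>+x. (c * (\<integral>\<^sup>+b. ennreal (F (f x) b) \<partial>lborel)) * indicator V x \<partial>lborel)"
      by (intro nn_integral_mono mult_right_mono change[of "\<lambda>b. ennreal (F _ b)"]) auto
    also have "\<dots> \<le> c * (\<integral>\<^sup>+a. c * (\<integral>\<^sup>+b. ennreal (F a b) \<partial>lborel) \<partial>lborel)"
      by (rule change[of "\<lambda>a. c * (\<integral>\<^sup>+b. ennreal (F a b) \<partial>lborel)"]) measurable
    also have "\<dots> = c * (c * (\<integral>\<^sup>+a. (\<integral>\<^sup>+b. ennreal (F a b) \<partial>lborel) \<partial>lborel))"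
      by (subst nn_integral_cmult) auto
    also have "\<dots> < \<infinity>" using vG c by (auto simp: F_def p_def ennreal_mult_less_top)
    finally show ?thesis .
  qed
  have "gagliardo p w
    \<le> (\<integral>\<^sup>+x. (\<integral>\<^sup>+y. ennreal (G x) * ennreal (k (x - y)) + ennreal (G y) * ennreal (k (x - y))
      + ennreal P * (ennreal (F (f x) (f y)) * indicator V x * indicator V y) \<partial>lborel) \<partial>lborel)"
    by (intro nn_integral_mono all)
  also have "\<dots> = (\<integral>\<^sup>+x. (\<integral>\<^sup>+y. ennreal (G x) * ennreal (k (x - y)) \<partial>lborel) \<partial>lborel)
     + (\<integral>\<^sup>+x. (\<integral>\<^sup>+y. ennreal (G y) * ennreal (k (x - y)) \<partial>lborel) \<partial>lborel)
     + (\<integral>\<^sup>+x. (\<integral>\<^sup>+y. ennreal P * (ennreal (F (f x) (f y)) * indicator V x * indicator V y) \<partial>lborel) \<partial>lborel)"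
    by (simp add: nn_integral_add)
  also have "(\<integral>\<^sup>+x. (\<integral>\<^sup>+y. ennreal (G x) * ennreal (k (x - y)) \<partial>lborel) \<partial>lborel)
    = (\<integral>\<^sup>+x. ennreal (G x) \<partial>lborel) * (\<integral>\<^sup>+h. ennreal (k h) \<partial>lborel)"
    by (simp add: nn_integral_cmult nn_integral_multc kx)
  also have "(\<integral>\<^sup>+x. (\<integral>\<^sup>+y. ennreal (G y) * ennreal (k (x - y)) \<partial>lborel) \<partial>lborel)
    = (\<integral>\<^sup>+y. (\<integral>\<^sup>+x. ennreal (G y) * ennreal (k (x - y)) \<partial>lborel) \<partial>lborel)"
    by (rule lborel_pair.Fubini') measurable
  also have "\<dots> = (\<integral>\<^sup>+x. ennreal (G x) \<partial>lborel) * (\<integral>\<^sup>+h. ennreal (k h) \<partial>lborel)"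
    by (simp add: nn_integral_cmult nn_integral_multc ky)
  also have "(\<integral>\<^sup>+x. (\<integral>\<^sup>+y. ennreal P * (ennreal (F (f x) (f y)) * indicator V x * indicator V y) \<partial>lborel) \<partial>lborel)
    = ennreal P * (\<integral>\<^sup>+x. (\<integral>\<^sup>+y. ennreal (F (f x) (f y)) * indicator V x * indicator V y \<partial>lborel) \<partial>lborel)"
    by (simp add: nn_integral_cmult)
  finally have "gagliardo p w < \<infinity>"
    by (rule le_less_trans) (use Gfin kfin Ifin in \<open>simp add: ennreal_mult_less_top\<close>)
  then show ?thesis using w2 by (simp add: sobolev_space_def p_def)
qed

section \<open>Locally Lipschitz maps\<close>

text \<open>Phrased with \<open>cball x u \<inter> W\<close> to agree with
  \<open>local_lipschitz\<close> for a map that does not depend on time.\<close>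

definition locally_lipschitz_on :: "'a::metric_space set \<Rightarrow> ('a \<Rightarrow> 'b::metric_space) \<Rightarrow> bool" where
  "locally_lipschitz_on W f \<longleftrightarrow> (\<forall>x\<in>W. \<exists>u>0. \<exists>L. L-lipschitz_on (cball x u \<inter> W) f)"

lemma locally_lipschitz_onE:
  assumes "locally_lipschitz_on W f" "x \<in> W"
  obtains u L where "u > 0" "L-lipschitz_on (cball x u \<inter> W) f"
  using assms unfolding locally_lipschitz_on_def by blast

lemma locally_lipschitz_on_compact:
  assumes f: "locally_lipschitz_on W f" and X: "compact X" "X \<subseteq> W"
  obtains L where "L-lipschitz_on X f"
proof -
  \<comment> \<open>A dummy time variable gives access to the compactness theorem for
    \<open>local_lipschitz\<close>.\<close>
  have "local_lipschitz {0::real} W (\<lambda>_. f)"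
    unfolding local_lipschitz_def
  proof (intro ballI)
    fix x and t :: real assume "x \<in> W"
    then obtain u L where "u > 0" "L-lipschitz_on (cball x u \<inter> W) f" by (rule locally_lipschitz_onE[OF f])
    then show "\<exists>u>0. \<exists>L. \<forall>t\<in>cball t u \<inter> {0}. L-lipschitz_on (cball x u \<inter> W) f" by auto
  qed
  then have "local_lipschitz {0::real} X (\<lambda>_. f)" by (rule local_lipschitz_subset) (use X in auto)
  from local_lipschitz_compact_implies_lipschitz[OF this X(1)] that show thesis by auto
qed

lemma locally_lipschitz_on_continuous:
  assumes "locally_lipschitz_on W f" "open W" shows "continuous_on W f"
proof -
  have "isCont f x" if x: "x \<in> W" for x
  proof -
    obtain u L where u: "u > 0" "L-lipschitz_on (cball x u \<inter> W) f"
      using assms(1) x by (auto simp: locally_lipschitz_on_def)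
    have "continuous_on (ball x u \<inter> W) f"
      by (rule continuous_on_subset[OF lipschitz_on_continuous_on[OF u(2)]]) auto
    then show ?thesis using u(1) x assms(2) by (auto simp: continuous_on_eq_continuous_at open_Int)
  qed
  then show ?thesis by (rule continuous_at_imp_continuous_on[rule_format])
qed

lemma locally_lipschitz_on_subset:
  assumes f: "locally_lipschitz_on W f" and X: "X \<subseteq> W" shows "locally_lipschitz_on X f"
  unfolding locally_lipschitz_on_def
proof
  fix x assume "x \<in> X"
  then have "x \<in> W" using X by auto
  then obtain u L where "u > 0" "L-lipschitz_on (cball x u \<inter> W) f"
    by (rule locally_lipschitz_onE[OF f])
  then show "\<exists>u>0. \<exists>L. L-lipschitz_on (cball x u \<inter> X) f"
    using X by (intro exI[of _ u] conjI exI[of _ L]) (auto intro: lipschitz_on_subset)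
qed

lemma locally_lipschitz_on_cong:
  assumes "\<And>x. x \<in> W \<Longrightarrow> f x = g x"
  shows "locally_lipschitz_on W f \<longleftrightarrow> locally_lipschitz_on W g"
proof -
  have "L-lipschitz_on (cball x u \<inter> W) f \<longleftrightarrow> L-lipschitz_on (cball x u \<inter> W) g" for L x u
    by (intro lipschitz_on_cong) (auto simp: assms)
  then show ?thesis by (simp add: locally_lipschitz_on_def)
qed

lemma locally_lipschitz_on_const: "locally_lipschitz_on W (\<lambda>x. c)"
  unfolding locally_lipschitz_on_def by (metis lipschitz_on_constant zero_less_one)

lemma locally_lipschitz_on_add:
  fixes f g :: "'a::metric_space \<Rightarrow> 'b::real_normed_vector"
  assumes f: "locally_lipschitz_on W f" and g: "locally_lipschitz_on W g"
  shows "locally_lipschitz_on W (\<lambda>x. f x + g x)"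
  unfolding locally_lipschitz_on_def
proof
  fix x assume x: "x \<in> W"
  obtain u L where u: "u > 0" "L-lipschitz_on (cball x u \<inter> W) f"
    using f x by (auto simp: locally_lipschitz_on_def)
  obtain u' L' where u': "u' > 0" "L'-lipschitz_on (cball x u' \<inter> W) g"
    using g x by (auto simp: locally_lipschitz_on_def)
  have "(L + L')-lipschitz_on (cball x (min u u') \<inter> W) (\<lambda>x. f x + g x)"
    by (intro lipschitz_on_add lipschitz_on_subset[OF u(2)] lipschitz_on_subset[OF u'(2)]) auto
  then show "\<exists>u>0. \<exists>L. L-lipschitz_on (cball x u \<inter> W) (\<lambda>x. f x + g x)"
    using u u' by (intro exI[of _ "min u u'"]) auto
qed

lemma lipschitz_on_mult_bounded:
  fixes f g :: "'a::metric_space \<Rightarrow> real"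
  assumes f: "L-lipschitz_on X f" and g: "L'-lipschitz_on X g"
    and B: "\<And>x. x \<in> X \<Longrightarrow> \<bar>f x\<bar> \<le> B" "\<And>x. x \<in> X \<Longrightarrow> \<bar>g x\<bar> \<le> B'" and B0: "0 \<le> B" "0 \<le> B'"
  shows "(B * L' + B' * L)-lipschitz_on X (\<lambda>x. f x * g x)"
proof (rule lipschitz_onI)
  fix x y assume xy: "x \<in> X" "y \<in> X"
  have "dist (f x * g x) (f y * g y) = \<bar>f x * (g x - g y) + g y * (f x - f y)\<bar>"
    by (simp add: dist_real_def algebra_simps)
  also have "\<dots> \<le> \<bar>f x\<bar> * \<bar>g x - g y\<bar> + \<bar>g y\<bar> * \<bar>f x - f y\<bar>"
    by (metis abs_mult abs_triangle_ineq)
  also have "\<dots> \<le> B * (L' * dist x y) + B' * (L * dist x y)"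
    using lipschitz_onD[OF f xy] lipschitz_onD[OF g xy] B[OF xy(1)] B[OF xy(2)] B0
    by (intro add_mono mult_mono) (auto simp: dist_real_def)
  finally show "dist (f x * g x) (f y * g y) \<le> (B * L' + B' * L) * dist x y"
    by (simp add: algebra_simps)
qed (use lipschitz_on_nonneg[OF f] lipschitz_on_nonneg[OF g] B0 in auto)

lemma locally_lipschitz_on_mult:
  fixes f g :: "'a::metric_space \<Rightarrow> real"
  assumes f: "locally_lipschitz_on W f" and g: "locally_lipschitz_on W g"
  shows "locally_lipschitz_on W (\<lambda>x. f x * g x)"
  unfolding locally_lipschitz_on_def
proof
  fix x assume x: "x \<in> W"
  have bd: "\<bar>h y\<bar> \<le> \<bar>h x\<bar> + L * u" if "L-lipschitz_on (cball x u \<inter> W) h" "y \<in> cball x u \<inter> W" "u > 0" for L u y and h :: "'a \<Rightarrow> real"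
  proof -
    have "dist (h x) (h y) \<le> L * dist x y" using that x by (intro lipschitz_onD[OF that(1)]) auto
    also have "\<dots> \<le> L * u" using that lipschitz_on_nonneg[OF that(1)] by (intro mult_left_mono) auto
    finally show ?thesis by (simp add: dist_real_def)
  qed
  obtain u L where u: "u > 0" "L-lipschitz_on (cball x u \<inter> W) f"
    using f x by (auto simp: locally_lipschitz_on_def)
  obtain u' L' where u': "u' > 0" "L'-lipschitz_on (cball x u' \<inter> W) g"
    using g x by (auto simp: locally_lipschitz_on_def)
  have "((\<bar>f x\<bar> + L * u) * L' + (\<bar>g x\<bar> + L' * u') * L)-lipschitz_on (cball x (min u u') \<inter> W) (\<lambda>x. f x * g x)"
  proof (rule lipschitz_on_mult_bounded)
    show "\<bar>f y\<bar> \<le> \<bar>f x\<bar> + L * u" if "y \<in> cball x (min u u') \<inter> W" for y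
      using that by (intro bd[OF u(2)]) (use u in auto)
    show "\<bar>g y\<bar> \<le> \<bar>g x\<bar> + L' * u'" if "y \<in> cball x (min u u') \<inter> W" for y
      using that by (intro bd[OF u'(2)]) (use u' in auto)
    show "L-lipschitz_on (cball x (min u u') \<inter> W) f" "L'-lipschitz_on (cball x (min u u') \<inter> W) g"
      by (rule lipschitz_on_subset[OF u(2)] lipschitz_on_subset[OF u'(2)]; auto)+
  qed (use u u' lipschitz_on_nonneg[OF u(2)] lipschitz_on_nonneg[OF u'(2)] in auto)
  then show "\<exists>u>0. \<exists>L. L-lipschitz_on (cball x u \<inter> W) (\<lambda>x. f x * g x)"
    using u u' by (intro exI[of _ "min u u'"]) auto
qed

lemma locally_lipschitz_on_sum:
  fixes f :: "'i \<Rightarrow> 'a::metric_space \<Rightarrow> 'b::real_normed_vector"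
  assumes "\<And>i. i \<in> A \<Longrightarrow> locally_lipschitz_on W (f i)"
  shows "locally_lipschitz_on W (\<lambda>x. \<Sum>i\<in>A. f i x)"
  using assms by (induction A rule: infinite_finite_induct)
    (auto intro: locally_lipschitz_on_add locally_lipschitz_on_const)

lemma locally_lipschitz_on_prod:
  fixes f :: "'i \<Rightarrow> 'a::metric_space \<Rightarrow> real"
  assumes "\<And>i. i \<in> A \<Longrightarrow> locally_lipschitz_on W (f i)"
  shows "locally_lipschitz_on W (\<lambda>x. \<Prod>i\<in>A. f i x)"
  using assms by (induction A rule: infinite_finite_induct)
    (auto intro: locally_lipschitz_on_mult locally_lipschitz_on_const)

lemma locally_lipschitz_on_compose:
  assumes f: "locally_lipschitz_on W f" and g: "locally_lipschitz_on W' g" and sub: "f ` W \<subseteq> W'"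
  shows "locally_lipschitz_on W (\<lambda>x. g (f x))"
  unfolding locally_lipschitz_on_def
proof
  fix x assume x: "x \<in> W"
  obtain u L where u: "u > 0" "L-lipschitz_on (cball x u \<inter> W) f"
    using f x by (auto simp: locally_lipschitz_on_def)
  have "f x \<in> W'" using x sub by auto
  then obtain u' L' where u': "u' > 0" "L'-lipschitz_on (cball (f x) u' \<inter> W') g"
    by (rule locally_lipschitz_onE[OF g])
  note L0 = lipschitz_on_nonneg[OF u(2)]
  \<comment> \<open>Small enough that the image of the ball stays within distance \<open>u'\<close>;
    \<open>L + 1\<close> avoids a zero denominator.\<close>
  define e where "e = min u (u' / (L + 1))"
  have e: "e > 0" using u u' L0 by (simp add: e_def)
  have l: "L-lipschitz_on (cball x e \<inter> W) f"
    by (rule lipschitz_on_subset[OF u(2)]) (auto simp: e_def)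
  have im: "f ` (cball x e \<inter> W) \<subseteq> cball (f x) u' \<inter> W'"
  proof
    fix z assume "z \<in> f ` (cball x e \<inter> W)"
    then obtain y where y: "y \<in> cball x e \<inter> W" "z = f y" by auto
    have "dist (f x) (f y) \<le> L * dist x y" using y x e by (intro lipschitz_onD[OF l]) auto
    also have "\<dots> \<le> (L + 1) * (u' / (L + 1))"
      using y L0 by (intro mult_mono) (auto simp: e_def)
    also have "\<dots> = u'" using L0 by simp
    finally show "z \<in> cball (f x) u' \<inter> W'" using y sub by auto
  qed
  have "(L' * L)-lipschitz_on (cball x e \<inter> W) (\<lambda>x. g (f x))"
    by (rule lipschitz_on_compose2[OF l lipschitz_on_subset[OF u'(2) im]])
  then show "\<exists>u>0. \<exists>L. L-lipschitz_on (cball x u \<inter> W) (\<lambda>x. g (f x))" using e by blast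
qed

text \<open>On a closed ball, compact and convex, the partial derivatives are bounded; their bounds
  add up to a bound for the operator norm, and the mean value inequality applies. Continuity is
  assumed direction by direction to match \<open>Ck_on\<close>.\<close>

lemma locally_lipschitz_on_C1:
  fixes f :: "'a::euclidean_space \<Rightarrow> 'b::real_normed_vector"
  assumes W: "open W" and f: "f differentiable_on W"
    and f': "\<And>v. continuous_on W (\<lambda>x. frechet_derivative f (at x) v)"
  shows "locally_lipschitz_on W f"
  unfolding locally_lipschitz_on_def
proof
  fix x assume x: "x \<in> W"
  obtain u where u: "u > 0" "cball x u \<subseteq> W" using W x open_contains_cball by blast
  have "\<exists>B. \<forall>y\<in>cball x u. norm (frechet_derivative f (at y) i) \<le> B" for i
  proof -
    have "compact ((\<lambda>y. frechet_derivative f (at y) i) ` cball x u)"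
      by (intro compact_continuous_image continuous_on_subset[OF f' u(2)]) auto
    then show ?thesis by (auto dest!: compact_imp_bounded simp: bounded_iff)
  qed
  then obtain B where B: "\<And>i y. y \<in> cball x u \<Longrightarrow> norm (frechet_derivative f (at y) i) \<le> B i" by metis
  have d: "(f has_derivative frechet_derivative f (at y)) (at y)" if "y \<in> W" for y
    using f that W by (simp add: differentiable_on_eq_differentiable_at frechet_derivative_works)
  have "(\<Sum>i\<in>Basis. B i)-lipschitz_on (cball x u) f"
  proof (rule bounded_derivative_imp_lipschitz[where f' = "\<lambda>y. frechet_derivative f (at y)"])
    show "onorm (frechet_derivative f (at y)) \<le> (\<Sum>i\<in>Basis. B i)" if y: "y \<in> cball x u" for y
    proof (rule onorm_le)
      fix h
      interpret bounded_linear "frechet_derivative f (at y)"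
        using d y u has_derivative_bounded_linear by blast
      have "norm (frechet_derivative f (at y) h) = norm (frechet_derivative f (at y) (\<Sum>i\<in>Basis. (h \<bullet> i) *\<^sub>R i))"
        by (simp add: euclidean_representation)
      also have "\<dots> \<le> (\<Sum>i\<in>Basis. norm ((h \<bullet> i) *\<^sub>R frechet_derivative f (at y) i))"
        unfolding sum scaleR by (rule norm_sum)
      also have "\<dots> \<le> (\<Sum>i\<in>Basis. norm h * B i)"
        by (intro sum_mono) (auto intro!: mult_mono B y Basis_le_norm)
      finally show "norm (frechet_derivative f (at y) h) \<le> (\<Sum>i\<in>Basis. B i) * norm h"
        by (simp add: sum_distrib_left mult.commute)
    qed
    have "0 \<le> B i" for i using order_trans[OF norm_ge_zero B[of x i]] u(1) by simp
    then show "0 \<le> (\<Sum>i\<in>Basis. B i)" by (simp add: sum_nonneg)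
    show "(f has_derivative frechet_derivative f (at y)) (at y within cball x u)" if "y \<in> cball x u" for y
      by (rule has_derivative_at_withinI[OF d]) (use u(2) that in blast)
  qed (rule convex_cball)
  then have "(\<Sum>i\<in>Basis. B i)-lipschitz_on (cball x u \<inter> W) f" using u by (simp add: Int_absorb2)
  then show "\<exists>u>0. \<exists>L. L-lipschitz_on (cball x u \<inter> W) f" using u(1) by blast
qed

section \<open>Smooth maps and elementary functions are locally Lipschitz\<close>

lemma smooth_map_on_locally_lipschitz:
  assumes "open W" "smooth_map_on W f" shows "locally_lipschitz_on W f"
proof -
  have "Ck_on (Suc 0) W f" using assms(2) by (simp add: smooth_map_on_def)
  then show ?thesis by (intro locally_lipschitz_on_C1 assms(1)) auto
qed

lemma smooth_map_on_derivative:
  assumes "smooth_map_on W f" shows "smooth_map_on W (\<lambda>x. frechet_derivative f (at x) v)"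
  unfolding smooth_map_on_def
proof
  fix k
  have "Ck_on (Suc k) W f" using assms by (simp add: smooth_map_on_def)
  then show "Ck_on k W (\<lambda>x. frechet_derivative f (at x) v)" by simp
qed

lemma locally_lipschitz_on_inverse: "locally_lipschitz_on {0<..} (inverse :: real \<Rightarrow> real)"
proof (rule locally_lipschitz_on_C1)
  have d: "(inverse has_derivative (\<lambda>h. - (inverse x * h * inverse x))) (at x)" if "x > 0" for x :: real
    using that by (intro has_derivative_inverse') auto
  then show "inverse differentiable_on {0::real<..}"
    by (auto simp: differentiable_on_eq_differentiable_at differentiable_def)
  show "continuous_on {0::real<..} (\<lambda>x. frechet_derivative inverse (at x) v)" for v
    by (subst continuous_on_cong[OF refl frechet_derivative_at[OF d, symmetric, THEN fun_cong]])
      (auto intro!: continuous_intros)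
qed simp

lemma locally_lipschitz_on_sqrt: "locally_lipschitz_on {0<..} sqrt"
proof (rule locally_lipschitz_on_C1)
  have d: "(sqrt has_derivative (*) (inverse (sqrt x) / 2)) (at x)" if "x > 0" for x :: real
    using DERIV_real_sqrt[OF that] by (simp add: has_field_derivative_def)
  then show "sqrt differentiable_on {0<..}"
    by (auto simp: differentiable_on_eq_differentiable_at differentiable_def)
  show "continuous_on {0<..} (\<lambda>x. frechet_derivative sqrt (at x) v)" for v
    by (subst continuous_on_cong[OF refl frechet_derivative_at[OF d, symmetric, THEN fun_cong]])
      (auto intro!: continuous_intros)
qed simp

section \<open>The Gram density\<close>

text \<open>The segment from the identity to the Gram matrix consists of positive definite, hence
  invertible, matrices; along it the determinant starts at 1 and cannot change sign.\<close>

lemma det_gram_pos: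
  fixes f :: "real ^ 'm::finite \<Rightarrow> real ^ 'n::finite"
  assumes f: "linear f" "inj f"
  shows "0 < det (transpose (matrix f) ** matrix f)"
proof -
  let ?G = "transpose (matrix f) ** matrix f"
  define H where "H t = (1 - t) *\<^sub>R mat 1 + t *\<^sub>R ?G" for t :: real
  \<comment> \<open>Positive for \<open>x \<noteq> 0\<close> and t in [0, 1]: by the first term if t
    < 1, and by the second if t > 0 because \<open>f\<close> is injective.\<close>
  have ip: "x \<bullet> (H t *v x) = (1 - t) * (norm x)\<^sup>2 + t * (norm (f x))\<^sup>2" for t x
  proof -
    have "x \<bullet> (?G *v x) = (matrix f *v x) \<bullet> (matrix f *v x)"
      by (simp add: matrix_vector_mul_assoc[symmetric] dot_lmul_matrix[symmetric] inner_commute)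
    moreover have "matrix f *v x = f x" using f(1) by (simp add: matrix_works)
    ultimately show ?thesis
      by (simp add: H_def matrix_vector_mult_add_rdistrib scaleR_matrix_vector_assoc[symmetric] inner_add_right power2_norm_eq_inner)
  qed
  have nz: "det (H t) \<noteq> 0" if "t \<in> {0..1}" for t
  proof
    assume "det (H t) = 0"
    then have "\<not> inj ((*v) (H t))" using det_nz_iff_inj[of "(*v) (H t)"] by (simp add: matrix_of_matrix_vector_mul)
    then obtain x where x: "x \<noteq> 0" "H t *v x = 0"
      by (metis linear_injective_0 matrix_vector_mul_linear)
    have "norm (f x) > 0" using x(1) f by (metis linear_injective_0 zero_less_norm_iff)
    then have "0 < x \<bullet> (H t *v x)"
      unfolding ip using that x(1) by (cases "t = 0") (auto intro!: add_nonneg_pos)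
    then show False using x by simp
  qed
  have cont: "continuous_on {0..1} (\<lambda>t. det (H t))"
    unfolding det_def H_def by (auto intro!: continuous_intros)
  have "0 < det (H 1)"
  proof (rule ccontr)
    assume "\<not> 0 < det (H 1)"
    then have "det (H 1) \<le> 0" by simp
    moreover have "0 \<le> det (H 0)" by (simp add: H_def)
    ultimately obtain t where "0 \<le> t" "t \<le> 1" "det (H t) = 0"
      using IVT2'[of "\<lambda>t. det (H t)" 1 0 0] cont by auto
    then show False using nz by auto
  qed
  then show ?thesis by (simp add: H_def)
qed

lemma gram_density_pos:
  fixes \<Phi> :: "real ^ 'm::finite \<Rightarrow> real ^ 'n::finite"
  assumes "open U" "smooth_map_on U \<Phi>" "u \<in> U" "inj (frechet_derivative \<Phi> (at u))"
  shows "0 < gram_density \<Phi> u"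
proof -
  have "Ck_on (Suc 0) U \<Phi>" using assms(2) by (simp add: smooth_map_on_def)
  then have "\<Phi> differentiable (at u)"
    using assms(1,3) by (auto simp: differentiable_on_eq_differentiable_at)
  then have "linear (frechet_derivative \<Phi> (at u))" by (rule linear_frechet_derivative)
  from det_gram_pos[OF this assms(4)] show ?thesis by (simp add: gram_density_def Let_def)
qed

text \<open>The determinant is a polynomial in the entries of the Jacobian, which are smooth. As
  \<open>sqrt\<close> is locally Lipschitz only away from 0, injectivity of the derivative is needed
  to keep the determinant positive.\<close>

lemma gram_density_locally_lipschitz:
  fixes \<Phi> :: "real ^ 'm::finite \<Rightarrow> real ^ 'n::finite"
  assumes U: "open U" and \<Phi>: "smooth_map_on U \<Phi>" and inj: "\<And>u. u \<in> U \<Longrightarrow> inj (frechet_derivative \<Phi> (at u))"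
  shows "locally_lipschitz_on U (gram_density \<Phi>)"
proof -
  define J where "J u = matrix (frechet_derivative \<Phi> (at u))" for u
  have J: "locally_lipschitz_on U (\<lambda>u. J u $ i $ j)" for i j
  proof -
    have "locally_lipschitz_on UNIV (\<lambda>x::real ^ 'n. x $ i)"
      unfolding locally_lipschitz_on_def
      by (intro ballI exI[of _ 1] conjI exI[of _ 1] lipschitz_onI) (auto simp: dist_vec_nth_le)
    from locally_lipschitz_on_compose[OF smooth_map_on_locally_lipschitz[OF U smooth_map_on_derivative[OF \<Phi>, of "axis j 1"]] this]
    show ?thesis by (simp add: J_def matrix_def)
  qed
  have "locally_lipschitz_on U (\<lambda>u. det (transpose (J u) ** J u))"
    unfolding det_def
    by (intro locally_lipschitz_on_sum locally_lipschitz_on_mult locally_lipschitz_on_const locally_lipschitz_on_prod)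
      (auto simp: matrix_matrix_mult_def transpose_def intro!: locally_lipschitz_on_sum locally_lipschitz_on_mult J)
  moreover have "0 < det (transpose (J u) ** J u)" if "u \<in> U" for u
    using gram_density_pos[OF U \<Phi> that inj[OF that]] by (simp add: gram_density_def J_def Let_def)
  ultimately have "locally_lipschitz_on U (\<lambda>u. sqrt (det (transpose (J u) ** J u)))"
    by (intro locally_lipschitz_on_compose[OF _ locally_lipschitz_on_sqrt]) auto
  then show ?thesis by (simp add: gram_density_def[abs_def] J_def Let_def)
qed

section \<open>Sobolev functions and locally bi-Lipschitz maps\<close>

lemma sobolev_space_add:
  assumes "u \<in> sobolev_space s" "v \<in> sobolev_space s"
  shows "(\<lambda>x. u x + v x) \<in> (sobolev_space s :: (real ^ 'm::finite \<Rightarrow> real) set)"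
proof -
  let ?p = "real CARD('m) + 2 * s"
  have [measurable]: "u \<in> borel_measurable borel" "v \<in> borel_measurable borel"
    and u2: "(\<integral>\<^sup>+x. ennreal ((u x)\<^sup>2) \<partial>lborel) < \<infinity>" and v2: "(\<integral>\<^sup>+x. ennreal ((v x)\<^sup>2) \<partial>lborel) < \<infinity>"
    and uG: "gagliardo ?p u < \<infinity>"
    and vG: "gagliardo ?p v < \<infinity>"
    using assms by (auto simp: sobolev_space_def)
  have two: "ennreal (2 * a) = 2 * ennreal a" if "0 \<le> a" for a using that by (simp add: ennreal_mult)
  have "(\<integral>\<^sup>+x. ennreal ((u x + v x)\<^sup>2) \<partial>lborel) \<le> (\<integral>\<^sup>+x. 2 * ennreal ((u x)\<^sup>2) + 2 * ennreal ((v x)\<^sup>2) \<partial>lborel)"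
    using power2_add_le[of "u _" "v _"]
    by (intro nn_integral_mono) (simp add: two[symmetric] ennreal_plus[symmetric] del: ennreal_plus)
  also have "\<dots> < \<infinity>" using u2 v2 by (simp add: nn_integral_add nn_integral_cmult ennreal_mult_less_top)
  finally have 1: "(\<integral>\<^sup>+x. ennreal ((u x + v x)\<^sup>2) \<partial>lborel) < \<infinity>" .
  have "(\<integral>\<^sup>+x. (\<integral>\<^sup>+y. ennreal ((u x + v x - (u y + v y))\<^sup>2 / norm (x - y) powr ?p) \<partial>lborel) \<partial>lborel)
    \<le> (\<integral>\<^sup>+x. (\<integral>\<^sup>+y. 2 * ennreal ((u x - u y)\<^sup>2 / norm (x - y) powr ?p) + 2 * ennreal ((v x - v y)\<^sup>2 / norm (x - y) powr ?p) \<partial>lborel) \<partial>lborel)"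
  proof (intro nn_integral_mono)
    fix x y
    have "(u x + v x - (u y + v y))\<^sup>2 \<le> 2 * (u x - u y)\<^sup>2 + 2 * (v x - v y)\<^sup>2"
      using power2_add_le[of "u x - u y" "v x - v y"] by (simp add: algebra_simps)
    then have "(u x + v x - (u y + v y))\<^sup>2 / norm (x - y) powr ?p \<le> 2 * ((u x - u y)\<^sup>2 / norm (x - y) powr ?p) + 2 * ((v x - v y)\<^sup>2 / norm (x - y) powr ?p)"
      by (simp add: divide_right_mono flip: add_divide_distrib)
    then have "ennreal ((u x + v x - (u y + v y))\<^sup>2 / norm (x - y) powr ?p) \<le> ennreal (2 * ((u x - u y)\<^sup>2 / norm (x - y) powr ?p) + 2 * ((v x - v y)\<^sup>2 / norm (x - y) powr ?p))"
      by (rule ennreal_leI)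
    also have "\<dots> = 2 * ennreal ((u x - u y)\<^sup>2 / norm (x - y) powr ?p) + 2 * ennreal ((v x - v y)\<^sup>2 / norm (x - y) powr ?p)"
      by (subst ennreal_plus) (simp_all only: two zero_le_divide_iff zero_le_power2 powr_ge_zero simp_thms mult_nonneg_nonneg zero_le_numeral)
    finally show "ennreal ((u x + v x - (u y + v y))\<^sup>2 / norm (x - y) powr ?p) \<le> \<dots>" .
  qed
  also have "\<dots> < \<infinity>" using uG vG by (simp add: nn_integral_add nn_integral_cmult ennreal_mult_less_top)
  finally show ?thesis using 1 by (simp add: sobolev_space_def)
qed

lemma sobolev_space_zero: "(\<lambda>x. 0) \<in> sobolev_space s"
  by (simp add: sobolev_space_def)

lemma sobolev_space_sum:
  assumes "\<And>i. i \<in> A \<Longrightarrow> u i \<in> sobolev_space s"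
  shows "(\<lambda>x. \<Sum>i\<in>A. u i x) \<in> sobolev_space s"
  using assms by (induction A rule: infinite_finite_induct)
    (auto intro!: sobolev_space_add sobolev_space_zero)

text \<open>Borel measurability of \<open>v\<close> is a separate hypothesis because it does not
  follow from equality almost everywhere.\<close>

lemma sobolev_space_cong_AE:
  fixes u v :: "real ^ 'm::finite \<Rightarrow> real"
  assumes u: "u \<in> sobolev_space s" and v: "v \<in> borel_measurable borel" and uv: "AE x in lborel. u x = v x"
  shows "v \<in> sobolev_space s"
proof -
  have "(\<integral>\<^sup>+x. ennreal ((v x)\<^sup>2) \<partial>lborel) = (\<integral>\<^sup>+x. ennreal ((u x)\<^sup>2) \<partial>lborel)"
    by (rule nn_integral_cong_AE) (use uv in auto)
  moreover have "gagliardo (real CARD('m) + 2 * s) v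
     = gagliardo (real CARD('m) + 2 * s) u"
  proof (rule nn_integral_cong_AE, use uv in eventually_elim)
    case (elim x)
    show ?case by (rule nn_integral_cong_AE) (use uv elim in auto)
  qed
  ultimately show ?thesis using u v by (simp add: sobolev_space_def)
qed

text \<open>Local constants become uniform on a compact neighbourhood \<open>V\<close> of
  \<open>K\<close> in \<open>W\<close>. The lower bound on distances comes from the inverse
  \<theta>, which is Lipschitz on the compact image of \<open>V\<close>.\<close>

lemma sobolev_space_locally_lipschitz:
  fixes \<phi> :: "real ^ 'm::finite \<Rightarrow> real ^ 'm" and \<psi> v w :: "real ^ 'm \<Rightarrow> real"
  assumes s: "0 < s" "s < 1" and v: "v \<in> sobolev_space s" and W: "open W" and K: "compact K" "K \<subseteq> W"
    and \<phi>: "locally_lipschitz_on W \<phi>" "\<phi> ` W \<subseteq> W'" and \<theta>: "locally_lipschitz_on W' \<theta>" "\<And>x. x \<in> W \<Longrightarrow> \<theta> (\<phi> x) = x"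
    and \<psi>: "locally_lipschitz_on W \<psi>"
    and wW: "\<And>x. x \<in> W \<Longrightarrow> w x = \<psi> x * v (\<phi> x)" and wK: "\<And>x. x \<notin> K \<Longrightarrow> w x = 0"
  shows "w \<in> sobolev_space s"
proof -
  obtain e where e: "e > 0" "(\<Union>x\<in>K. ball x e) \<subseteq> W"
    using compact_subset_open_imp_ball_epsilon_subset[OF K(1) W K(2)] by blast
  \<comment> \<open>Strictly below \<open>e\<close>, so that the closed \<delta>-neighbourhood of
    \<open>K\<close> stays in \<open>W\<close>, and at most 1 as
    \<open>sobolev_space_transplant\<close> requires.\<close>
  define \<delta> where "\<delta> = min (e / 2) 1"
  have \<delta>: "0 < \<delta>" "\<delta> \<le> 1" "\<delta> < e" using e by (auto simp: \<delta>_def)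
  define V where "V = (\<Union>x\<in>K. \<Union>y\<in>cball 0 \<delta>. {x + y})"
  have V: "compact V" unfolding V_def by (intro compact_sums' K compact_cball)
  have VI: "y \<in> V" if "x \<in> K" "dist x y < \<delta>" for x y
  proof -
    have "y = x + (y - x)" "y - x \<in> cball 0 \<delta>" using that by (auto simp: dist_norm norm_minus_commute)
    then show ?thesis using that(1) unfolding V_def by blast
  qed
  have VW: "V \<subseteq> W"
  proof
    fix z assume "z \<in> V"
    then obtain x y where "x \<in> K" "norm y \<le> \<delta>" "z = x + y" by (auto simp: V_def)
    then have "z \<in> ball x e" using \<delta>(3) by (simp add: dist_norm)
    then show "z \<in> W" using e(2) \<open>x \<in> K\<close> by blast
  qed
  obtain L1 where L1: "L1-lipschitz_on V \<phi>" using locally_lipschitz_on_compact[OF \<phi>(1) V VW] .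
  have "compact (\<phi> ` V)" by (rule compact_continuous_image[OF lipschitz_on_continuous_on[OF L1] V])
  then obtain L2 where L2: "L2-lipschitz_on (\<phi> ` V) \<theta>"
    using locally_lipschitz_on_compact[OF \<theta>(1), of "\<phi> ` V"] \<phi>(2) VW by blast
  obtain L3 where L3: "L3-lipschitz_on V \<psi>" using locally_lipschitz_on_compact[OF \<psi> V VW] .
  note nn = lipschitz_on_nonneg[OF L1] lipschitz_on_nonneg[OF L2] lipschitz_on_nonneg[OF L3]
  define L where "L = L1 + L2 + L3 + 1"
  have "bounded (\<psi> ` V)"
    by (rule compact_imp_bounded[OF compact_continuous_image[OF lipschitz_on_continuous_on[OF L3] V]])
  then obtain M where M: "\<And>x. x \<in> V \<Longrightarrow> \<bar>\<psi> x\<bar> \<le> M" by (auto simp: bounded_iff)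
  have up: "a * dist x y \<le> L * dist x y" if "a \<le> L" for a and x y :: "real ^ 'm" using that by (intro mult_right_mono) auto
  show ?thesis
  proof (rule sobolev_space_transplant[OF s v K(1) V \<delta>(1,2) VI, where L = L and M = M and \<phi> = \<phi> and \<psi> = \<psi>])
    fix x y assume xy: "x \<in> V" "y \<in> V"
    show "dist (\<phi> x) (\<phi> y) \<le> L * dist x y"
      using lipschitz_onD[OF L1 xy] by (rule order_trans[OF _ up]) (use nn in \<open>simp add: L_def\<close>)
    show "dist (\<psi> x) (\<psi> y) \<le> L * dist x y"
      using lipschitz_onD[OF L3 xy] by (rule order_trans[OF _ up]) (use nn in \<open>simp add: L_def\<close>)
    have "dist (\<theta> (\<phi> x)) (\<theta> (\<phi> y)) \<le> L2 * dist (\<phi> x) (\<phi> y)"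
      using xy by (intro lipschitz_onD[OF L2]) auto
    then have "dist x y \<le> L2 * dist (\<phi> x) (\<phi> y)" using xy VW \<theta>(2) by (metis subsetD)
    then show "dist x y \<le> L * dist (\<phi> x) (\<phi> y)"
      by (rule order_trans[OF _ up]) (use nn in \<open>simp add: L_def\<close>)
  qed (use M nn VW wW wK in \<open>auto simp: L_def\<close>)
qed

section \<open>Charts of an immersed hypersurface\<close>

text \<open>\<open>S\<close> is one component and \<Gamma> the union that carries \<open>ds\<close>.
  A single chart is isolated so that the local analysis can ignore the family.\<close>

locale surface_chart =
  fixes \<Gamma> S D :: "'a::t2_space set" and X :: "'a \<Rightarrow> real ^ 'm::finite" and \<iota> :: "'a \<Rightarrow> real ^ 'n::finite" and ds :: "'a measure"
  assumes compact_S: "compact S" and S_\<Gamma>: "S \<subseteq> \<Gamma>" and \<Gamma>_borel: "\<Gamma> \<in> sets borel"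
    and sets_ds: "sets ds = sets (restrict_space borel \<Gamma>)"
    and chart: "chart_on S (D, X)"
    and smooth_\<iota>: "smooth_map_on (X ` D) (\<iota> \<circ> inv_into D X)"
    and inj_\<iota>: "\<And>u. u \<in> X ` D \<Longrightarrow> inj (frechet_derivative (\<iota> \<circ> inv_into D X) (at u))"
    and emeasure_ds: "\<And>B. B \<in> sets ds \<Longrightarrow> B \<subseteq> D \<Longrightarrow> emeasure ds B =
          (\<integral>\<^sup>+u\<in>X ` B. ennreal (gram_density (\<iota> \<circ> inv_into D X) u) \<partial>lborel)"
begin

abbreviation "Y \<equiv> inv_into D X"

text \<open>Cut off outside the open chart image, where \<open>inv_into\<close> is arbitrary; this
  makes the density Borel on the whole space.\<close>

definition gram :: "real ^ 'm \<Rightarrow> real" where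
  "gram u = indicator (X ` D) u * gram_density (\<iota> \<circ> Y) u"

lemma open_image: "open (X ` D)" and homeo: "homeomorphism D (X ` D) X Y" and openin_D: "openin (top_of_set S) D"
  using chart by (auto simp: chart_on_def)

lemma D_S: "D \<subseteq> S" using openin_D openin_imp_subset by blast

lemma Y_X: "x \<in> D \<Longrightarrow> Y (X x) = x" using homeo by (auto simp: homeomorphism_def)
lemma X_Y: "u \<in> X ` D \<Longrightarrow> X (Y u) = u" using homeo by (auto simp: homeomorphism_def)
lemma Y_D: "u \<in> X ` D \<Longrightarrow> Y u \<in> D" using homeo by (auto simp: homeomorphism_def)
lemma cont_X: "continuous_on D X" and cont_Y: "continuous_on (X ` D) Y"
  using homeo by (auto simp: homeomorphism_def)

lemma S_borel [measurable]: "S \<in> sets borel"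
  using compact_S by (simp add: borel_compact)

lemma D_borel [measurable]: "D \<in> sets borel"
proof -
  obtain T where "open T" "D = S \<inter> T" using openin_D by (auto simp: openin_open)
  then show ?thesis using S_borel by auto
qed

lemma sets_ds_iff: "B \<in> sets ds \<longleftrightarrow> B \<subseteq> \<Gamma> \<and> B \<in> sets borel"
  unfolding sets_ds using \<Gamma>_borel by (subst sets_restrict_space_iff) auto

lemma space_ds: "space ds = \<Gamma>"
  using sets_eq_imp_space_eq[OF sets_ds] by (simp add: space_restrict_space)

lemma D_ds [measurable]: "D \<in> sets ds"
  using D_S S_\<Gamma> by (simp add: sets_ds_iff)

lemma X_measurable: "X \<in> measurable (restrict_space borel D) borel"
  by (rule borel_measurable_continuous_on_restrict[OF cont_X])

lemma sets_restrict_D: "S \<subseteq> T \<Longrightarrow> sets (restrict_space (restrict_space borel T) D) = sets (restrict_space borel D)"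
  using D_S by (subst sets_restrict_restrict_space) (auto intro!: arg_cong[where f = "\<lambda>A. sets (restrict_space borel A)"])

text \<open>On \<open>D\<close> the Borel structures inherited from \<open>S\<close> and from
  \<Gamma> coincide, so one measurability proof on \<open>D\<close> serves the component measures
  and \<open>ds\<close> alike.\<close>

lemma measurable_restrict_D:
  assumes T: "S \<subseteq> T" "sets M = sets (restrict_space borel T)" and f: "f \<in> measurable (restrict_space borel D) N"
  shows "f \<in> measurable (restrict_space M D) N"
proof -
  have "sets (restrict_space M D) = sets (restrict_space borel D)"
    using sets_restrict_D[OF T(1)] sets_restrict_space_cong[OF T(2)] by metis
  then show ?thesis using f measurable_cong_sets[OF _ refl] by blast
qed

lemmas X_measurable' = measurable_restrict_D[OF _ _ X_measurable]

lemma vimage_borel: "B \<in> sets borel \<Longrightarrow> X -` B \<inter> D \<in> sets borel"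
  using measurable_sets[OF X_measurable, of B] D_borel
  by (simp add: sets_restrict_space_iff space_restrict_space)

text \<open>The image is the preimage under the continuous inverse of the chart.\<close>

lemma image_borel:
  assumes "B \<in> sets borel" "B \<subseteq> D" shows "X ` B \<in> sets borel"
proof -
  have "Y \<in> measurable (restrict_space borel (X ` D)) borel"
    by (rule borel_measurable_continuous_on_restrict[OF cont_Y])
  from measurable_sets[OF this assms(1)] have "Y -` B \<inter> X ` D \<in> sets borel"
    using open_image by (simp add: sets_restrict_space_iff space_restrict_space)
  moreover have "Y -` B \<inter> X ` D = X ` B" using assms(2) Y_X by auto
  ultimately show ?thesis by simp
qed

lemma gram_density_lipschitz: "locally_lipschitz_on (X ` D) (gram_density (\<iota> \<circ> Y))"
  by (rule gram_density_locally_lipschitz[OF open_image smooth_\<iota> inj_\<iota>])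

lemma gram_pos: "u \<in> X ` D \<Longrightarrow> 0 < gram u"
  using gram_density_pos[OF open_image smooth_\<iota> _ inj_\<iota>, of u] by (simp add: gram_def)

lemma gram_nonneg: "0 \<le> gram u"
  using gram_pos[of u] by (cases "u \<in> X ` D") (auto simp: gram_def)

lemma gram_lipschitz: "locally_lipschitz_on (X ` D) gram"
  using gram_density_lipschitz by (subst locally_lipschitz_on_cong) (auto simp: gram_def)

lemma gram_measurable [measurable]: "gram \<in> borel_measurable borel"
proof -
  have "(\<lambda>u. indicator (X ` D) u *\<^sub>R gram_density (\<iota> \<circ> Y) u) \<in> borel_measurable borel"
    using open_image
    by (intro borel_measurable_continuous_on_indicator locally_lipschitz_on_continuous[OF gram_density_lipschitz]) auto
  then show ?thesis by (simp add: gram_def[abs_def])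
qed

text \<open>This is the defining condition of the surface measure, evaluated on chart preimages of
  Borel sets.\<close>

lemma distr_ds: "distr (restrict_space ds D) borel X = density lborel (\<lambda>u. ennreal (gram u))"
proof (rule measure_eqI)
  fix B :: "(real ^ 'm) set" assume "B \<in> sets (distr (restrict_space ds D) borel X)"
  then have B[measurable]: "B \<in> sets borel" by simp
  have "emeasure (distr (restrict_space ds D) borel X) B = emeasure ds (X -` B \<inter> D)"
    using D_S S_\<Gamma>
    by (subst emeasure_distr[OF X_measurable'[OF S_\<Gamma> sets_ds] B])
      (auto simp: space_restrict_space space_ds emeasure_restrict_space D_ds Int_absorb1 Int_absorb2 intro!: arg_cong[where f = "emeasure ds"])
  also have "\<dots> = (\<integral>\<^sup>+u\<in>X ` (X -` B \<inter> D). ennreal (gram_density (\<iota> \<circ> Y) u) \<partial>lborel)"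
    using vimage_borel[OF B] D_S S_\<Gamma> by (intro emeasure_ds) (auto simp: sets_ds_iff)
  also have "\<dots> = (\<integral>\<^sup>+u\<in>B. ennreal (gram u) \<partial>lborel)"
    by (intro nn_integral_cong) (auto simp: gram_def split: split_indicator)
  also have "\<dots> = emeasure (density lborel (\<lambda>u. ennreal (gram u))) B"
    by (simp add: emeasure_density)
  finally show "emeasure (distr (restrict_space ds D) borel X) B = \<dots>" .
qed simp

lemma nn_integral_chart:
  assumes [measurable]: "f \<in> borel_measurable borel"
  shows "(\<integral>\<^sup>+x\<in>D. f (X x) \<partial>ds) = (\<integral>\<^sup>+u. ennreal (gram u) * f u \<partial>lborel)"
proof -
  have "(\<integral>\<^sup>+x\<in>D. f (X x) \<partial>ds) = (\<integral>\<^sup>+x. f (X x) \<partial>restrict_space ds D)"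
    by (rule nn_integral_restrict_space[symmetric]) (rule sets.Int[OF D_ds sets.top])
  also have "\<dots> = (\<integral>\<^sup>+u. f u \<partial>distr (restrict_space ds D) borel X)"
    by (rule nn_integral_distr[OF X_measurable'[OF S_\<Gamma> sets_ds], symmetric]) simp
  also have "\<dots> = (\<integral>\<^sup>+u. ennreal (gram u) * f u \<partial>lborel)"
    unfolding distr_ds by (rule nn_integral_density) measurable
  finally show ?thesis .
qed

end

lemma chart_image_open:
  assumes c: "chart_on S (D, X)" and U: "openin (top_of_set S) U" "U \<subseteq> D"
  shows "open (X ` U)"
proof -
  have h: "homeomorphism D (X ` D) X (inv_into D X)" and op: "open (X ` D)" and DS: "D \<subseteq> S"
    using c by (auto simp: chart_on_def dest: openin_imp_subset)
  obtain T where T: "open T" "U = S \<inter> T" using U(1) by (auto simp: openin_open)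
  have "X ` U = X ` D \<inter> inv_into D X -` T"
    using h U(2) DS T(2) by (auto simp: homeomorphism_def)
  moreover have "open (X ` D \<inter> inv_into D X -` T)"
    by (rule continuous_open_preimage[OF _ op T(1)]) (use h in \<open>simp add: homeomorphism_def\<close>)
  ultimately show ?thesis by simp
qed

lemma compact_closure_subset:
  assumes "compact (S::'a::t2_space set)" shows "compact (closure {x\<in>S. P x})" and "closure {x\<in>S. P x} \<subseteq> S"
proof -
  show sub: "closure {x\<in>S. P x} \<subseteq> S" by (rule closure_minimal) (use assms compact_imp_closed in auto)
  then have "closure {x\<in>S. P x} = S \<inter> closure {x\<in>S. P x}" by auto
  then show "compact (closure {x\<in>S. P x})" using compact_Int_closed[OF assms closed_closure] by metis
qed

section \<open>One chart with one function of the partition of unity\<close>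

locale cutoff_chart = surface_chart \<Gamma> S D X \<iota> ds
  for \<Gamma> S D :: "'a::t2_space set" and X :: "'a \<Rightarrow> real ^ 'm::finite" and \<iota> :: "'a \<Rightarrow> real ^ 'n::finite" and ds :: "'a measure" +
  fixes b :: "'a \<Rightarrow> real"
  assumes b_nonneg: "\<And>x. x \<in> S \<Longrightarrow> 0 \<le> b x" and b_le: "\<And>x. x \<in> S \<Longrightarrow> b x \<le> 1"
    and b_smooth: "smooth_map_on (X ` D) (b \<circ> Y)"
    and b_support: "closure {x\<in>S. b x \<noteq> 0} \<subseteq> D"
begin

text \<open>Localized measures and densities live on this set. It is compact because the support of
  \<open>b\<close> is a closed subset of the compact \<open>S\<close> and lies in the chart
  domain.\<close>

definition K :: "(real ^ 'm) set" where
  "K = X ` closure {x\<in>S. b x \<noteq> 0}"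

lemma compact_K: "compact K" and K_image: "K \<subseteq> X ` D"
proof -
  show "compact K" unfolding K_def
    by (rule compact_continuous_image[OF continuous_on_subset[OF cont_X b_support] compact_closure_subset(1)[OF compact_S]])
  show "K \<subseteq> X ` D" unfolding K_def using b_support by auto
qed

lemma b_eq_0: "x \<in> S \<Longrightarrow> x \<notin> D \<Longrightarrow> b x = 0"
  using b_support closure_subset[of "{x\<in>S. b x \<noteq> 0}"] by auto

lemma b_eq_0': "x \<in> D \<Longrightarrow> X x \<notin> K \<Longrightarrow> b x = 0"
  using D_S closure_subset[of "{x\<in>S. b x \<noteq> 0}"] unfolding K_def by auto

lemma cont_b: "continuous_on D b"
proof -
  have "continuous_on (X ` D) (b \<circ> Y)"
    by (rule locally_lipschitz_on_continuous[OF smooth_map_on_locally_lipschitz[OF open_image b_smooth] open_image])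
  then have "continuous_on D ((b \<circ> Y) \<circ> X)" by (rule continuous_on_compose[OF cont_X])
  then show ?thesis by (rule continuous_on_eq) (simp add: Y_X)
qed

lemma b_measurable: "b \<in> borel_measurable (restrict_space borel D)"
  by (rule borel_measurable_continuous_on_restrict[OF cont_b])

text \<open>\<open>b\<close> is known to be measurable on \<open>D\<close> only; the indicator of a
  subset of \<open>D\<close> extends it by zero. The set \<open>T\<close> will be \<open>S\<close>
  for a component measure and \<Gamma> for \<open>ds\<close>.\<close>

lemma b_measurable_indicator:
  assumes T: "S \<subseteq> T" "T \<in> sets borel" and M: "sets M = sets (restrict_space borel T)" and B: "B \<in> sets borel" "B \<subseteq> D"
  shows "(\<lambda>x. ennreal (b x) * indicator B x) \<in> borel_measurable M"
proof -
  have sM: "C \<in> sets M" if "C \<in> sets borel" "C \<subseteq> D" for C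
    unfolding M using that T D_S by (subst sets_restrict_space_iff) auto
  have "b \<in> borel_measurable (restrict_space M D)"
    by (rule measurable_restrict_D[OF T(1) M b_measurable])
  then have "(\<lambda>x. ennreal (b x)) \<in> borel_measurable (restrict_space M D)" by measurable
  then have "(\<lambda>x. ennreal (b x) * indicator D x) \<in> borel_measurable M"
    by (subst (asm) borel_measurable_restrict_space_iff_ennreal) (rule sets.Int[OF sM[OF D_borel subset_refl] sets.top])
  then have "(\<lambda>x. (ennreal (b x) * indicator D x) * indicator B x) \<in> borel_measurable M"
    by (rule borel_measurable_times_ennreal) (rule borel_measurable_indicator[OF sM[OF B]])
  then show ?thesis
    by (rule measurable_cong[THEN iffD1, rotated]) (use B(2) in \<open>auto split: split_indicator\<close>)
qed

context
  fixes \<mu> :: "'a measure"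
  assumes fin_\<mu>: "finite_measure \<mu>" and sets_\<mu>: "sets \<mu> = sets (restrict_space borel S)"
begin

abbreviation "N \<equiv> localized_measure \<mu> D X b"

lemma sets_N: "sets N = sets borel"
  by (simp add: localized_measure_def)

lemma space_\<mu>: "space \<mu> = S"
  using sets_eq_imp_space_eq[OF sets_\<mu>] by (simp add: space_restrict_space)

lemma sets_\<mu>_iff: "B \<in> sets \<mu> \<longleftrightarrow> B \<subseteq> S \<and> B \<in> sets borel"
  unfolding sets_\<mu> by (subst sets_restrict_space_iff) auto

lemma emeasure_N:
  assumes B: "B \<in> sets borel"
  shows "emeasure N B = (\<integral>\<^sup>+x\<in>X -` B \<inter> D. ennreal (b x) \<partial>\<mu>)"
proof -
  have Xm: "X \<in> measurable (restrict_space \<mu> D) borel" and bm: "b \<in> borel_measurable (restrict_space \<mu> D)"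
    by (rule measurable_restrict_D[OF subset_refl sets_\<mu>] X_measurable b_measurable)+
  have D\<mu>: "D \<in> sets \<mu>" using D_S by (simp add: sets_\<mu>_iff)
  have sp: "space (restrict_space \<mu> D) = D" using D_S by (auto simp: space_restrict_space space_\<mu>)
  have vm: "X -` B \<inter> D \<in> sets (restrict_space \<mu> D)" using measurable_sets[OF Xm B] by (simp add: sp)
  have "emeasure N B = emeasure (density (restrict_space \<mu> D) (\<lambda>x. ennreal (b x))) (X -` B \<inter> D)"
    unfolding localized_measure_def using Xm B by (subst emeasure_distr) (auto simp: sp)
  also have "\<dots> = (\<integral>\<^sup>+x. ennreal (b x) * indicator (X -` B \<inter> D) x \<partial>restrict_space \<mu> D)"
    using bm vm by (intro emeasure_density) measurable
  also have "\<dots> = (\<integral>\<^sup>+x. ennreal (b x) * indicator (X -` B \<inter> D) x * indicator D x \<partial>\<mu>)"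
    by (rule nn_integral_restrict_space) (rule sets.Int[OF D\<mu> sets.top])
  also have "\<dots> = (\<integral>\<^sup>+x\<in>X -` B \<inter> D. ennreal (b x) \<partial>\<mu>)"
    by (intro nn_integral_cong) (auto split: split_indicator)
  finally show ?thesis .
qed

lemma finite_N: "finite_measure N"
proof (rule finite_measureI)
  interpret finite_measure \<mu> by (rule fin_\<mu>)
  have "emeasure N (space N) = (\<integral>\<^sup>+x\<in>D. ennreal (b x) \<partial>\<mu>)"
    using emeasure_N[of UNIV] by (simp add: localized_measure_def)
  also have "\<dots> \<le> (\<integral>\<^sup>+x. 1 \<partial>\<mu>)"
    using b_le D_S by (intro nn_integral_mono) (auto split: split_indicator)
  also have "\<dots> < \<infinity>" by (simp add: less_top[symmetric])
  finally show "emeasure N (space N) \<noteq> \<infinity>" by simp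
qed

lemma emeasure_N_outside_K: "emeasure N (- K) = 0"
proof -
  have "- K \<in> sets borel" using compact_K by (intro borel_comp borel_compact)
  then have "emeasure N (- K) = (\<integral>\<^sup>+x\<in>X -` (- K) \<inter> D. ennreal (b x) \<partial>\<mu>)" by (rule emeasure_N)
  also have "\<dots> = (\<integral>\<^sup>+x. 0 \<partial>\<mu>)"
    using b_eq_0' by (intro nn_integral_cong) (auto split: split_indicator)
  finally show ?thesis by simp
qed

text \<open>The localized measure has a Sobolev density with respect to Lebesgue measure in the
  chart; dividing by \<open>gram\<close> converts it into a density with respect to
  \<open>ds\<close>.\<close>

lemma finite_energy_imp_local_density:
  assumes \<beta>: "0 < \<beta>" "\<beta> < 2"
    and en: "energy \<beta> N < \<infinity>"
  obtains v where "v \<in> sobolev_space (\<beta> / 2)" "\<And>u. 0 \<le> v u" "\<And>u. u \<notin> K \<Longrightarrow> v u = 0"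
    "\<And>B. B \<in> sets borel \<Longrightarrow> B \<subseteq> D \<Longrightarrow>
      (\<integral>\<^sup>+x\<in>B. ennreal (b x) \<partial>\<mu>) = (\<integral>\<^sup>+x\<in>B. ennreal (v (X x) / gram (X x)) \<partial>ds)"
proof -
  obtain v' where v'[measurable]: "v' \<in> borel_measurable borel" and v'0: "\<And>x. 0 \<le> v' x"
    and Nv': "N = density lborel (\<lambda>x. ennreal (v' x))"
    and v'2: "(\<integral>\<^sup>+x. ennreal ((v' x)\<^sup>2) \<partial>lborel) < \<infinity>"
    and v'G: "gagliardo (DIM(real ^ 'm) + \<beta>) v' < \<infinity>"
    using finite_energy_imp_sobolev_density[OF finite_N sets_N \<beta> en] by blast
  have v's: "v' \<in> sobolev_space (\<beta> / 2)" using v' v'2 v'G by (simp add: sobolev_space_def)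
  have Kb[measurable]: "K \<in> sets borel" using compact_K by (rule borel_compact)
  \<comment> \<open>The density is changed on a null set so as to vanish everywhere off
    \<open>K\<close>; the passage to other charts relies on this compact support.\<close>
  define v where "v u = indicator K u * v' u" for u
  have [measurable]: "v \<in> borel_measurable borel" unfolding v_def by measurable
  have "(\<integral>\<^sup>+u. ennreal (v' u) * indicator (- K) u \<partial>lborel) = 0"
    using emeasure_N_outside_K unfolding Nv' by (subst (asm) emeasure_density) auto
  then have "AE u in lborel. ennreal (v' u) * indicator (- K) u = 0"
    by (subst (asm) nn_integral_0_iff_AE) auto
  then have ae: "AE u in lborel. v' u = v u"
  proof eventually_elim
    case (elim u)
    then show ?case using v'0[of u] by (cases "u \<in> K") (auto simp: v_def ennreal_eq_0_iff)
  qed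
  show thesis
  proof (rule that)
    show "v \<in> sobolev_space (\<beta> / 2)" by (rule sobolev_space_cong_AE[OF v's _ ae]) measurable
    show "0 \<le> v u" for u by (simp add: v_def v'0)
    show "v u = 0" if "u \<notin> K" for u using that by (simp add: v_def)
    fix B assume B: "B \<in> sets borel" "B \<subseteq> D"
    have XB[measurable]: "X ` B \<in> sets borel" by (rule image_borel[OF B])
    have eq: "X -` (X ` B) \<inter> D = B" using B(2) Y_X by (auto) (metis subsetD)
    have "(\<integral>\<^sup>+x\<in>B. ennreal (b x) \<partial>\<mu>) = emeasure N (X ` B)"
      unfolding emeasure_N[OF XB] eq ..
    also have "\<dots> = (\<integral>\<^sup>+u. ennreal (v' u) * indicator (X ` B) u \<partial>lborel)"
      unfolding Nv' by (rule emeasure_density) measurable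
    also have "\<dots> = (\<integral>\<^sup>+u. ennreal (gram u) * (ennreal (v u / gram u) * indicator (X ` B) u) \<partial>lborel)"
    proof (rule nn_integral_cong_AE, use ae in eventually_elim)
      case (elim u)
      show ?case
      proof (cases "u \<in> X ` B")
        case True
        then have "gram u > 0" using B(2) by (intro gram_pos) auto
        then have "ennreal (gram u) * ennreal (v u / gram u) = ennreal (v u)"
          by (subst ennreal_mult'[symmetric]) auto
        then show ?thesis using elim True by simp
      qed simp
    qed
    also have "\<dots> = (\<integral>\<^sup>+x\<in>D. ennreal (v (X x) / gram (X x)) * indicator (X ` B) (X x) \<partial>ds)"
      by (rule nn_integral_chart[symmetric]) measurable
    also have "\<dots> = (\<integral>\<^sup>+x\<in>B. ennreal (v (X x) / gram (X x)) \<partial>ds)"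
      using eq B(2) by (intro nn_integral_cong) (auto split: split_indicator)
    finally show "(\<integral>\<^sup>+x\<in>B. ennreal (b x) \<partial>\<mu>) = (\<integral>\<^sup>+x\<in>B. ennreal (v (X x) / gram (X x)) \<partial>ds)" .
  qed
qed

text \<open>In the chart the localized measure has as density \<open>gram\<close> times the given
  Sobolev function, and the locally Lipschitz factor \<open>gram\<close> preserves the Sobolev
  space.\<close>

lemma local_density_imp_finite_energy:
  fixes t :: "'a \<Rightarrow> real"
  assumes \<beta>: "0 < \<beta>" "\<beta> < 2"
    and t: "t \<in> borel_measurable ds" and t0: "AE x in ds. x \<in> S \<longrightarrow> 0 \<le> t x"
    and \<mu>t: "\<And>B. B \<in> sets borel \<Longrightarrow> B \<subseteq> S \<Longrightarrow> emeasure \<mu> B = (\<integral>\<^sup>+x\<in>B. ennreal (t x) \<partial>ds)"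
    and sob: "(\<lambda>u. if u \<in> X ` D then b (Y u) * t (Y u) else 0) \<in> sobolev_space (\<beta> / 2)"
  shows "energy \<beta> N < \<infinity>"
proof -
  define v where "v u = (if u \<in> X ` D then b (Y u) * t (Y u) else 0)" for u
  have vs: "v \<in> sobolev_space (\<beta> / 2)" using sob by (simp add: v_def[abs_def])
  then have [measurable]: "v \<in> borel_measurable borel" by (simp add: sobolev_space_def)
  have vX: "v (X x) = b x * t x" if "x \<in> D" for x using that by (simp add: v_def Y_X)
  define w where "w u = gram u * v u" for u
  have [measurable]: "w \<in> borel_measurable borel" unfolding w_def by measurable
  have ws: "w \<in> sobolev_space (\<beta> / 2)"
  \<comment> \<open>A pure multiplication: \<phi> and \<theta> are the identity and \<psi> is
    \<open>gram\<close>.\<close>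
  proof (rule sobolev_space_locally_lipschitz[OF _ _ vs open_image compact_K K_image])
    show "locally_lipschitz_on (X ` D) (\<lambda>u. u)" "locally_lipschitz_on (X ` D) (\<lambda>u. u)"
      unfolding locally_lipschitz_on_def by (auto intro!: exI[of _ 1] lipschitz_on_id)
    show "w u = 0" if "u \<notin> K" for u
      using that b_eq_0'[of "Y u"] X_Y[of u] Y_D[of u] by (auto simp: w_def v_def)
  qed (use \<beta> in \<open>auto simp: w_def gram_lipschitz\<close>)
  have S_ds: "S \<in> sets ds" using S_\<Gamma> by (simp add: sets_ds_iff)
  have Nw: "N = density lborel (\<lambda>u. ennreal (w u))"
  proof (rule measure_eqI)
    fix B assume "B \<in> sets N"
    then have B[measurable]: "B \<in> sets borel" by (simp add: sets_N)
    let ?C = "X -` B \<inter> D"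
    have C: "?C \<in> sets borel" "?C \<subseteq> D" using vimage_borel[OF B] by auto
    have \<mu>_eq: "\<mu> = restrict_space (density ds (\<lambda>x. ennreal (t x))) S"
    proof (rule measure_eqI)
      show "sets \<mu> = sets (restrict_space (density ds (\<lambda>x. ennreal (t x))) S)"
        unfolding sets_\<mu> sets_restrict_space sets_density sets_ds image_image
        using S_\<Gamma> by (auto intro!: arg_cong2[where f = image])
      fix B assume "B \<in> sets \<mu>"
      then have B: "B \<subseteq> S" "B \<in> sets borel" by (auto simp: sets_\<mu>_iff)
      have "emeasure (restrict_space (density ds (\<lambda>x. ennreal (t x))) S) B = emeasure (density ds (\<lambda>x. ennreal (t x))) B"
        using B S_ds by (subst emeasure_restrict_space) (auto simp: sets.Int_space_eq2)
      also have "\<dots> = (\<integral>\<^sup>+x\<in>B. ennreal (t x) \<partial>ds)"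
        using B S_\<Gamma> t by (intro emeasure_density) (auto simp: sets_ds_iff)
      finally show "emeasure \<mu> B = emeasure (restrict_space (density ds (\<lambda>x. ennreal (t x))) S) B"
        using \<mu>t[OF B(2,1)] by simp
    qed
    have bC: "(\<lambda>x. ennreal (b x) * indicator ?C x) \<in> borel_measurable ds"
      by (rule b_measurable_indicator[OF S_\<Gamma> \<Gamma>_borel sets_ds C])
    have "emeasure N B = (\<integral>\<^sup>+x. ennreal (b x) * indicator ?C x \<partial>\<mu>)" by (rule emeasure_N[OF B])
    also have "\<dots> = (\<integral>\<^sup>+x. ennreal (b x) * indicator ?C x * indicator S x \<partial>density ds (\<lambda>x. ennreal (t x)))"
      by (subst \<mu>_eq, rule nn_integral_restrict_space) (use S_ds in \<open>simp add: sets.Int_space_eq2\<close>)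
    also have "\<dots> = (\<integral>\<^sup>+x. ennreal (b x) * indicator ?C x \<partial>density ds (\<lambda>x. ennreal (t x)))"
      using D_S by (intro nn_integral_cong) (auto split: split_indicator)
    also have "\<dots> = (\<integral>\<^sup>+x. ennreal (t x) * (ennreal (b x) * indicator ?C x) \<partial>ds)"
      using t bC by (intro nn_integral_density) auto
    also have "\<dots> = (\<integral>\<^sup>+x\<in>D. ennreal (v (X x)) * indicator B (X x) \<partial>ds)"
    proof (rule nn_integral_cong)
      fix x
      show "ennreal (t x) * (ennreal (b x) * indicator ?C x) = ennreal (v (X x)) * indicator B (X x) * indicator D x"
        using b_nonneg[of x] D_S by (cases "x \<in> D") (auto simp: vX ennreal_mult' mult_ac split: split_indicator)
    qed
    also have "\<dots> = (\<integral>\<^sup>+u. ennreal (gram u) * (ennreal (v u) * indicator B u) \<partial>lborel)"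
      by (rule nn_integral_chart) measurable
    also have "\<dots> = (\<integral>\<^sup>+u. ennreal (w u) * indicator B u \<partial>lborel)"
      by (simp only: w_def ennreal_mult'[OF gram_nonneg] mult.assoc)
    also have "\<dots> = emeasure (density lborel (\<lambda>u. ennreal (w u))) B"
      by (rule emeasure_density[symmetric]) measurable
    finally show "emeasure N B = \<dots>" .
  qed (simp add: sets_N)
  \<comment> \<open>The sign of \<open>t\<close> is known only almost everywhere for
    \<open>ds\<close>; \<open>distr_ds\<close> carries this to Lebesgue measure where
    \<open>gram\<close> is positive, and \<open>w\<close> vanishes where \<open>gram\<close>
    does.\<close>
  have w0: "AE u in lborel. 0 \<le> w u"
  proof -
    have "AE x in restrict_space ds D. 0 \<le> v (X x)"
      unfolding AE_restrict_space_iff[OF sets.Int[OF D_ds sets.top]]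
      using t0
    proof eventually_elim
      case (elim x)
      then show ?case using D_S b_nonneg[of x] vX[of x] by auto
    qed
    then have "AE u in distr (restrict_space ds D) borel X. 0 \<le> v u"
      by (subst AE_distr_iff[OF X_measurable'[OF S_\<Gamma> sets_ds]]) auto
    then have "AE u in lborel. 0 < ennreal (gram u) \<longrightarrow> 0 \<le> v u"
      unfolding distr_ds by (subst (asm) AE_density) auto
    then show ?thesis
    proof eventually_elim
      case (elim u)
      then show ?case using gram_nonneg[of u] by (cases "gram u = 0") (auto simp: w_def)
    qed
  qed
  have wi: "integrable lborel w"
  proof (rule integrableI_nonneg[OF _ w0])
    have "(\<integral>\<^sup>+u. ennreal (w u) \<partial>lborel) = emeasure N UNIV"
      unfolding Nw by (subst emeasure_density) auto
    also have "\<dots> < \<infinity>"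
      using finite_measure.emeasure_finite[OF finite_N, of UNIV] by (simp add: less_top)
    finally show "(\<integral>\<^sup>+u. ennreal (w u) \<partial>lborel) < \<infinity>" .
  qed simp
  have "gagliardo (DIM(real ^ 'm) + \<beta>) w < \<infinity>"
    using ws by (simp add: sobolev_space_def)
  from sobolev_density_imp_finite_energy[OF wi w0 \<beta> this] show ?thesis by (simp only: Nw)
qed

end

text \<open>A locally bi-Lipschitz transplant from the chart \<open>(D, X)\<close> to
  \<open>(E, Z)\<close>, with the transition map as \<phi> and \<zeta> divided by
  \<open>gram\<close> as \<psi>. It lets a density found in the fixed atlas pass the test of
  \<open>sobolev_space_on\<close> in every chart.\<close>

lemma sobolev_space_transition:
  assumes s: "0 < s" "s < 1" and v: "v \<in> sobolev_space s" and vK: "\<And>u. u \<notin> K \<Longrightarrow> v u = 0"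
    and c: "chart_on S (E, Z)" and comp: "compatible_charts (E, Z) (D, X)"
    and \<zeta>: "smooth_map_on (Z ` E) (\<zeta> \<circ> inv_into E Z)" "closure {x\<in>S. \<zeta> x \<noteq> 0} \<subseteq> E"
  shows "(\<lambda>u. if u \<in> Z ` E then \<zeta> (inv_into E Z u) *
      (if inv_into E Z u \<in> D then v (X (inv_into E Z u)) / gram (X (inv_into E Z u)) else 0) else 0) \<in> sobolev_space s"
proof -
  let ?Z = "inv_into E Z"
  define w where "w = (\<lambda>u. if u \<in> Z ` E then \<zeta> (?Z u) *
      (if ?Z u \<in> D then v (X (?Z u)) / gram (X (?Z u)) else 0) else 0)"
  have hZ: "homeomorphism E (Z ` E) Z ?Z" and oE: "openin (top_of_set S) E" and oZ: "open (Z ` E)"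
    using c by (auto simp: chart_on_def)
  have ZZ: "?Z (Z x) = x" if "x \<in> E" for x using hZ that by (auto simp: homeomorphism_def)
  have ES: "E \<subseteq> S" using oE openin_imp_subset by blast
  let ?W = "Z ` (E \<inter> D)" and ?W' = "X ` (E \<inter> D)"
  have oW: "open ?W" by (rule chart_image_open[OF c]) (use oE openin_D in auto)
  have oW': "open ?W'" by (rule chart_image_open[OF chart]) (use oE openin_D in auto)
  have tr: "smooth_map_on ?W (X \<circ> ?Z)" "smooth_map_on ?W' (Z \<circ> Y)"
    using comp by (auto simp: compatible_charts_def)
  \<comment> \<open>Off the image of this compact set the new function vanishes, and the set lies in
    the overlap \<open>E \<inter> D\<close>, where the transition map is defined.\<close>
  let ?C = "closure {x\<in>S. \<zeta> x \<noteq> 0} \<inter> closure {x\<in>S. b x \<noteq> 0}"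
  have CE: "?C \<subseteq> E \<inter> D" using \<zeta>(2) b_support by auto
  have "continuous_on ?C Z"
    using hZ CE by (auto simp: homeomorphism_def intro: continuous_on_subset)
  then have cK: "compact (Z ` ?C)"
    by (rule compact_continuous_image) (intro compact_Int_closed compact_closure_subset compact_S closed_closure)
  have "w \<in> sobolev_space s"
  proof (rule sobolev_space_locally_lipschitz[OF s v oW cK image_mono[OF CE]])
    show \<phi>: "locally_lipschitz_on ?W (X \<circ> ?Z)" by (rule smooth_map_on_locally_lipschitz[OF oW tr(1)])
    show \<phi>W: "(X \<circ> ?Z) ` ?W \<subseteq> ?W'" using ZZ by auto
    show "locally_lipschitz_on ?W' (Z \<circ> Y)" by (rule smooth_map_on_locally_lipschitz[OF oW' tr(2)])
    show "(Z \<circ> Y) ((X \<circ> ?Z) u) = u" if "u \<in> ?W" for u using that ZZ Y_X by auto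
    have 1: "locally_lipschitz_on ?W (\<zeta> \<circ> ?Z)"
      by (rule locally_lipschitz_on_subset[OF smooth_map_on_locally_lipschitz[OF oZ \<zeta>(1)]]) auto
    have 2: "locally_lipschitz_on ?W (\<lambda>u. gram ((X \<circ> ?Z) u))"
      by (rule locally_lipschitz_on_compose[OF \<phi> gram_lipschitz]) (use \<phi>W in auto)
    have 3: "locally_lipschitz_on ?W (\<lambda>u. inverse (gram ((X \<circ> ?Z) u)))"
      by (rule locally_lipschitz_on_compose[OF 2 locally_lipschitz_on_inverse])
        (use ZZ gram_pos in auto)
    show "locally_lipschitz_on ?W (\<lambda>u. (\<zeta> \<circ> ?Z) u * inverse (gram ((X \<circ> ?Z) u)))"
      by (rule locally_lipschitz_on_mult[OF 1 3])
    show "w u = (\<zeta> \<circ> ?Z) u * inverse (gram ((X \<circ> ?Z) u)) * v ((X \<circ> ?Z) u)" if "u \<in> ?W" for u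
      using that ZZ by (auto simp: w_def divide_inverse)
    show "w u = 0" if u: "u \<notin> Z ` ?C" for u
    proof (cases "u \<in> Z ` E \<and> ?Z u \<in> D")
      case True
      then obtain x where x: "x \<in> E" "u = Z x" "x \<in> D" using ZZ by auto
      then have "x \<notin> ?C" using u by auto
      then consider "x \<notin> closure {x\<in>S. \<zeta> x \<noteq> 0}" | "x \<notin> closure {x\<in>S. b x \<noteq> 0}" by blast
      then show ?thesis
      proof cases
        case 1
        then have "\<zeta> x = 0" using closure_subset[of "{x\<in>S. \<zeta> x \<noteq> 0}"] x(1) ES by auto
        then show ?thesis using x ZZ by (simp add: w_def)
      next
        case 2
        have "X x \<notin> K"
        proof
          assume "X x \<in> K"
          then obtain y where y: "y \<in> closure {x\<in>S. b x \<noteq> 0}" "X x = X y" by (auto simp: K_def)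
          have yD: "y \<in> D" using b_support y(1) by (rule subsetD)
          have "x = Y (X x)" by (rule Y_X[OF x(3), symmetric])
          also have "\<dots> = Y (X y)" by (simp only: y(2))
          also have "\<dots> = y" by (rule Y_X[OF yD])
          finally show False using 2 y(1) by simp
        qed
        then show ?thesis using x ZZ vK by (simp add: w_def)
      qed
    qed (auto simp: w_def)
  qed
  then show ?thesis by (simp add: w_def)
qed

end

section \<open>Energy and Sobolev cones\<close>

locale surface_family =
  fixes I :: "'l set"
    and \<Gamma> :: "'l \<Rightarrow> 'a::t2_space set"
    and A :: "'l \<Rightarrow> ('a, 'm::finite) chart set"
    and \<iota> :: "'a \<Rightarrow> real ^ 'n::finite"
    and ds :: "'a measure"
    and sg :: "'l \<Rightarrow> real"
    and R :: "'l \<Rightarrow> 'r set"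
    and D :: "'l \<Rightarrow> 'r \<Rightarrow> 'a set"
    and X :: "'l \<Rightarrow> 'r \<Rightarrow> 'a \<Rightarrow> real ^ 'm"
    and b :: "'l \<Rightarrow> 'r \<Rightarrow> 'a \<Rightarrow> real"
  assumes finite_I: "finite I"
    and manifold: "\<And>l. l \<in> I \<Longrightarrow> closed_immersed_manifold (\<Gamma> l) (A l) \<iota>"
    and disjoint_images: "disjoint_family_on (\<lambda>l. \<iota> ` \<Gamma> l) I"
    and surface: "surface_measure I \<Gamma> A \<iota> ds"
    and sign: "\<And>l. l \<in> I \<Longrightarrow> sg l \<in> {-1, 1}"
    and atlas: "\<And>l. l \<in> I \<Longrightarrow> finite_atlas (\<Gamma> l) (A l) (R l) (D l) (X l)"
    and partition: "\<And>l. l \<in> I \<Longrightarrow> subordinate_partition_of_unity (\<Gamma> l) (A l) (R l) (D l) (b l)"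
begin

abbreviation "\<Gamma>all \<equiv> (\<Union>l\<in>I. \<Gamma> l)"

text \<open>Disjointness is assumed for the images in the ambient space; a common point of two
  components would have a common image.\<close>

lemma disjoint: "l \<in> I \<Longrightarrow> k \<in> I \<Longrightarrow> l \<noteq> k \<Longrightarrow> \<Gamma> l \<inter> \<Gamma> k = {}"
  using disjoint_images unfolding disjoint_family_on_def by blast

lemma sign_square: "l \<in> I \<Longrightarrow> sg l * sg l = 1"
  using sign[of l] by auto

lemma compact_\<Gamma>: "l \<in> I \<Longrightarrow> compact (\<Gamma> l)"
  using manifold by (auto simp: closed_immersed_manifold_def)

lemma component_borel: "l \<in> I \<Longrightarrow> \<Gamma> l \<in> sets borel"
  using compact_\<Gamma> by (simp add: borel_compact)

lemma \<Gamma>all_borel: "\<Gamma>all \<in> sets borel"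
  using finite_I component_borel by (intro sets.finite_UN) auto

lemma sets_ds: "sets ds = sets (restrict_space borel \<Gamma>all)"
  using surface by (simp add: surface_measure_def)

lemma sets_ds_iff: "B \<in> sets ds \<longleftrightarrow> B \<subseteq> \<Gamma>all \<and> B \<in> sets borel"
  unfolding sets_ds using \<Gamma>all_borel by (subst sets_restrict_space_iff) auto

lemma sets_\<Gamma>_iff: "l \<in> I \<Longrightarrow> B \<in> sets (restrict_space borel (\<Gamma> l)) \<longleftrightarrow> B \<subseteq> \<Gamma> l \<and> B \<in> sets borel"
  using component_borel by (subst sets_restrict_space_iff) auto

lemma finite_R: "l \<in> I \<Longrightarrow> finite (R l)"
  using atlas by (simp add: finite_atlas_def)

lemma chart_A: "l \<in> I \<Longrightarrow> r \<in> R l \<Longrightarrow> (D l r, X l r) \<in> A l"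
  using atlas by (simp add: finite_atlas_def)

lemma partition_sum: "l \<in> I \<Longrightarrow> x \<in> \<Gamma> l \<Longrightarrow> (\<Sum>r\<in>R l. b l r x) = 1"
  using partition by (simp add: subordinate_partition_of_unity_def)

lemma smooth_structure_A: "l \<in> I \<Longrightarrow> smooth_structure (\<Gamma> l) (A l)"
  using manifold by (simp add: closed_immersed_manifold_def)

lemma cutoff_chart:
  assumes l: "l \<in> I" and r: "r \<in> R l"
  shows "cutoff_chart \<Gamma>all (\<Gamma> l) (D l r) (X l r) \<iota> ds (b l r)"
proof unfold_locales
  note A = chart_A[OF l r]
  have pou: "smooth_function (A l) (b l r)" "\<And>r x. r \<in> R l \<Longrightarrow> x \<in> \<Gamma> l \<Longrightarrow> 0 \<le> b l r x"
    "closure {x\<in>\<Gamma> l. b l r x \<noteq> 0} \<subseteq> D l r"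
    using partition[OF l] r by (auto simp: subordinate_partition_of_unity_def)
  have imm: "smooth_immersion (A l) \<iota>" using manifold[OF l] by (simp add: closed_immersed_manifold_def)
  show "compact (\<Gamma> l)" by (rule compact_\<Gamma>[OF l])
  show "\<Gamma> l \<subseteq> \<Gamma>all" using l by auto
  show "\<Gamma>all \<in> sets borel" by (rule \<Gamma>all_borel)
  show "sets ds = sets (restrict_space borel \<Gamma>all)" by (rule sets_ds)
  show "chart_on (\<Gamma> l) (D l r, X l r)" using smooth_structure_A[OF l] A by (simp add: smooth_structure_def)
  show "smooth_map_on (X l r ` D l r) (\<iota> \<circ> inv_into (D l r) (X l r))"
    "\<And>u. u \<in> X l r ` D l r \<Longrightarrow> inj (frechet_derivative (\<iota> \<circ> inv_into (D l r) (X l r)) (at u))"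
    using imm A unfolding smooth_immersion_def by fast+
  show "emeasure ds B = (\<integral>\<^sup>+u\<in>X l r ` B. ennreal (gram_density (\<iota> \<circ> inv_into (D l r) (X l r)) u) \<partial>lborel)"
    if "B \<in> sets ds" "B \<subseteq> D l r" for B
    using surface l A that unfolding surface_measure_def by fast
  show "0 \<le> b l r x" if "x \<in> \<Gamma> l" for x using pou(2) r that by auto
  \<comment> \<open>One term of a sum of nonnegative terms with value 1.\<close>
  show "b l r x \<le> 1" if "x \<in> \<Gamma> l" for x
    using member_le_sum[OF r, of "\<lambda>r. b l r x"] pou(2) that finite_R[OF l] partition_sum[OF l that] by auto
  show "smooth_map_on (X l r ` D l r) (b l r \<circ> inv_into (D l r) (X l r))"
    using pou(1) A unfolding smooth_function_def by fast
  show "closure {x\<in>\<Gamma> l. b l r x \<noteq> 0} \<subseteq> D l r" by (rule pou(3))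
qed

section \<open>A fixed measure of the cone and its components\<close>

context
  fixes \<mu> :: "'l \<Rightarrow> 'a measure" and \<Sigma> :: "'a set \<Rightarrow> real"
  assumes \<mu>: "\<And>l. l \<in> I \<Longrightarrow> finite_measure (\<mu> l)" "\<And>l. l \<in> I \<Longrightarrow> sets (\<mu> l) = sets (restrict_space borel (\<Gamma> l))"
    and \<Sigma>: "\<Sigma> = (\<lambda>B. if B \<in> sets (restrict_space borel \<Gamma>all)
               then \<Sum>l\<in>I. sg l * measure (\<mu> l) (B \<inter> \<Gamma> l) else 0)"
begin

lemma space_\<mu>: "l \<in> I \<Longrightarrow> space (\<mu> l) = \<Gamma> l"
  using sets_eq_imp_space_eq[OF \<mu>(2)] by (simp add: space_restrict_space)

lemma signed_measure_component:
  assumes l: "l \<in> I" and B: "B \<in> sets borel" "B \<subseteq> \<Gamma> l"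
  shows "\<Sigma> B = sg l * measure (\<mu> l) B"
proof -
  have "B \<in> sets (restrict_space borel \<Gamma>all)" using B l sets_ds_iff sets_ds by auto
  then have "\<Sigma> B = (\<Sum>k\<in>I. sg k * measure (\<mu> k) (B \<inter> \<Gamma> k))" by (simp add: \<Sigma>)
  also have "\<dots> = (\<Sum>k\<in>I. if k = l then sg l * measure (\<mu> l) B else 0)"
  proof (rule sum.cong[OF refl])
    fix k assume k: "k \<in> I"
    show "sg k * measure (\<mu> k) (B \<inter> \<Gamma> k) = (if k = l then sg l * measure (\<mu> l) B else 0)"
    proof (cases "k = l")
      case True then show ?thesis using B(2) by (simp add: Int_absorb2)
    next
      case False
      then have "B \<inter> \<Gamma> k = {}" using disjoint[OF l k] B(2) by auto
      then show ?thesis using False by simp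
    qed
  qed
  also have "\<dots> = sg l * measure (\<mu> l) B" using finite_I l by simp
  finally show ?thesis .
qed

lemma component_measure_eq:
  assumes l: "l \<in> I"
  shows "component_measure (\<Gamma> l) (sg l) \<Sigma> = \<mu> l"
proof -
  interpret finite_measure "\<mu> l" by (rule \<mu>(1)[OF l])
  have "component_measure (\<Gamma> l) (sg l) \<Sigma> = measure_of (space (\<mu> l)) (sets (\<mu> l)) (\<lambda>B. ennreal (sg l * \<Sigma> B))"
    by (simp add: component_measure_def \<mu>(2)[OF l] space_\<mu>[OF l])
  also have "\<dots> = measure_of (space (\<mu> l)) (sets (\<mu> l)) (emeasure (\<mu> l))"
  proof (rule measure_of_eq[OF sets.space_closed])
    fix B assume "B \<in> sigma_sets (space (\<mu> l)) (sets (\<mu> l))"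
    then have "B \<in> sets (\<mu> l)" by (simp add: sets.sigma_sets_eq)
    then have "B \<in> sets borel" "B \<subseteq> \<Gamma> l" using sets_\<Gamma>_iff[OF l] \<mu>(2)[OF l] by auto
    then have "sg l * \<Sigma> B = measure (\<mu> l) B"
      by (simp add: signed_measure_component[OF l] mult.assoc[symmetric] sign_square[OF l])
    then show "ennreal (sg l * \<Sigma> B) = emeasure (\<mu> l) B" by (simp add: emeasure_eq_measure)
  qed
  also have "\<dots> = \<mu> l" by (rule measure_of_of_measure)
  finally show ?thesis .
qed

text \<open>The sign has modulus one, so the signed and the nonnegative localized measure have the
  same energy.\<close>

lemma localized_fourier_eq:
  assumes l: "l \<in> I"
  shows "(cmod (localized_fourier (\<Gamma> l) (sg l) \<Sigma> (D l r) (X l r) (b l r) \<xi>))\<^sup>2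
    = (cmod (fourier_transform (localized_measure (\<mu> l) (D l r) (X l r) (b l r)) \<xi>))\<^sup>2"
proof -
  have "\<bar>sg l\<bar> = 1" using sign[OF l] by auto
  then show ?thesis by (simp add: localized_fourier_def component_measure_eq[OF l] norm_mult)
qed

text \<open>The local densities are added over the atlas. As the cutoffs sum to 1, the sum is a
  density of the component with respect to \<open>ds\<close>, and each summand passes the Sobolev
  test in every chart by \<open>sobolev_space_transition\<close>.\<close>

lemma finite_energy_imp_sobolev:
  assumes \<beta>: "0 < \<beta>" "\<beta> < 2"
    and en: "\<And>l r. l \<in> I \<Longrightarrow> r \<in> R l \<Longrightarrow> energy \<beta> (localized_measure (\<mu> l) (D l r) (X l r) (b l r)) < \<infinity>"
  shows "\<exists>\<sigma>\<in>sobolev_density_cone I \<Gamma> A ds sg (\<beta> / 2).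
       integrable ds \<sigma> \<and> (\<forall>B\<in>sets ds. \<Sigma> B = (LINT x:B|ds. \<sigma> x))"
proof -
  define g where "g l r = surface_chart.gram (D l r) (X l r) \<iota>" for l r
  \<comment> \<open>All that is needed of a local density is packed into one predicate, so that a
    density can be chosen for all \<open>l\<close> and \<open>r\<close> at once.\<close>
  define P where "P l r v \<longleftrightarrow> v \<in> sobolev_space (\<beta> / 2) \<and> (\<forall>u. 0 \<le> v u) \<and>
    (\<forall>u. u \<notin> cutoff_chart.K (\<Gamma> l) (X l r) (b l r) \<longrightarrow> v u = 0) \<and>
    (\<forall>B\<in>sets borel. B \<subseteq> D l r \<longrightarrow>
      (\<integral>\<^sup>+x\<in>B. ennreal (b l r x) \<partial>\<mu> l) = (\<integral>\<^sup>+x\<in>B. ennreal (v (X l r x) / g l r (X l r x)) \<partial>ds))" for l r v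
  define v where "v l r = (SOME v. P l r v)" for l r
  have v: "P l r (v l r)" if l: "l \<in> I" and r: "r \<in> R l" for l r
  proof -
    interpret cutoff_chart \<Gamma>all "\<Gamma> l" "D l r" "X l r" \<iota> ds "b l r" by (rule cutoff_chart[OF l r])
    have "\<exists>v. P l r v"
    proof (rule finite_energy_imp_local_density[OF \<mu>(1)[OF l] \<mu>(2)[OF l] \<beta> en[OF l r]])
      fix v assume "v \<in> sobolev_space (\<beta> / 2)" "\<And>u. 0 \<le> v u" "\<And>u. u \<notin> K \<Longrightarrow> v u = 0"
        "\<And>B. B \<in> sets borel \<Longrightarrow> B \<subseteq> D l r \<Longrightarrow>
          (\<integral>\<^sup>+x\<in>B. ennreal (b l r x) \<partial>\<mu> l) = (\<integral>\<^sup>+x\<in>B. ennreal (v (X l r x) / gram (X l r x)) \<partial>ds)"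
      then have "P l r v" unfolding P_def g_def by simp
      then show ?thesis by blast
    qed
    then show ?thesis unfolding v_def by (rule someI_ex)
  qed
  have v0: "0 \<le> v l r u" if "l \<in> I" "r \<in> R l" for l r u using v[OF that] by (simp add: P_def)
  have g0: "0 \<le> g l r u" if l: "l \<in> I" and r: "r \<in> R l" for l r u
  proof -
    interpret cutoff_chart \<Gamma>all "\<Gamma> l" "D l r" "X l r" \<iota> ds "b l r" by (rule cutoff_chart[OF l r])
    show ?thesis unfolding g_def by (rule gram_nonneg)
  qed
  \<comment> \<open>The density with respect to \<open>ds\<close> of the component times the cutoff,
    set to 0 outside the chart domain.\<close>
  define q where "q l r x = (if x \<in> D l r then v l r (X l r x) / g l r (X l r x) else 0)" for l r x
  have q0: "0 \<le> q l r x" if "l \<in> I" "r \<in> R l" for l r x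
    using v0[OF that] g0[OF that] by (simp add: q_def)
  have qm: "q l r \<in> borel_measurable ds" if l: "l \<in> I" and r: "r \<in> R l" for l r
  proof -
    interpret cutoff_chart \<Gamma>all "\<Gamma> l" "D l r" "X l r" \<iota> ds "b l r" by (rule cutoff_chart[OF l r])
    have [measurable]: "v l r \<in> borel_measurable borel" using v[OF l r] by (simp add: P_def sobolev_space_def)
    have [measurable]: "g l r \<in> borel_measurable borel" unfolding g_def by measurable
    have Xm: "X l r \<in> measurable (restrict_space ds (D l r)) borel" by (rule X_measurable'[OF S_\<Gamma> sets_ds])
    have "(\<lambda>x. v l r (X l r x) / g l r (X l r x)) \<in> borel_measurable (restrict_space ds (D l r))"
      using Xm by measurable
    then have "(\<lambda>x. indicator (D l r) x *\<^sub>R (v l r (X l r x) / g l r (X l r x))) \<in> borel_measurable ds"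
      by (subst (asm) borel_measurable_restrict_space_iff[OF sets.Int[OF D_ds sets.top]])
    then show ?thesis
      by (rule measurable_cong[THEN iffD1, rotated]) (simp add: q_def)
  qed
  define \<tau> where "\<tau> l x = (\<Sum>r\<in>R l. q l r x)" for l x
  have \<tau>0: "0 \<le> \<tau> l x" if "l \<in> I" for l x unfolding \<tau>_def by (intro sum_nonneg q0 that)
  have \<tau>m: "\<tau> l \<in> borel_measurable ds" if "l \<in> I" for l
    unfolding \<tau>_def by (intro borel_measurable_sum qm that)
  have \<mu>\<tau>: "(\<integral>\<^sup>+x\<in>B. ennreal (\<tau> l x) \<partial>ds) = emeasure (\<mu> l) B"
    if l: "l \<in> I" and B: "B \<in> sets borel" "B \<subseteq> \<Gamma> l" for l B
  proof -
    have Bds: "B \<in> sets ds" using B l by (auto simp: sets_ds_iff)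
    have B\<mu>: "B \<in> sets (\<mu> l)" using B by (simp add: \<mu>(2)[OF l] sets_\<Gamma>_iff[OF l])
    have D_borel: "D l r \<in> sets borel" "D l r \<subseteq> \<Gamma> l" if r: "r \<in> R l" for r
    proof -
      interpret cutoff_chart \<Gamma>all "\<Gamma> l" "D l r" "X l r" \<iota> ds "b l r" by (rule cutoff_chart[OF l r])
      show "D l r \<in> sets borel" "D l r \<subseteq> \<Gamma> l" by (rule D_borel D_S)+
    qed
    have "(\<integral>\<^sup>+x\<in>B. ennreal (\<tau> l x) \<partial>ds) = (\<integral>\<^sup>+x. (\<Sum>r\<in>R l. ennreal (q l r x) * indicator B x) \<partial>ds)"
      by (intro nn_integral_cong) (simp add: \<tau>_def sum_ennreal[symmetric] q0[OF l] sum_distrib_right del: sum_ennreal)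
    also have "\<dots> = (\<Sum>r\<in>R l. \<integral>\<^sup>+x\<in>B. ennreal (q l r x) \<partial>ds)"
      by (intro nn_integral_sum borel_measurable_times_ennreal borel_measurable_indicator Bds
          measurable_compose[OF qm[OF l] measurable_ennreal])
    also have "\<dots> = (\<Sum>r\<in>R l. \<integral>\<^sup>+x\<in>B \<inter> D l r. ennreal (b l r x) \<partial>\<mu> l)"
    proof (rule sum.cong[OF refl])
      fix r assume r: "r \<in> R l"
      have "(\<integral>\<^sup>+x\<in>B. ennreal (q l r x) \<partial>ds) = (\<integral>\<^sup>+x\<in>B \<inter> D l r. ennreal (v l r (X l r x) / g l r (X l r x)) \<partial>ds)"
        by (intro nn_integral_cong) (auto simp: q_def split: split_indicator)
      also have "\<dots> = (\<integral>\<^sup>+x\<in>B \<inter> D l r. ennreal (b l r x) \<partial>\<mu> l)"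
        using v[OF l r] B(1) D_borel(1)[OF r] unfolding P_def by auto
      finally show "(\<integral>\<^sup>+x\<in>B. ennreal (q l r x) \<partial>ds) = (\<integral>\<^sup>+x\<in>B \<inter> D l r. ennreal (b l r x) \<partial>\<mu> l)" .
    qed
    also have "\<dots> = (\<integral>\<^sup>+x. (\<Sum>r\<in>R l. ennreal (b l r x) * indicator (B \<inter> D l r) x) \<partial>\<mu> l)"
    proof (rule nn_integral_sum[symmetric])
      fix r assume r: "r \<in> R l"
      interpret cutoff_chart \<Gamma>all "\<Gamma> l" "D l r" "X l r" \<iota> ds "b l r" by (rule cutoff_chart[OF l r])
      show "(\<lambda>x. ennreal (b l r x) * indicator (B \<inter> D l r) x) \<in> borel_measurable (\<mu> l)"
        by (rule b_measurable_indicator[OF subset_refl component_borel[OF l] \<mu>(2)[OF l]]) (use B(1) D_borel in auto)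
    qed
    also have "\<dots> = (\<integral>\<^sup>+x. indicator B x \<partial>\<mu> l)"
    proof (rule nn_integral_cong)
      fix x assume "x \<in> space (\<mu> l)"
      then have x: "x \<in> \<Gamma> l" by (simp add: space_\<mu>[OF l])
      have "ennreal (b l r x) * indicator (B \<inter> D l r) x = ennreal (b l r x) * indicator B x" if r: "r \<in> R l" for r
      proof -
        interpret cutoff_chart \<Gamma>all "\<Gamma> l" "D l r" "X l r" \<iota> ds "b l r" by (rule cutoff_chart[OF l r])
        show ?thesis using b_eq_0[OF x] by (auto split: split_indicator)
      qed
      then have "(\<Sum>r\<in>R l. ennreal (b l r x) * indicator (B \<inter> D l r) x) = (\<Sum>r\<in>R l. ennreal (b l r x)) * indicator B x"
        by (simp add: sum_distrib_right)
      also have "(\<Sum>r\<in>R l. ennreal (b l r x)) = ennreal (\<Sum>r\<in>R l. b l r x)"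
        using partition[OF l] x by (intro sum_ennreal) (simp add: subordinate_partition_of_unity_def)
      finally show "(\<Sum>r\<in>R l. ennreal (b l r x) * indicator (B \<inter> D l r) x) = indicator B x"
        by (simp add: partition_sum[OF l x])
    qed
    also have "\<dots> = emeasure (\<mu> l) B" using B\<mu> by simp
    finally show ?thesis .
  qed
  have \<tau>s: "\<tau> l \<in> sobolev_space_on (\<Gamma> l) (A l) (\<beta> / 2)" if l: "l \<in> I" for l
    unfolding sobolev_space_on_def
  proof (intro CollectI ballI allI impI, safe)
    fix E Z \<zeta>
    assume EZ: "(E, Z) \<in> A l" and \<zeta>: "smooth_function (A l) \<zeta>" "closure {x\<in>\<Gamma> l. \<zeta> x \<noteq> 0} \<subseteq> E"
    have ss: "chart_on (\<Gamma> l) (E, Z)" "\<And>c. c \<in> A l \<Longrightarrow> compatible_charts (E, Z) c"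
    proof -
      note ss = smooth_structure_A[OF l, unfolded smooth_structure_def]
      show "chart_on (\<Gamma> l) (E, Z)" using ss EZ by blast
      show "\<And>c. c \<in> A l \<Longrightarrow> compatible_charts (E, Z) c" using ss EZ by (elim conjE) (drule (1) bspec)+
    qed
    have "smooth_map_on (Z ` E) (\<zeta> \<circ> inv_into E Z)"
      using \<zeta>(1) EZ unfolding smooth_function_def by fast
    then have *: "(\<lambda>u. if u \<in> Z ` E then \<zeta> (inv_into E Z u) * q l r (inv_into E Z u) else 0) \<in> sobolev_space (\<beta> / 2)"
      if r: "r \<in> R l" for r
    proof -
      assume sm: "smooth_map_on (Z ` E) (\<zeta> \<circ> inv_into E Z)"
      interpret cutoff_chart \<Gamma>all "\<Gamma> l" "D l r" "X l r" \<iota> ds "b l r" by (rule cutoff_chart[OF l r])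
      show ?thesis unfolding q_def g_def
        by (rule sobolev_space_transition[OF _ _ _ _ ss(1) ss(2)[OF chart_A[OF l r]] sm \<zeta>(2)])
          (use \<beta> v[OF l r] in \<open>auto simp: P_def\<close>)
    qed
    have "(\<lambda>u. if u \<in> Z ` E then \<zeta> (inv_into E Z u) * \<tau> l (inv_into E Z u) else 0)
      = (\<lambda>u. \<Sum>r\<in>R l. if u \<in> Z ` E then \<zeta> (inv_into E Z u) * q l r (inv_into E Z u) else 0)"
      by (auto simp: fun_eq_iff \<tau>_def sum_distrib_left)
    then show "(\<lambda>u. if u \<in> Z ` E then \<zeta> (inv_into E Z u) * \<tau> l (inv_into E Z u) else 0) \<in> sobolev_space (\<beta> / 2)"
      using sobolev_space_sum[OF *] by simp
  qed
  define \<sigma> where "\<sigma> = (\<lambda>x. \<Sum>l\<in>I. sg l * (indicator (\<Gamma> l) x * \<tau> l x))"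
  have \<sigma>: "\<sigma> \<in> sobolev_density_cone I \<Gamma> A ds sg (\<beta> / 2)"
    unfolding sobolev_density_cone_def \<sigma>_def using \<tau>s \<tau>0 by blast
  have int: "integrable ds (\<lambda>x. indicator B x * \<tau> l x)" and
    int_eq: "(LINT x|ds. indicator B x * \<tau> l x) = measure (\<mu> l) B"
    if l: "l \<in> I" and B: "B \<in> sets borel" "B \<subseteq> \<Gamma> l" for l B
  proof -
    interpret finite_measure "\<mu> l" by (rule \<mu>(1)[OF l])
    have Bds: "B \<in> sets ds" using B l by (auto simp: sets_ds_iff)
    have m: "(\<lambda>x. indicator B x * \<tau> l x) \<in> borel_measurable ds" using \<tau>m[OF l] Bds by measurable
    have e: "(\<integral>\<^sup>+x. ennreal (indicator B x * \<tau> l x) \<partial>ds) = ennreal (measure (\<mu> l) B)"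
      unfolding emeasure_eq_measure[symmetric] \<mu>\<tau>[OF l B, symmetric]
      by (intro nn_integral_cong) (auto split: split_indicator)
    show "integrable ds (\<lambda>x. indicator B x * \<tau> l x)"
      by (rule integrableI_nonneg[OF m]) (use \<tau>0[OF l] e in auto)
    show "(LINT x|ds. indicator B x * \<tau> l x) = measure (\<mu> l) B"
      by (rule integral_eq_nn_integral[THEN trans]) (use m \<tau>0[OF l] e in auto)
  qed
  have "integrable ds \<sigma>" unfolding \<sigma>_def
    by (intro Bochner_Integration.integrable_sum integrable_mult_right int) (auto simp: component_borel)
  moreover have "\<Sigma> B = (LINT x:B|ds. \<sigma> x)" if B: "B \<in> sets ds" for B
  proof -
    have Bb: "B \<in> sets borel" using B by (simp add: sets_ds_iff)
    have "(LINT x:B|ds. \<sigma> x) = (LINT x|ds. (\<Sum>l\<in>I. sg l * (indicator (B \<inter> \<Gamma> l) x * \<tau> l x)))"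
      unfolding set_lebesgue_integral_def \<sigma>_def
      by (intro Bochner_Integration.integral_cong refl) (auto simp: sum_distrib_left indicator_inter_arith mult_ac)
    also have "\<dots> = (\<Sum>l\<in>I. LINT x|ds. sg l * (indicator (B \<inter> \<Gamma> l) x * \<tau> l x))"
      by (intro Bochner_Integration.integral_sum integrable_mult_right int) (auto simp: component_borel Bb)
    also have "\<dots> = (\<Sum>l\<in>I. sg l * measure (\<mu> l) (B \<inter> \<Gamma> l))"
      by (intro sum.cong refl)
        (simp only: integral_mult_right_zero int_eq[OF _ sets.Int[OF Bb component_borel] Int_lower2])
    also have "\<dots> = \<Sigma> B" using B by (simp add: \<Sigma> sets_ds)
    finally show ?thesis ..
  qed
  ultimately show ?thesis using \<sigma> by blast
qed

text \<open>The Sobolev test in the given chart with the cutoff \<open>b l r\<close> itself is the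
  hypothesis of \<open>local_density_imp_finite_energy\<close>; what remains is to recognize the
  density as that of the component measure.\<close>

lemma sobolev_imp_finite_energy:
  assumes \<beta>: "0 < \<beta>" "\<beta> < 2"
    and \<sigma>: "\<sigma> \<in> sobolev_density_cone I \<Gamma> A ds sg (\<beta> / 2)" and int: "integrable ds \<sigma>"
    and \<Sigma>\<sigma>: "\<And>B. B \<in> sets ds \<Longrightarrow> \<Sigma> B = (LINT x:B|ds. \<sigma> x)"
    and l: "l \<in> I" and r: "r \<in> R l"
  shows "energy \<beta> (localized_measure (\<mu> l) (D l r) (X l r) (b l r)) < \<infinity>"
proof -
  obtain \<tau> where \<tau>s: "\<And>l. l \<in> I \<Longrightarrow> \<tau> l \<in> sobolev_space_on (\<Gamma> l) (A l) (\<beta> / 2)"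
    and \<tau>0: "\<And>l. l \<in> I \<Longrightarrow> AE x in ds. x \<in> \<Gamma> l \<longrightarrow> 0 \<le> \<tau> l x"
    and \<sigma>_eq: "\<sigma> = (\<lambda>x. \<Sum>l\<in>I. sg l * (indicator (\<Gamma> l) x * \<tau> l x))"
    using \<sigma> unfolding sobolev_density_cone_def by blast
  interpret cutoff_chart \<Gamma>all "\<Gamma> l" "D l r" "X l r" \<iota> ds "b l r" by (rule cutoff_chart[OF l r])
  interpret \<mu>: finite_measure "\<mu> l" by (rule \<mu>(1)[OF l])
  have \<Gamma>ds: "\<Gamma> l \<in> sets ds" using l component_borel[OF l] by (auto simp: sets_ds_iff)
  have \<sigma>l: "\<sigma> x = sg l * \<tau> l x" if x: "x \<in> \<Gamma> l" for x
  proof -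
    have "\<sigma> x = (\<Sum>k\<in>I. if k = l then sg l * \<tau> l x else 0)"
      unfolding \<sigma>_eq
    proof (rule sum.cong[OF refl])
      fix k assume "k \<in> I"
      then show "sg k * (indicator (\<Gamma> k) x * \<tau> k x) = (if k = l then sg l * \<tau> l x else 0)"
        using disjoint[OF l, of k] x by (auto split: split_indicator)
    qed
    then show ?thesis using finite_I l by simp
  qed
  \<comment> \<open>On the component this equals \<tau>, as the sign squares to 1. No measurability
    with respect to \<open>ds\<close> is given for \<tau>, whereas \<open>t\<close> inherits it from
    the integrable \<sigma>.\<close>
  define t where "t x = sg l * (indicator (\<Gamma> l) x * \<sigma> x)" for x
  have t\<tau>: "t x = \<tau> l x" if "x \<in> \<Gamma> l" for x
    using that sign_square[OF l] by (simp add: t_def \<sigma>l mult.assoc[symmetric])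
  have t_int: "integrable ds (\<lambda>x. indicator B x * t x)" if "B \<in> sets ds" for B
    unfolding t_def using integrable_mult_indicator[OF sets.Int[OF that \<Gamma>ds] int]
    by (simp add: mult.left_commute[of _ "sg l"] indicator_inter_arith mult.assoc)
  have tm: "t \<in> borel_measurable ds"
    unfolding t_def using borel_measurable_integrable[OF int] \<Gamma>ds by measurable
  have t0: "AE x in ds. x \<in> \<Gamma> l \<longrightarrow> 0 \<le> t x"
    using \<tau>0[OF l] by eventually_elim (simp add: t\<tau>)
  show ?thesis
  proof (rule local_density_imp_finite_energy[OF \<mu>(1)[OF l] \<mu>(2)[OF l] \<beta> tm t0])
    fix B assume B: "B \<in> sets borel" "B \<subseteq> \<Gamma> l"
    have Bds: "B \<in> sets ds" using B l by (auto simp: sets_ds_iff)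
    have "measure (\<mu> l) B = sg l * \<Sigma> B"
      by (simp add: signed_measure_component[OF l B] mult.assoc[symmetric] sign_square[OF l])
    also have "\<dots> = (LINT x|ds. sg l * (indicator B x * \<sigma> x))"
      by (simp add: \<Sigma>\<sigma>[OF Bds] set_lebesgue_integral_def)
    also have "\<dots> = (LINT x|ds. indicator B x * t x)"
      using B(2) by (intro Bochner_Integration.integral_cong refl) (auto simp: t_def split: split_indicator)
    finally have "emeasure (\<mu> l) B = ennreal (LINT x|ds. indicator B x * t x)"
      by (simp add: \<mu>.emeasure_eq_measure)
    also have "\<dots> = (\<integral>\<^sup>+x. ennreal (indicator B x * t x) \<partial>ds)"
    proof (rule nn_integral_eq_integral[symmetric, OF t_int[OF Bds]])
      show "AE x in ds. 0 \<le> indicator B x * t x"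
        using t0 by eventually_elim (use B(2) in \<open>auto split: split_indicator\<close>)
    qed
    also have "\<dots> = (\<integral>\<^sup>+x\<in>B. ennreal (t x) \<partial>ds)"
      by (intro nn_integral_cong) (auto split: split_indicator)
    finally show "emeasure (\<mu> l) B = (\<integral>\<^sup>+x\<in>B. ennreal (t x) \<partial>ds)" .
  next
    have sf: "smooth_function (A l) (b l r)"
      using partition[OF l] r by (simp add: subordinate_partition_of_unity_def)
    have "(\<lambda>u. if u \<in> X l r ` D l r then b l r (Y u) * \<tau> l (Y u) else 0) \<in> sobolev_space (\<beta> / 2)"
      using \<tau>s[OF l] chart_A[OF l r] sf b_support unfolding sobolev_space_on_def by fast
    moreover have "(\<lambda>u. if u \<in> X l r ` D l r then b l r (Y u) * \<tau> l (Y u) else 0)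
      = (\<lambda>u. if u \<in> X l r ` D l r then b l r (Y u) * t (Y u) else 0)"
    proof
      fix u
      show "(if u \<in> X l r ` D l r then b l r (Y u) * \<tau> l (Y u) else 0)
        = (if u \<in> X l r ` D l r then b l r (Y u) * t (Y u) else 0)"
        using t\<tau>[OF subsetD[OF D_S Y_D]] by simp
    qed
    ultimately show "(\<lambda>u. if u \<in> X l r ` D l r then b l r (Y u) * t (Y u) else 0) \<in> sobolev_space (\<beta> / 2)"
      by simp
  qed
qed

end

end

text \<open>The order \<beta>/2 comes from matching the Gagliardo exponent m + 2s with the exponent
  m + \<beta> that the weight |\<xi>|^\<beta> produces. Each inclusion unpacks the component
  measures from the common cone.\<close>

theorem theorem3p4:
  fixes \<alpha> \<beta> :: real
    and I :: "'l set"
    and \<Gamma> :: "'l \<Rightarrow> 'a::t2_space set"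
    and A :: "'l \<Rightarrow> ('a, 'm::finite) chart set"
    and \<iota> :: "'a \<Rightarrow> real ^ 'n::finite"
    and ds :: "'a measure"
    and sg :: "'l \<Rightarrow> real"
    and R :: "'l \<Rightarrow> 'r set"
    and D :: "'l \<Rightarrow> 'r \<Rightarrow> 'a set"
    and X :: "'l \<Rightarrow> 'r \<Rightarrow> 'a \<Rightarrow> real ^ 'm"
    and b :: "'l \<Rightarrow> 'r \<Rightarrow> 'a \<Rightarrow> real"
  assumes "CARD('n) \<ge> 2" and "CARD('m) = CARD('n) - 1"
    and "-1 < \<alpha>" and "\<alpha> < 1" and "\<beta> = 1 - \<alpha>"
    and "finite I"
    and "\<And>l. l \<in> I \<Longrightarrow> closed_immersed_manifold (\<Gamma> l) (A l) \<iota>"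
    and "disjoint_family_on (\<lambda>l. \<iota> ` \<Gamma> l) I"
    and "surface_measure I \<Gamma> A \<iota> ds"
    and "\<And>l. l \<in> I \<Longrightarrow> sg l \<in> {-1, 1}"
    and "\<And>l. l \<in> I \<Longrightarrow> finite_atlas (\<Gamma> l) (A l) (R l) (D l) (X l)"
    and "\<And>l. l \<in> I \<Longrightarrow> subordinate_partition_of_unity (\<Gamma> l) (A l) (R l) (D l) (b l)"
  shows "finite_energy_cone I \<Gamma> sg R D X b \<alpha> = sobolev_measure_cone I \<Gamma> A ds sg (\<beta> / 2)"
proof -
  interpret surface_family I \<Gamma> A \<iota> ds sg R D X b
    by (rule surface_family.intro) (use assms(6-12) in auto)
  \<comment> \<open>The range of \<alpha> places \<beta>/2 strictly between 0 and 1, where the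
    double integral definition of the Sobolev space is meaningful.\<close>
  have \<beta>: "0 < \<beta>" "\<beta> < 2" "1 - \<alpha> = \<beta>" using assms(3-5) by auto
  show ?thesis
  proof (intro equalityI subsetI)
    fix \<Sigma> assume \<Sigma>: "\<Sigma> \<in> finite_energy_cone I \<Gamma> sg R D X b \<alpha>"
    then have cone: "\<Sigma> \<in> signed_measure_cone I \<Gamma> sg" by (simp add: finite_energy_cone_def)
    then obtain \<mu> where \<mu>: "\<And>l. l \<in> I \<Longrightarrow> finite_measure (\<mu> l)"
      "\<And>l. l \<in> I \<Longrightarrow> sets (\<mu> l) = sets (restrict_space borel (\<Gamma> l))"
      "\<Sigma> = (\<lambda>B. if B \<in> sets (restrict_space borel \<Gamma>all) then \<Sum>l\<in>I. sg l * measure (\<mu> l) (B \<inter> \<Gamma> l) else 0)"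
      unfolding signed_measure_cone_def by blast
    have "\<exists>\<sigma>\<in>sobolev_density_cone I \<Gamma> A ds sg (\<beta> / 2).
       integrable ds \<sigma> \<and> (\<forall>B\<in>sets ds. \<Sigma> B = (LINT x:B|ds. \<sigma> x))"
    proof (rule finite_energy_imp_sobolev[OF \<mu> \<beta>(1,2)])
      fix l r assume "l \<in> I" "r \<in> R l"
      then show "energy \<beta> (localized_measure (\<mu> l) (D l r) (X l r) (b l r)) < \<infinity>"
        using \<Sigma> by (simp add: finite_energy_cone_def \<beta>(3) localized_fourier_eq[OF \<mu>])
    qed
    then show "\<Sigma> \<in> sobolev_measure_cone I \<Gamma> A ds sg (\<beta> / 2)"
      using cone by (simp add: sobolev_measure_cone_def)
  next
    fix \<Sigma> assume "\<Sigma> \<in> sobolev_measure_cone I \<Gamma> A ds sg (\<beta> / 2)"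
    then obtain \<sigma> where cone: "\<Sigma> \<in> signed_measure_cone I \<Gamma> sg"
      and \<sigma>: "\<sigma> \<in> sobolev_density_cone I \<Gamma> A ds sg (\<beta> / 2)" "integrable ds \<sigma>"
        "\<And>B. B \<in> sets ds \<Longrightarrow> \<Sigma> B = (LINT x:B|ds. \<sigma> x)"
      unfolding sobolev_measure_cone_def by blast
    from cone obtain \<mu> where \<mu>: "\<And>l. l \<in> I \<Longrightarrow> finite_measure (\<mu> l)"
      "\<And>l. l \<in> I \<Longrightarrow> sets (\<mu> l) = sets (restrict_space borel (\<Gamma> l))"
      "\<Sigma> = (\<lambda>B. if B \<in> sets (restrict_space borel \<Gamma>all) then \<Sum>l\<in>I. sg l * measure (\<mu> l) (B \<inter> \<Gamma> l) else 0)"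
      unfolding signed_measure_cone_def by blast
    show "\<Sigma> \<in> finite_energy_cone I \<Gamma> sg R D X b \<alpha>"
      using cone sobolev_imp_finite_energy[OF \<mu> \<beta>(1,2) \<sigma>]
      by (simp add: finite_energy_cone_def \<beta>(3) localized_fourier_eq[OF \<mu>])
  qed
qed

end
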